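(* Let $q\geq 3$ and let $\chi$ be a real non-principal Dirichlet character modulo $q$. Let $g_\chi:\mathbb{N}\to\{-1,1\}$ be the completely multiplicative function determined on primes by $g_\chi(p)=\chi(p)$ if $p\nmid q$ and $g_\chi(p)=1$ if $p\mid q$. Let $f=\mu^2 g_\chi$, where $\mu$ is the M\"obius function, and let $M_f(x)=\sum_{n\leq x} f(n)$. Then $M_f(x)=\Omega(x^{1/4})$, i.e. there is a constant $c>0$ such that $|M_f(x)|\geq c\,x^{1/4}$ for arbitrarily large values of $x$.
   Context: This result is unconditional. $\Omega$ denotes the negation of $o$: $M_f(x)=\Omega(x^{1/4})$ means $M_f(x)\neq o(x^{1/4})$. *)

theory Defs
  imports "HOL-Analysis.Analysis" "HOL-Number_Theory.Number_Theory" "HOL-Computational_Algebra.Squarefree" "HOL-Library.Landau_Symbols"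
begin

(* Dirichlet characters are taken as functions on the natural numbers; by periodicity such a
   function extends uniquely to the integers.  The value chi 1 = 1 is not listed because it follows
   from chi 1 = chi 1 * chi 1 and chi 1 \<noteq> 0. *)
definition dirichlet_character :: "nat \<Rightarrow> (nat \<Rightarrow> complex) \<Rightarrow> bool" where
  "dirichlet_character q chi \<longleftrightarrow>
     q > 0 \<and>
     (\<forall>n. chi (n + q) = chi n) \<and>
     (\<forall>m n. chi (m * n) = chi m * chi n) \<and>
     (\<forall>n. chi n \<noteq> 0 \<longleftrightarrow> coprime n q)"

definition principal_character :: "nat \<Rightarrow> nat \<Rightarrow> complex" where
  "principal_character q n = (if coprime n q then 1 else 0)"

definition real_character :: "(nat \<Rightarrow> complex) \<Rightarrow> bool" where
  "real_character chi \<longleftrightarrow> (\<forall>n. chi n \<in> \<real>)"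

(* Arithmetic functions have domain {1, 2, ...}; their value at the argument 0 is irrelevant. *)
definition completely_multiplicative :: "(nat \<Rightarrow> int) \<Rightarrow> bool" where
  "completely_multiplicative g \<longleftrightarrow>
     g 1 = 1 \<and> (\<forall>m>0. \<forall>n>0. g (m * n) = g m * g n)"

(* g is the function written g_chi, for the character chi modulo q.  These conditions determine g on
   the positive integers, see char_extension_exists and char_extension_unique. *)
definition is_char_extension :: "nat \<Rightarrow> (nat \<Rightarrow> complex) \<Rightarrow> (nat \<Rightarrow> int) \<Rightarrow> bool" where
  "is_char_extension q chi g \<longleftrightarrow>
     (\<forall>n>0. g n \<in> {-1, 1}) \<and>
     completely_multiplicative g \<and>
     (\<forall>p. prime p \<longrightarrow> \<not> p dvd q \<longrightarrow> of_int (g p) = chi p) \<and>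
     (\<forall>p. prime p \<longrightarrow> p dvd q \<longrightarrow> g p = 1)"

definition moebius_mu :: "nat \<Rightarrow> int" where
  "moebius_mu n = (if squarefree n then (-1) ^ card (prime_factors n) else 0)"

definition summatory :: "(nat \<Rightarrow> int) \<Rightarrow> real \<Rightarrow> real" where
  "summatory f x = (\<Sum>n | n > 0 \<and> real n \<le> x. real_of_int (f n))"

lemma real_character_values:
  assumes "dirichlet_character q chi" "real_character chi" "coprime n q"
  shows "chi n = 1 \<or> chi n = -1"
proof -
  have mult: "chi (a * b) = chi a * chi b" and per: "chi (a + q) = chi a"
    and nz: "chi a \<noteq> 0 \<longleftrightarrow> coprime a q" and q: "q > 0" for a b
    using assms(1) by (auto simp: dirichlet_character_def)
  have per': "chi (a + k * q) = chi a" for a k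
  proof (induction k)
    case (Suc k)
    have "chi (a + Suc k * q) = chi ((a + k * q) + q)" by (simp add: algebra_simps)
    then show ?case using Suc per by simp
  qed simp
  have permod: "chi (a mod q) = chi a" for a
    using per'[of "a mod q" "a div q"] by (simp add: mod_div_mult_eq)
  have one: "chi 1 = 1"
    using mult[of 1 1] nz[of 1] by simp
  have pow: "chi (n ^ k) = chi n ^ k" for k
    by (induction k) (use one mult in auto)
  have "[n ^ totient q = 1] (mod q)"
    using assms(3) by (rule euler_theorem)
  then have "chi (n ^ totient q) = 1"
    using permod one unfolding cong_def by metis
  then have *: "chi n ^ totient q = 1" using pow by simp
  have "totient q > 0" using q by simp
  with * have "norm (chi n) = 1"
    by (metis norm_power norm_one norm_ge_zero power_eq_1_iff less_numeral_extra(3))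
  moreover obtain r where r: "chi n = of_real r"
    using assms(2) by (auto simp: real_character_def elim: Reals_cases)
  ultimately have "r = 1 \<or> r = -1" by auto
  with r show ?thesis by auto
qed

lemma char_extension_exists:
  assumes "dirichlet_character q chi" "real_character chi"
  shows "\<exists>g. is_char_extension q chi g"
proof -
  define h :: "nat \<Rightarrow> int" where "h p = (if p dvd q \<or> chi p = 1 then 1 else -1)" for p
  define g where "g n = (\<Prod>p\<in>#prime_factorization n. h p)" for n
  have gp: "g p = h p" if "prime p" for p
    using that by (simp add: g_def prime_factorization_prime)
  have mset: "(\<Prod>p\<in>#A. h p) \<in> {-1, 1}" for A
    by (induction A) (auto simp: h_def)
  have "completely_multiplicative g"
    by (auto simp: completely_multiplicative_def g_def prime_factorization_mult)
  moreover have "of_int (g p) = chi p" if "prime p" "\<not> p dvd q" for p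
    using real_character_values[OF assms, of p] that prime_imp_coprime[of p q]
    by (auto simp: gp h_def)
  moreover have "g p = 1" if "prime p" "p dvd q" for p
    using that by (simp add: gp h_def)
  ultimately show ?thesis
    unfolding is_char_extension_def using mset g_def by metis
qed

lemma char_extension_unique:
  assumes "is_char_extension q chi g" "is_char_extension q chi h" "n > 0"
  shows "g n = h n"
  using assms(3)
proof (induction n rule: less_induct)
  case (less n)
  have primes: "g p = h p" if "prime p" for p
  proof (cases "p dvd q")
    case False
    then have "(of_int (g p) :: complex) = of_int (h p)"
      using assms that by (simp add: is_char_extension_def)
    then show ?thesis by simp
  qed (use assms that in \<open>simp add: is_char_extension_def\<close>)
  show ?case
  proof (cases "n = 1")
    case True
    then show ?thesis
      using assms by (simp add: is_char_extension_def completely_multiplicative_def)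
  next
    case False
    then obtain p where p: "prime p" "p dvd n" using prime_factor_nat by blast
    then obtain m where n: "n = p * m" by (elim dvdE)
    have "p > 1" using prime_gt_1_nat[OF p(1)] .
    with n less.prems have "m > 0" "m < n" by auto
    then show ?thesis
      using assms n less.IH[of m] primes[OF p(1)] \<open>p > 1\<close>
      by (simp add: is_char_extension_def completely_multiplicative_def)
  qed
qed

end

theory Submission
  imports Defs "HOL-Probability.Probability" "HOL-Complex_Analysis.Complex_Analysis"
begin

text \<open>Let \<open>F(s)\<close> be the Dirichlet series of \<open>f\<close>. Up to finitely many Euler factors,
  \<open>F(s) \<zeta>(2s) = L(s)\<close>, where \<open>L\<close> belongs to the primitive character inducing \<open>\<chi>\<close>. If
  \<open>M\<^sub>f(x) = o(x\<^bsup>1/4\<^esup>)\<close>, then \<open>F\<close> is holomorphic for \<open>Re s > 1/4\<close> and cannot behave like a pole at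
  any point of the line \<open>Re s = 1/4\<close>; so every zero of \<open>\<zeta>(2s)\<close> with \<open>Re s \<ge> 1/4\<close> is a zero of \<open>L\<close> with
  at least the same multiplicity. Let \<open>\<Lambda>(s) = \<kappa>\<^sup>-\<^sup>1 \<Lambda>(1 - s)\<close> and \<open>\<Xi>(s) = \<Xi>(1/2 - s)\<close> be the entire
  completions of \<open>L(s)\<close> and \<open>\<zeta>(2s)\<close>. A zero \<open>\<rho>\<close> of \<open>\<Xi>\<close> to the left of \<open>Re s = 1/4\<close> gives a zero
  \<open>1/2 - \<rho>\<close> of \<open>\<Xi>\<close> on the right, hence the zero \<open>\<rho> + 1/2\<close> of \<open>\<Lambda>\<close>. Therefore the product of the four
  functions \<open>\<Lambda>(s + j/2)\<close>, \<open>0 \<le> j \<le> 3\<close>, is divisible by the product of the three functions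
  \<open>\<Xi>(s + j/2)\<close>, \<open>0 \<le> j \<le> 2\<close>. The quotient is an entire function of exponential type, but the Gamma
  factors, about \<open>\<Gamma>(s)\<^sup>2\<close> in the numerator and \<open>\<Gamma>(s)\<^sup>3\<close> in the denominator, make it decay like
  \<open>1/\<Gamma>(s)\<close> in the right half-plane. Such a function vanishes identically, contradicting
  \<open>\<Lambda> \<noteq> 0\<close>.\<close>

section \<open>Poisson summation\<close>

text \<open>Why a contradiction is to be expected: a zero \<rho> of \<Xi> with Re \<rho> \<ge> 1/4
  forces the two zeros \<rho> and 1 - \<rho> of \<Lambda>, so \<Lambda> has at least as many zeros
  as \<Xi>, whereas asymptotically \<Xi> has twice as many as \<Lambda>. Division replaces the
  counting. With n factors \<Xi> against n + 1 factors \<Lambda> the Gamma factors are about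
  \<Gamma>(s)^n against \<Gamma>(s)^((n+1)/2): n = 1 only balances, every larger n wins, and n = 3
  pairs the numerator for the duplication formula. The shifts by 1/2 fit the strip 0 < Re s < 1/2
  that contains all zeros of \<Xi>: the shifted open strips are disjoint, so at most one factor of
  the denominator vanishes at a point. This rests on \<zeta> having no zero on Re s = 1. The
  obstacle is to bound the quotient where 1/\<zeta> is not under control. There one ratio
  \<Lambda>/\<Xi>, reflected if necessary, is expressed by the Dirichlet series, which partial
  summation bounds except near finitely many vertical lines; a maximum principle removes the
  lines.\<close>

lemma cos_sq_near:
  fixes y a :: real
  assumes "\<bar>y\<bar> \<le> a" "a \<le> 1/2"
  shows "(cos (pi * a))\<^sup>2 \<le> (cos (pi * y))\<^sup>2"
proof (rule power_mono)
  have "pi * \<bar>y\<bar> \<le> pi * a" "pi * a \<le> pi * (1/2)" "pi * \<bar>y\<bar> \<ge> 0"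
    using assms by (simp_all add: mult_left_mono)
  then have "cos (pi * a) \<le> cos (pi * \<bar>y\<bar>)" "0 \<le> cos (pi * a)"
    using pi_gt_zero by (intro cos_monotone_0_pi_le cos_ge_zero; linarith)+
  moreover have "cos (pi * \<bar>y\<bar>) = cos (pi * y)"
    by (cases "y \<ge> 0") simp_all
  ultimately show "cos (pi * a) \<le> cos (pi * y)" "0 \<le> cos (pi * a)" by simp_all
qed

lemma cos_sq_far:
  fixes y a :: real
  assumes "a \<le> \<bar>y\<bar>" "\<bar>y\<bar> \<le> 1 - a" "0 < a" "a \<le> 1/2"
  shows "(cos (pi * y))\<^sup>2 \<le> (cos (pi * a))\<^sup>2"
proof -
  have "pi * a \<le> pi * \<bar>y\<bar>" "pi * \<bar>y\<bar> \<le> pi * (1 - a)" "pi * a \<le> pi * (1/2)" "pi * a \<ge> 0"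
    using assms by (simp_all only: mult_left_mono pi_ge_zero mult_nonneg_nonneg less_imp_le)
  moreover have "pi * (1 - a) = pi - pi * a" by (simp add: right_diff_distrib)
  ultimately have "cos (pi * \<bar>y\<bar>) \<le> cos (pi * a)" "cos (pi - pi * a) \<le> cos (pi * \<bar>y\<bar>)"
    using pi_gt_zero by (intro cos_monotone_0_pi_le; linarith)+
  moreover have "cos (pi * \<bar>y\<bar>) = cos (pi * y)"
    by (cases "y \<ge> 0") simp_all
  ultimately have "\<bar>cos (pi * y)\<bar> \<le> \<bar>cos (pi * a)\<bar>" by simp
  then show ?thesis by (simp only: abs_le_square_iff)
qed

text \<open>High powers of \<open>K\<close> favour the places where \<open>K\<close> is large: the
  interval contributes at least a fixed multiple of \<open>r1 ^ k\<close>, the points with negative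
  \<open>w\<close> cost at most \<open>B * r2 ^ k\<close>, and \<open>r2 / r1 < 1\<close>.\<close>

lemma kernel_concentration:
  fixes w K :: "real \<Rightarrow> real"
  assumes contw: "continuous_on {0..1} w" and contK: "continuous_on {0..1} K"
    and lr: "0 \<le> l" "l < r" "r \<le> 1" and c: "c > 0" and B: "B > 0" and r12: "r1 > r2" "r2 \<ge> 0"
    and mid: "\<And>x. x \<in> {l..r} \<Longrightarrow> w x \<ge> c \<and> K x \<ge> r1"
    and out: "\<And>x. x \<in> {0..1} \<Longrightarrow> w x < 0 \<Longrightarrow> - B \<le> w x \<and> K x \<le> r2"
    and K0: "\<And>x. K x \<ge> 0"
  shows "\<exists>k. integral {0..1} (\<lambda>x. w x * K x ^ k) > 0"
proof (rule ccontr)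
  assume "\<not> ?thesis"
  then have le: "integral {0..1} (\<lambda>x. w x * K x ^ k) \<le> 0" for k by (metis not_less)
  have ineq: "(r - l) * (c * r1 ^ k) \<le> B * r2 ^ k" for k
  proof -
    have pt: "(if x \<in> {l..r} then c * r1 ^ k else 0) - B * r2 ^ k \<le> w x * K x ^ k" if x: "x \<in> {0..1}" for x
    proof -
      have Br: "0 \<le> B * r2 ^ k" using B r12 by simp
      consider "x \<in> {l..r}" | "x \<notin> {l..r}" "w x \<ge> 0" | "x \<notin> {l..r}" "w x < 0" by linarith
      then show ?thesis
      proof cases
        case 1
        have "c * r1 ^ k \<le> w x * K x ^ k"
          using mid[OF 1] c r12 by (intro mult_mono power_mono) auto
        then show ?thesis using 1 Br by simp
      next
        case 2
        have "0 \<le> w x * K x ^ k" using 2 K0 by simp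
        then show ?thesis unfolding if_not_P[OF 2(1)] using Br by linarith
      next
        case 3
        have "- w x * K x ^ k \<le> B * r2 ^ k"
          using out[OF x 3(2)] B K0 3 by (intro mult_mono power_mono) auto
        then show ?thesis unfolding if_not_P[OF 3(1)] by simp
      qed
    qed
    have 1: "((\<lambda>x. if x \<in> {l..r} then c * r1^k else 0) has_integral ((r - l) * (c * r1^k))) {0..1}"
    proof -
      have "((\<lambda>x. c * r1^k) has_integral ((r - l) * (c * r1^k))) {l..r}"
        using has_integral_const_real[of "c * r1^k" l r] lr by simp
      then show ?thesis
        using lr by (subst has_integral_restrict) auto
    qed
    have 2: "((\<lambda>x::real. B * r2 ^ k) has_integral B * r2 ^ k) {0..1}"
      using has_integral_const_real[of "B * r2 ^ k" 0 "1::real"] by simp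
    have 3: "(\<lambda>x. w x * K x ^ k) integrable_on {0..1}"
      by (intro integrable_continuous_real continuous_intros contw contK)
    have "(r - l) * (c * r1^k) - B * r2^k \<le> integral {0..1} (\<lambda>x. w x * K x ^ k)"
      by (rule has_integral_le[OF has_integral_diff[OF 1 2] integrable_integral[OF 3] pt])
    then show ?thesis using le[of k] by linarith
  qed
  have r1pos: "r1 > 0" using r12 by linarith
  have "(\<lambda>k. B * (r2 / r1) ^ k) \<longlonglongrightarrow> B * 0"
    using r12 r1pos by (intro tendsto_intros LIMSEQ_realpow_zero) auto
  moreover have "(r - l) * c \<le> B * (r2 / r1) ^ k" for k
    using ineq[of k] r1pos by (simp add: power_divide field_simps)
  ultimately have "(r - l) * c \<le> B * 0"
    by (intro tendsto_lowerbound[where f = "\<lambda>k. B * (r2/r1)^k" and F = sequentially]) auto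
  moreover have "(r - l) * c > 0" using lr c by simp
  ultimately show False by linarith
qed

text \<open>The powers of cos^2(pi (x - x0)) are trigonometric polynomials, so their integrals
  against \<open>D\<close> vanish; but they concentrate at \<open>x0\<close> and would detect a
  nonzero value there. For an interior point the peak has a whole neighbourhood inside
  [0, 1].\<close>

lemma fourier_unique_interior:
  fixes D :: "real \<Rightarrow> complex"
  assumes cont: "continuous_on UNIV D"
    and coef: "\<And>m::int. integral {0..1} (\<lambda>x. D x * cis (2 * pi * of_int m * x)) = 0"
    and x0: "0 < x0" "x0 < 1"
  shows "D x0 = 0"
proof (rule ccontr)
  assume nz: "D x0 \<noteq> 0"
  define v where "v = D x0"
  define K where "K x = (cos (pi * (x - x0)))\<^sup>2" for x :: real
  have contD: "continuous_on A D" for A using cont continuous_on_subset by blast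
  have contK: "continuous_on A K" for A unfolding K_def by (intro continuous_intros)
  have contc: "continuous_on A (\<lambda>x. cis (2 * pi * of_int m * x))" for A and m :: int
    by (intro continuous_intros)
  have Kexp: "complex_of_real (K x) = 1/2 + (cis (-2*pi*x0) / 4) * cis (2*pi * of_int 1 * x)
      + (cis (2*pi*x0) / 4) * cis (2*pi * of_int (-1) * x)" for x
  proof -
    have "K x = (1 + cos (2 * pi * (x - x0))) / 2"
      unfolding K_def using cos_double_cos[of "pi * (x - x0)"] by (simp add: mult.assoc)
    moreover have "cis (-2*pi*x0) * cis (2*pi * of_int 1 * x) = cis (2*pi*(x-x0))"
      "cis (2*pi*x0) * cis (2*pi * of_int (-1) * x) = cis (-(2*pi*(x-x0)))"
      by (simp_all add: cis_mult algebra_simps)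
    ultimately show ?thesis
      by (simp add: complex_eq_iff field_simps)
  qed
  \<comment> \<open>Multiplication by \<open>K\<close> only shifts the frequency by -1, 0 or 1, so
    the induction has to range over all \<open>m\<close>.\<close>
  have zero: "integral {0..1} (\<lambda>x. D x * cis (2 * pi * of_int m * x) * of_real (K x) ^ k) = 0" for k and m :: int
  proof (induction k arbitrary: m)
    case 0
    then show ?case using coef by simp
  next
    case (Suc k)
    let ?g = "\<lambda>m x. D x * cis (2 * pi * of_int m * x) * complex_of_real (K x) ^ k"
    have int: "?g m integrable_on {0..1}" for m
      by (intro integrable_continuous_real continuous_intros contD contK)
    have "?g m x * of_real (K x) = 1/2 * ?g m x + (cis (-2*pi*x0) / 4) * ?g (m+1) x + (cis (2*pi*x0) / 4) * ?g (m-1) x" for x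
    proof -
      have "cis (2 * pi * of_int (m+1) * x) = cis (2 * pi * of_int m * x) * cis (2*pi * of_int 1 * x)"
        "cis (2 * pi * of_int (m-1) * x) = cis (2 * pi * of_int m * x) * cis (2*pi * of_int (-1) * x)"
        by (simp_all add: cis_mult algebra_simps)
      then show ?thesis unfolding Kexp by (simp only:) (simp add: algebra_simps)
    qed
    then have eq: "(\<lambda>x. D x * cis (2 * pi * of_int m * x) * of_real (K x) ^ Suc k)
       = (\<lambda>x. 1/2 * ?g m x + (cis (-2*pi*x0) / 4) * ?g (m+1) x + (cis (2*pi*x0) / 4) * ?g (m-1) x)"
      by (auto simp: fun_eq_iff mult_ac)
    show ?case unfolding eq
    proof (rule integral_unique)
      have g0: "(?g m has_integral 0) {0..1}" for m
        using integrable_integral[OF int[of m]] Suc.IH[of m] by simp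
      show "((\<lambda>x. 1/2 * ?g m x + (cis (-2*pi*x0) / 4) * ?g (m+1) x + (cis (2*pi*x0) / 4) * ?g (m-1) x) has_integral 0) {0..1}"
        using has_integral_add[OF has_integral_add[OF has_integral_mult_right[OF g0[of m], of "1/2"]
            has_integral_mult_right[OF g0[of "m+1"], of "cis (-2*pi*x0) / 4"]]
            has_integral_mult_right[OF g0[of "m-1"], of "cis (2*pi*x0) / 4"]]
        by (simp only: mult_zero_right add_0_right)
    qed
  qed
  \<comment> \<open>The factor \<open>cnj v\<close> rotates the value at \<open>x0\<close> to the
    positive number |v|^2, which makes a comparison of signs possible.\<close>
  define w where "w x = Re (D x * cnj v)" for x
  have contw: "continuous_on A w" for A unfolding w_def by (intro continuous_intros contD)
  have wzero: "integral {0..1} (\<lambda>x. w x * K x ^ k) = 0" for k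
  proof -
    let ?H = "\<lambda>x. D x * cis (2 * pi * of_int 0 * x) * complex_of_real (K x) ^ k"
    have "?H integrable_on {0..1}"
      by (intro integrable_continuous_real continuous_intros contD contK)
    then have "(?H has_integral 0) {0..1}"
      using zero[of 0 k] by (metis integrable_integral)
    from has_integral_linear[OF has_integral_mult_right[OF this, of "cnj v"] bounded_linear_Re]
    have "((Re \<circ> (\<lambda>x. cnj v * ?H x)) has_integral 0) {0..1}" by simp
    moreover have "(Re \<circ> (\<lambda>x. cnj v * ?H x)) = (\<lambda>x. w x * K x ^ k)"
    proof
      fix x
      have "cnj v * ?H x = of_real (K x ^ k) * (D x * cnj v)"
        by (simp add: mult_ac)
      then show "(Re \<circ> (\<lambda>x. cnj v * ?H x)) x = w x * K x ^ k"
        unfolding w_def o_def by (simp only: Re_complex_of_real Im_complex_of_real times_complex.sel) simp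
    qed
    ultimately show ?thesis by (simp only: integral_unique)
  qed
  define c where "c = (cmod v)\<^sup>2 / 2"
  have c: "c > 0" using nz by (simp add: c_def v_def)
  have wx0: "w x0 = 2 * c" unfolding w_def c_def v_def by (simp add: complex_mult_cnj cmod_power2)
  have "isCont w x0" using contw[of UNIV] by (simp add: continuous_on_eq_continuous_at)
  then obtain e where e: "e > 0" "\<And>x. \<bar>x - x0\<bar> < e \<Longrightarrow> \<bar>w x - w x0\<bar> < c"
    unfolding continuous_at_eps_delta using c by (auto simp: dist_real_def)
  define \<delta> where "\<delta> = min (min (e/2) (1/2)) (min x0 (1 - x0))"
  have \<delta>: "\<delta> > 0" "\<delta> < e" "\<delta> \<le> 1/2" "\<delta> \<le> x0" "\<delta> \<le> 1 - x0"
    using e(1) x0 by (auto simp: \<delta>_def min_def)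
  have near: "w x \<ge> c" if "\<bar>x - x0\<bar> \<le> \<delta>" for x
    using e(2)[of x] \<delta> that wx0 by auto
  have "bounded (w ` {0..1})"
    by (intro compact_imp_bounded compact_continuous_image contw) auto
  then obtain B where B: "\<And>x. x \<in> {0..1} \<Longrightarrow> \<bar>w x\<bar> \<le> B" "B > 0"
    by (metis bounded_pos imageI real_norm_def)
  define r1 where "r1 = (cos (pi * (\<delta>/2)))\<^sup>2"
  define r2 where "r2 = (cos (pi * \<delta>))\<^sup>2"
  have pd: "0 < pi * (\<delta>/2)" "pi * (\<delta>/2) < pi * \<delta>" "pi * \<delta> \<le> pi / 2"
    using mult_left_mono[OF \<delta>(3), of pi] \<delta>(1) by auto
  have cosr: "cos (pi * (\<delta>/2)) > cos (pi * \<delta>)" "0 \<le> cos (pi * \<delta>)"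
    using pd pi_gt_zero by (intro cos_monotone_0_pi cos_ge_zero; linarith)+
  have r: "r1 > r2" "r2 \<ge> 0" unfolding r1_def r2_def using cosr by (auto intro!: power_strict_mono)
  have K1: "K x \<ge> r1" if "\<bar>x - x0\<bar> \<le> \<delta>/2" for x
    unfolding K_def r1_def using that \<delta>(1,3) by (intro cos_sq_near) simp_all
  have K2: "K x \<le> r2" if "\<bar>x - x0\<bar> \<ge> \<delta>" "x \<in> {0..1}" for x
  proof -
    have "0 \<le> x" "x \<le> 1" using that by simp_all
    then have "\<bar>x - x0\<bar> \<le> 1 - \<delta>" using \<delta> x0 by linarith
    then show ?thesis unfolding K_def r2_def using that(1) \<delta>(1,3) by (intro cos_sq_far)
  qed
  have K0: "K x \<ge> 0" for x by (simp add: K_def)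
  have "\<exists>k. integral {0..1} (\<lambda>x. w x * K x ^ k) > 0"
  proof (rule kernel_concentration[OF contw contK _ _ _ c B(2) r])
    show "0 \<le> x0 - \<delta>/2" "x0 - \<delta>/2 < x0 + \<delta>/2" "x0 + \<delta>/2 \<le> 1" using \<delta> by linarith+
    fix x assume "x \<in> {x0 - \<delta>/2..x0 + \<delta>/2}"
    then have "x0 - \<delta>/2 \<le> x" "x \<le> x0 + \<delta>/2" by simp_all
    then have "\<bar>x - x0\<bar> \<le> \<delta>/2" by linarith
    then show "w x \<ge> c \<and> K x \<ge> r1" using near[of x] K1[of x] \<delta>(1) by linarith
  next
    fix x assume x: "x \<in> {0..1}" "w x < 0"
    then have "\<bar>x - x0\<bar> \<ge> \<delta>" using near[of x] c by linarith
    then show "- B \<le> w x \<and> K x \<le> r2" using K2 x B(1)[OF x(1)] by (simp add: abs_le_iff)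
  qed (simp add: K0)
  then show False using wzero by simp
qed

text \<open>The interior lemma leaves out the integers. Continuity from the right settles the point
  0, and periodicity transports both results to the whole line.\<close>

lemma fourier_unique:
  fixes D :: "real \<Rightarrow> complex"
  assumes cont: "continuous_on UNIV D"
    and per: "\<And>x. D (x + 1) = D x"
    and coef: "\<And>m::int. integral {0..1} (\<lambda>x. D x * cis (2 * pi * of_int m * x)) = 0"
  shows "D x = 0"
proof -
  have int: "D 0 = 0"
  proof -
    have "continuous (at_right 0) D"
      using cont by (simp add: continuous_on_eq_continuous_at continuous_at_imp_continuous_within)
    then have "(D \<longlongrightarrow> D 0) (at_right 0)" by (simp add: continuous_within)
    moreover have "eventually (\<lambda>x. D x = 0) (at_right 0)"
      using fourier_unique_interior[OF cont coef] by (auto simp: eventually_at_right_field intro!: exI[of _ 1])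
    ultimately have "((\<lambda>_. 0) \<longlongrightarrow> D 0) (at_right (0::real))"
      by (rule Lim_transform_eventually)
    then show ?thesis by (simp add: tendsto_const_iff)
  qed
  have sh: "D (x + real n) = D x" for x n
  proof (induction n)
    case (Suc n)
    have "x + real (Suc n) = (x + real n) + 1" by simp
    then show ?case using per[of "x + real n"] Suc by (simp only:)
  qed simp
  have shi: "D (x + of_int n) = D x" for x n
  proof (cases "n \<ge> 0")
    case True
    then show ?thesis using sh[of x "nat n"] by simp
  next
    case False
    then show ?thesis using sh[of "x + of_int n" "nat (-n)"] by simp
  qed
  have "D x = D (frac x)"
    using shi[of "frac x" "\<lfloor>x\<rfloor>"] by (simp add: frac_def)
  also have "\<dots> = 0"
  proof (cases "frac x = 0")
    case False
    then show ?thesis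
      using fourier_unique_interior[OF cont coef, of "frac x"] frac_ge_0[of x] frac_lt_1[of x] by linarith
  qed (use int in \<open>simp only:\<close>)
  finally show ?thesis .
qed

section \<open>Sums over the integers and the Poisson formula\<close>

lemma summable_on_int_inverse_square: "(\<lambda>n::int. 1 / (1 + (real_of_int n)\<^sup>2)) summable_on UNIV"
proof -
  let ?f = "\<lambda>n::int. 1 / (1 + (real_of_int n)\<^sup>2)"
  have "summable (\<lambda>n. 1 / (1 + (real n)\<^sup>2))"
  proof (rule summable_comparison_test)
    show "summable (\<lambda>n. inverse (real n ^ 2))" by (rule inverse_power_summable) simp
    have "norm (1 / (1 + (real n)\<^sup>2)) \<le> inverse (real n ^ 2)" if "n \<ge> 1" for n
      using that frac_le[of 1 1 "(real n)\<^sup>2" "1 + (real n)\<^sup>2"] by (simp add: inverse_eq_divide)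
    then show "\<exists>N. \<forall>n\<ge>N. norm (1 / (1 + (real n)\<^sup>2)) \<le> inverse (real n ^ 2)" by blast
  qed
  then have nat: "(\<lambda>n::nat. 1 / (1 + (real n)\<^sup>2)) summable_on UNIV"
    by (subst summable_on_UNIV_nonneg_real_iff) auto
  have "?f summable_on range int"
    using nat by (subst summable_on_reindex) (auto simp: o_def)
  moreover have "?f summable_on range (\<lambda>n. - int n)"
    using nat by (subst summable_on_reindex) (auto simp: o_def inj_on_def)
  ultimately have "?f summable_on (range int \<union> range (\<lambda>n. - int n))"
    by (rule summable_on_union)
  moreover have "range int \<union> range (\<lambda>n. - int n) = UNIV"
  proof -
    have "x \<in> range int \<union> range (\<lambda>n. - int n)" for x
      by (cases x rule: int_cases2) auto
    then show ?thesis by blast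
  qed
  ultimately show ?thesis by simp
qed

text \<open>Symmetric intervals are cofinal among the finite sets of integers, so unordered sums can
  be evaluated as limits of sequences.\<close>

lemma filterlim_int_intervals: "filterlim (\<lambda>N. {- int N..int N}) (finite_subsets_at_top UNIV) sequentially"
  unfolding filterlim_finite_subsets_at_top
proof (intro allI impI)
  fix X :: "int set" assume X: "finite X \<and> X \<subseteq> UNIV"
  have "finite (abs ` X)" using X by blast
  then obtain b where b: "\<And>x. x \<in> X \<Longrightarrow> \<bar>x\<bar> \<le> b"
    by (metis Max_ge imageI)
  have "eventually (\<lambda>N. N \<ge> nat b) sequentially" by (rule eventually_ge_at_top)
  then show "\<forall>\<^sub>F N in sequentially. finite {- int N..int N} \<and> X \<subseteq> {- int N..int N} \<and> {- int N..int N} \<subseteq> UNIV"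
  proof eventually_elim
    case (elim N)
    have "x \<in> {- int N..int N}" if "x \<in> X" for x
      using b[OF that] elim by auto
    then show ?case by auto
  qed
qed

lemma infsum_integral_limit:
  fixes f :: "int \<Rightarrow> real \<Rightarrow> complex"
  assumes bd: "\<And>n x. x \<in> {0..1} \<Longrightarrow> norm (f n x) \<le> M n"
    and M: "M summable_on UNIV"
    and cont: "\<And>n. continuous_on {0..1} (f n)"
  shows "(\<lambda>N. \<Sum>n\<in>{-int N..int N}. integral {0..1} (f n)) \<longlonglongrightarrow> integral {0..1} (\<lambda>x. \<Sum>\<^sub>\<infinity>n. f n x)"
proof -
  have "uniform_limit {0..1} (\<lambda>X y. \<Sum>n\<in>X. f n y) (\<lambda>y. \<Sum>\<^sub>\<infinity>n\<in>UNIV. f n y) (finite_subsets_at_top UNIV)"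
    by (rule Weierstrass_m_test_general[OF _ M]) (use bd in auto)
  then have ul: "uniform_limit {0..1} (\<lambda>N y. \<Sum>n\<in>{-int N..int N}. f n y) (\<lambda>y. \<Sum>\<^sub>\<infinity>n\<in>UNIV. f n y) sequentially"
    by (rule filterlim_compose[OF _ filterlim_int_intervals])
  obtain I J where I: "\<And>N. ((\<lambda>y. \<Sum>n\<in>{-int N..int N}. f n y) has_integral I N) {0..1}"
    and J: "((\<lambda>y. \<Sum>\<^sub>\<infinity>n. f n y) has_integral J) {0..1}" and lim: "I \<longlonglongrightarrow> J"
    by (rule uniform_limit_integral[OF ul]) (auto intro!: continuous_on_sum cont)
  have "I N = (\<Sum>n\<in>{-int N..int N}. integral {0..1} (f n))" for N
  proof -
    have "((\<lambda>y. \<Sum>n\<in>{-int N..int N}. f n y) has_integral (\<Sum>n\<in>{-int N..int N}. integral {0..1} (f n))) {0..1}"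
      by (intro has_integral_sum integrable_integral integrable_continuous_real cont) auto
    then show ?thesis using I[of N] has_integral_unique by blast
  qed
  then have "I = (\<lambda>N. \<Sum>n\<in>{-int N..int N}. integral {0..1} (f n))" by (rule ext)
  then show ?thesis using lim integral_unique[OF J] by (simp only:)
qed

text \<open>The index \<open>n\<close> owns the unit interval that starts at \<open>n\<close>; hence
  the lopsided range from -N to N + 1, which the later improper integrals adopt.\<close>

lemma sum_integral_unit_intervals:
  fixes h :: "real \<Rightarrow> complex"
  assumes "continuous_on UNIV h"
  shows "(\<Sum>n\<in>{-int N..int N}. integral {of_int n..of_int n + 1} h) = integral {- real N..real N + 1} h"
proof (induction N)
  case 0
  then show ?case by simp
next
  case (Suc N)
  have int: "h integrable_on {a..b}" for a b
    using assms continuous_on_subset by (blast intro: integrable_continuous_real)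
  have "{-int (Suc N)..int (Suc N)} = insert (- int (Suc N)) (insert (int (Suc N)) {-int N..int N})" by auto
  then have "(\<Sum>n\<in>{-int (Suc N)..int (Suc N)}. integral {of_int n..of_int n + 1} h) =
     integral {- real (Suc N)..- real N} h + (integral {real N + 1..real (Suc N) + 1} h + integral {- real N..real N + 1} h)"
    using Suc by (simp add: algebra_simps)
  also have "\<dots> = (integral {- real (Suc N)..- real N} h + integral {- real N..real N + 1} h) + integral {real N + 1..real (Suc N) + 1} h"
    by (simp only: add_ac)
  also have "integral {- real (Suc N)..- real N} h + integral {- real N..real N + 1} h = integral {- real (Suc N)..real N + 1} h"
    by (rule Henstock_Kurzweil_Integration.integral_combine[OF _ _ int]) auto
  also have "\<dots> + integral {real N + 1..real (Suc N) + 1} h = integral {- real (Suc N)..real (Suc N) + 1} h"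
    by (rule Henstock_Kurzweil_Integration.integral_combine[OF _ _ int]) auto
  finally show ?case .
qed

lemma cis_int_shift: "cis (2 * pi * of_int m * (x + of_int n)) = cis (2 * pi * of_int m * x)"
proof -
  have "cis (2 * pi * of_int m * (x + of_int n)) = cis (2 * pi * of_int m * x) * cis (2 * pi * of_int (m * n))"
    by (simp add: cis_mult algebra_simps)
  also have "cis (2 * pi * of_int (m * n)) = 1"
    using cis_multiple_2pi[of "of_int (m * n)"] by (simp add: mult_ac)
  finally show ?thesis by simp
qed

lemma integral_cis_int:
  "integral {0..1} (\<lambda>x. cis (2 * pi * of_int k * x)) = (if k = 0 then 1 else 0)"
proof (cases "k = 0")
  case False
  let ?c = "2 * complex_of_real pi * \<i> * of_int k"
  have c: "?c \<noteq> 0" using False by simp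
  have eq: "cis (2 * pi * of_int k * x) = exp (?c * of_real x)" for x
    by (simp add: cis_conv_exp mult_ac)
  have "((\<lambda>x. exp (?c * of_real x) / ?c) has_vector_derivative exp (?c * of_real x)) (at x within {0..1})" for x
  proof -
    have "((\<lambda>z. exp (?c * z) / ?c) has_field_derivative exp (?c * of_real x)) (at (of_real x))"
      using c by (auto intro!: derivative_eq_intros)
    then show ?thesis by (rule has_vector_derivative_real_field)
  qed
  then have "((\<lambda>x. exp (?c * of_real x)) has_integral (exp (?c * of_real 1) / ?c - exp (?c * of_real 0) / ?c)) {0..1}"
    by (intro fundamental_theorem_of_calculus) auto
  moreover have "exp (?c * of_real 1) = 1"
    unfolding eq[symmetric] using cis_multiple_2pi[of "of_int k"] by (simp add: mult_ac)
  ultimately show ?thesis using False unfolding eq by (simp add: integral_unique)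
qed simp

text \<open>Both sides are continuous in \<open>t\<close> with period 1 and have the same Fourier
  coefficients, so \<open>fourier_unique\<close> applies to their difference. The argument
  \<open>- m\<close> in \<open>lim\<close> comes from pairing with exp(+2 pi i m x).\<close>

lemma poisson_summation:
  fixes \<phi> :: "real \<Rightarrow> complex" and \<phi>h :: "int \<Rightarrow> complex" and C :: real
  assumes cont: "continuous_on UNIV \<phi>"
    and bound: "\<And>x. norm (\<phi> x) \<le> C / (1 + x\<^sup>2)"
    and hnorm: "(\<lambda>m. norm (\<phi>h m)) summable_on UNIV"
    and lim: "\<And>m. (\<lambda>N. integral {- real N..real N + 1} (\<lambda>x. \<phi> x * cis (2 * pi * of_int m * x))) \<longlonglongrightarrow> \<phi>h (- m)"
  shows "(\<lambda>n::int. norm (\<phi> (t + of_int n))) summable_on UNIV"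
    and "(\<Sum>\<^sub>\<infinity>n::int. \<phi> (t + of_int n)) = (\<Sum>\<^sub>\<infinity>m. \<phi>h m * cis (2 * pi * of_int m * t))"
proof -
  have C: "C \<ge> 0" using bound[of 0] by (simp add: order_trans[OF norm_ge_zero])
  define M where "M R n = (C * (2 * (1 + R\<^sup>2))) * (1 / (1 + (real_of_int n)\<^sup>2))" for R n
  have Msum: "M R summable_on UNIV" for R
    unfolding M_def by (intro summable_on_cmult_right summable_on_int_inverse_square)
  have bnd: "norm (\<phi> (x + of_int n)) \<le> M R n" if "\<bar>x\<bar> \<le> R" for x R n
  proof -
    define u where "u = x + of_int n"
    have pos: "1 + u\<^sup>2 > 0" "1 + (real_of_int n)\<^sup>2 > 0" by (simp_all add: add_pos_nonneg)
    have x2: "x\<^sup>2 \<le> R\<^sup>2" using that by (simp add: abs_le_square_iff[symmetric])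
    \<comment> \<open>Since u - x = n, the inequality (u - x)^2 \<le> 2 u^2 + 2 x^2 converts decay
      in \<open>u\<close> into decay in \<open>n\<close>, uniformly for |x| \<le> R.\<close>
    have "0 \<le> (u + x)\<^sup>2" by simp
    then have "(u - x)\<^sup>2 \<le> 2 * u\<^sup>2 + 2 * x\<^sup>2" by (simp add: power2_eq_square algebra_simps)
    then have "1 + (real_of_int n)\<^sup>2 \<le> 1 + 2 * u\<^sup>2 + 2 * x\<^sup>2" by (simp add: u_def)
    also have "\<dots> \<le> 2 * (1 + R\<^sup>2) * (1 + u\<^sup>2)"
    proof -
      have "0 \<le> R\<^sup>2 * u\<^sup>2" "0 \<le> R\<^sup>2" by simp_all
      moreover have "2 * (1 + R\<^sup>2) * (1 + u\<^sup>2) = 2 + 2 * u\<^sup>2 + 2 * R\<^sup>2 + 2 * (R\<^sup>2 * u\<^sup>2)" by (simp add: algebra_simps)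
      ultimately show ?thesis using x2 by linarith
    qed
    finally have "1 / (1 + u\<^sup>2) \<le> 2 * (1 + R\<^sup>2) * (1 / (1 + (real_of_int n)\<^sup>2))"
      using pos by (simp add: field_simps)
    then have "C * (1 / (1 + u\<^sup>2)) \<le> C * (2 * (1 + R\<^sup>2) * (1 / (1 + (real_of_int n)\<^sup>2)))"
      using C by (intro mult_left_mono) auto
    then show ?thesis using bound[of u] unfolding M_def u_def by (simp add: mult_ac)
  qed
  show abs: "(\<lambda>n::int. norm (\<phi> (t + of_int n))) summable_on UNIV" for t
    by (rule Infinite_Sum.abs_summable_on_comparison_test'[OF Msum[of "\<bar>t\<bar>"]]) (use bnd in auto)
  define g where "g x = (\<Sum>\<^sub>\<infinity>n::int. \<phi> (x + of_int n))" for x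
  define S where "S x = (\<Sum>\<^sub>\<infinity>m. \<phi>h m * cis (2 * pi * of_int m * x))" for x
  have contphi: "continuous_on A (\<lambda>x. \<phi> (x + of_int n))" for A and n :: int
    by (rule continuous_on_compose2[OF cont]) (auto intro!: continuous_intros)
  have "isCont g x" for x
  proof -
    define R where "R = \<bar>x\<bar> + 1"
    have "uniform_limit {-R..R} (\<lambda>X y. \<Sum>n\<in>X. \<phi> (y + of_int n)) (\<lambda>y. \<Sum>\<^sub>\<infinity>n::int\<in>UNIV. \<phi> (y + of_int n)) (finite_subsets_at_top UNIV)"
      by (rule Weierstrass_m_test_general[OF _ Msum[of R]]) (use bnd in auto)
    then have "continuous_on {-R..R} (\<lambda>y. \<Sum>\<^sub>\<infinity>n::int\<in>UNIV. \<phi> (y + of_int n))"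
      by (rule uniform_limit_theorem[rotated]) (auto intro!: always_eventually continuous_on_sum contphi)
    then have "continuous_on {-R..R} g" by (simp add: g_def[abs_def])
    moreover have "x \<in> interior {-R..R}" by (auto simp: R_def interior_atLeastAtMost_real abs_if)
    ultimately show ?thesis by (rule continuous_on_interior)
  qed
  then have contg: "continuous_on UNIV g" by (simp add: continuous_at_imp_continuous_on)
  have contS: "continuous_on UNIV S"
  proof -
    have "uniform_limit UNIV (\<lambda>X y. \<Sum>m\<in>X. \<phi>h m * cis (2 * pi * of_int m * y)) (\<lambda>y. \<Sum>\<^sub>\<infinity>m\<in>UNIV. \<phi>h m * cis (2 * pi * of_int m * y)) (finite_subsets_at_top UNIV)"
      by (rule Weierstrass_m_test_general[OF _ hnorm]) (auto simp: norm_mult)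
    then have "continuous_on UNIV (\<lambda>y. \<Sum>\<^sub>\<infinity>m\<in>UNIV. \<phi>h m * cis (2 * pi * of_int m * y))"
      by (rule uniform_limit_theorem[rotated]) (auto intro!: always_eventually continuous_intros)
    then show ?thesis by (simp add: S_def[abs_def])
  qed
  have perg: "g (x + 1) = g x" for x
  proof -
    have "bij (\<lambda>n::int. n + 1)" by (rule bij_plus_right)
    from infsum_reindex_bij_betw[OF this, of "\<lambda>n. \<phi> (x + of_int n)"]
    show ?thesis by (simp add: g_def add_ac)
  qed
  have perS: "S (x + 1) = S x" for x
    unfolding S_def using cis_int_shift[of _ x 1] by simp
  have coefg: "integral {0..1} (\<lambda>x. g x * cis (2 * pi * of_int m * x)) = \<phi>h (- m)" for m :: int
  proof -
    let ?f = "\<lambda>n x. \<phi> (x + of_int n) * cis (2 * pi * of_int m * x)"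
    have "(\<lambda>N. \<Sum>n\<in>{-int N..int N}. integral {0..1} (?f n)) \<longlonglongrightarrow> integral {0..1} (\<lambda>x. \<Sum>\<^sub>\<infinity>n. ?f n x)"
      by (rule infsum_integral_limit[OF _ Msum[of 1]]) (auto simp: norm_mult intro!: bnd continuous_intros contphi)
    moreover have "(\<lambda>x. \<Sum>\<^sub>\<infinity>n. ?f n x) = (\<lambda>x. g x * cis (2 * pi * of_int m * x))"
      by (simp add: g_def infsum_cmult_left')
    moreover have "(\<Sum>n\<in>{-int N..int N}. integral {0..1} (?f n)) = integral {- real N..real N + 1} (\<lambda>x. \<phi> x * cis (2 * pi * of_int m * x))" for N
    proof -
      let ?h = "\<lambda>x. \<phi> x * cis (2 * pi * of_int m * x)"
      have "integral {0..1} (?f n) = integral {of_int n..of_int n + 1} ?h" for n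
      proof -
        have "?f n = ?h \<circ> ((+) (of_int n))"
          unfolding o_def add.commute[of "real_of_int n"] cis_int_shift by (rule refl)
        then show ?thesis using integral_shift_Icc_real[of 0 1 ?h "of_int n"] by (simp add: add_ac)
      qed
      moreover have "continuous_on UNIV ?h" by (intro continuous_intros cont)
      ultimately show ?thesis
        using sum_integral_unit_intervals[of ?h N] by simp
    qed
    ultimately have "(\<lambda>N. integral {- real N..real N + 1} (\<lambda>x. \<phi> x * cis (2 * pi * of_int m * x))) \<longlonglongrightarrow> integral {0..1} (\<lambda>x. g x * cis (2 * pi * of_int m * x))"
      by simp
    from LIMSEQ_unique[OF this lim[of m]] show ?thesis .
  qed
  have coefS: "integral {0..1} (\<lambda>x. S x * cis (2 * pi * of_int m * x)) = \<phi>h (- m)" for m :: int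
  proof -
    let ?f = "\<lambda>k x. \<phi>h k * cis (2 * pi * of_int k * x) * cis (2 * pi * of_int m * x)"
    have "(\<lambda>N. \<Sum>n\<in>{-int N..int N}. integral {0..1} (?f n)) \<longlonglongrightarrow> integral {0..1} (\<lambda>x. \<Sum>\<^sub>\<infinity>n. ?f n x)"
      by (rule infsum_integral_limit[OF _ hnorm]) (auto simp: norm_mult intro!: continuous_intros)
    then have *: "(\<lambda>N. \<Sum>n\<in>{-int N..int N}. integral {0..1} (?f n)) \<longlonglongrightarrow> integral {0..1} (\<lambda>x. S x * cis (2 * pi * of_int m * x))"
      by (simp add: S_def infsum_cmult_left')
    have i: "integral {0..1} (?f k) = (if k = - m then \<phi>h (- m) else 0)" for k
    proof -
      have "?f k = (\<lambda>x. \<phi>h k * cis (2 * pi * of_int (k + m) * x))"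
        by (auto simp: fun_eq_iff cis_mult algebra_simps)
      then have "integral {0..1} (?f k) = \<phi>h k * integral {0..1} (\<lambda>x. cis (2 * pi * of_int (k + m) * x))"
        by simp
      then show ?thesis unfolding integral_cis_int by (simp add: add_eq_0_iff2)
    qed
    have "eventually (\<lambda>N. (\<Sum>n\<in>{-int N..int N}. integral {0..1} (?f n)) = \<phi>h (- m)) sequentially"
      using eventually_ge_at_top[of "nat \<bar>m\<bar>"]
    proof eventually_elim
      case (elim N)
      then have "- m \<in> {-int N..int N}" by auto
      then show ?case unfolding i by (simp add: sum.delta)
    qed
    then have "(\<lambda>N. \<Sum>n\<in>{-int N..int N}. integral {0..1} (?f n)) \<longlonglongrightarrow> \<phi>h (- m)"
      by (rule tendsto_eventually)
    from LIMSEQ_unique[OF this *] show ?thesis by simp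
  qed
  have "g t - S t = 0"
  proof (rule fourier_unique[where D = "\<lambda>x. g x - S x"])
    show "continuous_on UNIV (\<lambda>x. g x - S x)" by (intro continuous_intros contg contS)
    show "g (x + 1) - S (x + 1) = g x - S x" for x by (simp add: perg perS)
    fix m :: int
    have 1: "(\<lambda>x. g x * cis (2 * pi * of_int m * x)) integrable_on {0..1}" "(\<lambda>x. S x * cis (2 * pi * of_int m * x)) integrable_on {0..1}"
      by (intro integrable_continuous_real continuous_intros continuous_on_subset[OF contg] continuous_on_subset[OF contS]; simp)+
    show "integral {0..1} (\<lambda>x. (g x - S x) * cis (2 * pi * of_int m * x)) = 0"
      unfolding left_diff_distrib using coefg[of m] coefS[of m] by (simp add: Henstock_Kurzweil_Integration.integral_diff[OF 1])
  qed
  then show "(\<Sum>\<^sub>\<infinity>n::int. \<phi> (t + of_int n)) = (\<Sum>\<^sub>\<infinity>m. \<phi>h m * cis (2 * pi * of_int m * t))"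
    by (simp add: g_def S_def)
qed

section \<open>Theta functions\<close>

lemma has_integral_UNIV_imp_lim:
  fixes f :: "real \<Rightarrow> complex"
  assumes "(f has_integral y) UNIV"
  shows "(\<lambda>N. integral {- real N..real N + 1} f) \<longlonglongrightarrow> y"
proof (rule LIMSEQ_I)
  fix e :: real assume e: "e > 0"
  have "\<not> (\<exists>a b. (UNIV :: real set) = cbox a b)"
    using bounded_cbox not_bounded_UNIV by metis
  from has_integral_altD[OF assms this e] obtain B where B: "B > 0"
    "\<And>a b. ball 0 B \<subseteq> cbox a b \<Longrightarrow> \<exists>z. ((\<lambda>x. if x \<in> UNIV then f x else 0) has_integral z) (cbox a b) \<and> norm (z - y) < e"
    by metis
  have "norm (integral {- real N..real N + 1} f - y) < e" if "N \<ge> nat \<lceil>B\<rceil>" for N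
  proof -
    have NB: "B \<le> real N" using that by linarith
    have "ball 0 B \<subseteq> cbox (- real N) (real N + 1)"
    proof
      fix x :: real assume "x \<in> ball 0 B"
      then have "\<bar>x\<bar> < B" by simp
      then show "x \<in> cbox (- real N) (real N + 1)" using NB by auto
    qed
    from B(2)[OF this] obtain z where z: "(f has_integral z) {- real N..real N + 1}" "norm (z - y) < e" by auto
    then show ?thesis using integral_unique[OF z(1)] by simp
  qed
  then show "\<exists>no. \<forall>n\<ge>no. norm (integral {- real n..real n + 1} f - y) < e" by blast
qed

text \<open>This is the characteristic function of the standard normal law, rescaled by v = sqrt(2
  pi y) so that v^2 / 2 becomes pi y.\<close>

lemma gaussian_fourier:
  fixes y m :: real
  assumes y: "y > 0"
  shows "(\<lambda>N. integral {- real N..real N + 1} (\<lambda>x. of_real (exp (- (pi * x\<^sup>2 * y))) * cis (2 * pi * m * x)))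
    \<longlonglongrightarrow> of_real (exp (- (pi * m\<^sup>2 / y)) / sqrt y)"
proof -
  define v where "v = sqrt (2 * pi * y)"
  define t where "t = 2 * pi * m / v"
  have v: "v > 0" "v\<^sup>2 = 2 * pi * y" using y by (simp_all add: v_def)
  let ?f = "\<lambda>x. std_normal_density x *\<^sub>R iexp (t * x)"
  let ?g = "\<lambda>x. of_real (exp (- (pi * x\<^sup>2 * y))) * cis (2 * pi * m * x)"
  have fint: "integrable lborel ?f"
    by (rule Bochner_Integration.integrable_bound[OF integrable_normal_density[of 1 0]]) auto
  have "(CLINT x|std_normal_distribution. iexp (t * x)) = complex_of_real (exp (- (t^2) / 2))"
    using char_std_normal_distribution unfolding char_def by metis
  then have I: "(LINT x|lborel. ?f x) = complex_of_real (exp (- (t^2) / 2))"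
    by (subst (asm) integral_density) (auto simp: normal_density_nonneg)
  have fg: "?f (0 + v * x) = of_real (1 / sqrt (2 * pi)) * ?g x" for x
  proof -
    have "std_normal_density (v * x) = 1 / sqrt (2 * pi) * exp (- (pi * x\<^sup>2 * y))"
      unfolding std_normal_density_def power_mult_distrib v(2) by (simp add: mult_ac)
    moreover have tv: "t * (v * x) = 2 * pi * m * x" using v by (simp add: t_def)
    have "iexp (t * (v * x)) = cis (2 * pi * m * x)" by (simp only: tv cis_conv_exp)
    ultimately show ?thesis by (simp only: add_0_left scaleR_conv_of_real of_real_mult mult.assoc)
  qed
  have gint: "integrable lborel ?g"
  proof -
    have "integrable lborel (\<lambda>x. of_real (1 / sqrt (2 * pi)) * ?g x)"
      using fint lborel_integrable_real_affine_iff[of v ?f 0] v unfolding fg by simp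
    from integrable_mult_right[OF this, of "of_real (sqrt (2 * pi))"]
    have "integrable lborel (\<lambda>x. of_real (sqrt (2 * pi)) * (of_real (1 / sqrt (2 * pi)) * ?g x))" .
    moreover have "of_real (sqrt (2 * pi)) * of_real (1 / sqrt (2 * pi)) = (1::complex)"
      by (simp add: of_real_mult[symmetric] del: of_real_mult)
    ultimately show ?thesis by (simp only: mult.assoc[symmetric] mult_1_left)
  qed
  have "complex_of_real (exp (- (t^2) / 2)) = \<bar>v\<bar> *\<^sub>R (LINT x|lborel. ?f (0 + v * x))"
    using lborel_integral_real_affine[of v ?f 0] v I by simp
  also have "\<dots> = of_real (v / sqrt (2 * pi)) * (LINT x|lborel. ?g x)"
    unfolding fg using v by (simp add: scaleR_conv_of_real)
  finally have "of_real (v / sqrt (2 * pi)) * (LINT x|lborel. ?g x) = complex_of_real (exp (- (t^2) / 2))" ..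
  moreover have "v / sqrt (2 * pi) = sqrt y" by (simp add: v_def real_sqrt_mult)
  moreover have "t\<^sup>2 / 2 = pi * m\<^sup>2 / y"
    unfolding t_def power_divide v(2) using y by (simp add: power2_eq_square field_simps)
  ultimately have "of_real (sqrt y) * (LINT x|lborel. ?g x) = complex_of_real (exp (- (pi * m\<^sup>2 / y)))"
    by simp
  then have "(LINT x|lborel. ?g x) = of_real (exp (- (pi * m\<^sup>2 / y)) / sqrt y)"
    using y by (simp add: field_simps)
  then have "(?g has_integral of_real (exp (- (pi * m\<^sup>2 / y)) / sqrt y)) UNIV"
    using has_integral_integral_lborel[OF gint] by simp
  then show ?thesis by (rule has_integral_UNIV_imp_lim)
qed

text \<open>With \<open>z\<close> half of the exponent and a suitable constant \<open>k\<close> one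
  has 1 + x^2 \<le> k exp z. Squaring yields two factors 1 + x^2: one absorbs |x|^a, the other
  becomes the denominator.\<close>

lemma gaussian_decay:
  fixes y x :: real
  assumes y: "y > 0" and a: "a \<le> 1"
  shows "\<bar>x ^ a * exp (- (pi * x\<^sup>2 * y))\<bar> \<le> (1 + 2 / (pi * y))\<^sup>2 / (1 + x\<^sup>2)"
proof -
  define z where "z = pi * x\<^sup>2 * y / 2"
  define k where "k = 1 + 2 / (pi * y)"
  have z: "z \<ge> 0" using y by (simp add: z_def)
  have py: "pi * y > 0" using y by simp
  have k: "k \<ge> 1" using py by (simp add: k_def)
  have "k * (1 + z) = 1 + z + 2 / (pi * y) + x\<^sup>2"
    using py y by (simp add: k_def z_def field_simps)
  then have "1 + x\<^sup>2 \<le> k * (1 + z)" using z py by simp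
  also have "\<dots> \<le> k * exp z" using k exp_ge_add_one_self[of z] by (intro mult_left_mono) auto
  finally have 1: "1 + x\<^sup>2 \<le> k * exp z" .
  have pos: "1 + x\<^sup>2 > 0" by (simp add: add_pos_nonneg)
  have "\<bar>x\<bar> ^ a \<le> 1 + x\<^sup>2"
  proof (cases "a = 0")
    case False
    then have "a = 1" using a by simp
    have "0 \<le> (\<bar>x\<bar> - 1)\<^sup>2" by simp
    then have "2 * \<bar>x\<bar> \<le> 1 + x\<^sup>2" by (simp add: power2_eq_square algebra_simps)
    then have "\<bar>x\<bar> \<le> 1 + x\<^sup>2" by linarith
    with \<open>a = 1\<close> show ?thesis by simp
  qed simp
  then have "\<bar>x\<bar> ^ a * (1 + x\<^sup>2) \<le> (1 + x\<^sup>2) * (1 + x\<^sup>2)" using pos by (intro mult_right_mono) auto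
  also have "\<dots> \<le> (k * exp z) * (k * exp z)" using 1 pos by (intro mult_mono) auto
  also have "\<dots> = k\<^sup>2 * exp (2 * z)" by (simp add: power2_eq_square mult_exp_exp)
  finally have "\<bar>x\<bar> ^ a * (1 + x\<^sup>2) \<le> k\<^sup>2 * exp (2 * z)" .
  then have "\<bar>x\<bar> ^ a * exp (- (2 * z)) * (1 + x\<^sup>2) \<le> k\<^sup>2"
    by (simp add: exp_minus field_simps)
  then have "\<bar>x\<bar> ^ a * exp (- (2 * z)) \<le> k\<^sup>2 / (1 + x\<^sup>2)" using pos by (simp add: field_simps)
  moreover have "2 * z = pi * x\<^sup>2 * y" by (simp add: z_def)
  ultimately show ?thesis by (simp add: abs_mult power_abs k_def)
qed

text \<open>Integration by parts: the derivative of the Gaussian times the exponential is a multiple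
  of itself minus \<open>c\<close> times the integrand wanted here, and the boundary terms vanish in
  the limit.\<close>

lemma gaussian_fourier_linear:
  fixes y m :: real
  assumes y: "y > 0"
  shows "(\<lambda>N. integral {- real N..real N + 1} (\<lambda>x. of_real (x * exp (- (pi * x\<^sup>2 * y))) * cis (2 * pi * m * x)))
    \<longlonglongrightarrow> \<i> * of_real (m / y) * of_real (exp (- (pi * m\<^sup>2 / y)) / sqrt y)"
proof -
  let ?e = "\<lambda>x. of_real (exp (- (pi * x\<^sup>2 * y))) * cis (2 * pi * m * x)"
  let ?g = "\<lambda>x. of_real (x * exp (- (pi * x\<^sup>2 * y))) * cis (2 * pi * m * x)"
  define c where "c = complex_of_real (2 * pi * y)"
  have c: "c \<noteq> 0" using y by (simp add: c_def)
  have der: "(?e has_vector_derivative (2 * of_real pi * \<i> * of_real m * ?e x - c * ?g x)) (at x within A)" for x A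
  proof -
    let ?E = "\<lambda>z::complex. exp (- (of_real pi * z\<^sup>2 * of_real y) + \<i> * (2 * of_real pi * of_real m * z))"
    have eq: "?e = (\<lambda>x. ?E (of_real x))"
      by (auto simp: fun_eq_iff cis_conv_exp exp_of_real[symmetric] exp_add[symmetric])
    have "(?E has_field_derivative (?E (of_real x) * (2 * of_real pi * \<i> * of_real m - c * of_real x))) (at (of_real x))"
      by (auto intro!: derivative_eq_intros simp: c_def algebra_simps)
    then have "((\<lambda>x. ?E (of_real x)) has_vector_derivative (?E (of_real x) * (2 * of_real pi * \<i> * of_real m - c * of_real x))) (at x within A)"
      by (rule has_vector_derivative_real_field)
    moreover have "?E (of_real x) * (2 * of_real pi * \<i> * of_real m - c * of_real x) = 2 * of_real pi * \<i> * of_real m * ?e x - c * ?g x"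
    proof -
      have 1: "?e x = ?E (of_real x)" using eq by (rule fun_cong)
      have 2: "?g x = of_real x * ?e x" by simp
      show ?thesis unfolding 2 unfolding 1 by (simp only: left_diff_distrib right_diff_distrib mult_ac)
    qed
    ultimately show ?thesis unfolding eq by simp
  qed
  have int: "?e integrable_on {a..b}" "?g integrable_on {a..b}" for a b
    by (intro integrable_continuous_real continuous_intros; simp)+
  let ?b = "\<lambda>N. ?e (real N + 1) - ?e (- real N)"
  have I: "integral {- real N..real N + 1} ?g = (2 * of_real pi * \<i> * of_real m * integral {- real N..real N + 1} ?e - ?b N) / c" for N
  proof -
    have "((\<lambda>x. 2 * of_real pi * \<i> * of_real m * ?e x - c * ?g x) has_integral ?b N) {- real N..real N + 1}"
      by (rule fundamental_theorem_of_calculus[OF _ der]) simp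
    moreover have "((\<lambda>x. 2 * of_real pi * \<i> * of_real m * ?e x - c * ?g x) has_integral
      (2 * of_real pi * \<i> * of_real m * integral {- real N..real N + 1} ?e - c * integral {- real N..real N + 1} ?g)) {- real N..real N + 1}"
      by (intro has_integral_diff has_integral_mult_right integrable_integral int)
    ultimately have "?b N = 2 * of_real pi * \<i> * of_real m * integral {- real N..real N + 1} ?e - c * integral {- real N..real N + 1} ?g"
      by (rule has_integral_unique)
    then have "c * integral {- real N..real N + 1} ?g = 2 * of_real pi * \<i> * of_real m * integral {- real N..real N + 1} ?e - ?b N"
      by (simp add: algebra_simps)
    then show ?thesis using c by (simp add: eq_divide_eq mult.commute)
  qed
  have b0: "?b \<longlonglongrightarrow> 0 - 0"
  proof (rule tendsto_diff)
    let ?K = "(1 + 2 / (pi * y))\<^sup>2"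
    have bd: "norm (?e x) \<le> ?K / (1 + x\<^sup>2)" for x
      using gaussian_decay[OF y, of 0 x] by (simp add: norm_mult)
    have sq: "1 + real N \<le> 1 + (real N)\<^sup>2" "1 + real N \<le> 1 + (real N + 1)\<^sup>2" for N
      by (cases N; simp add: power2_eq_square algebra_simps)+
    have K: "?K \<ge> 0" by simp
    have lim: "(\<lambda>N. ?K / (1 + real N)) \<longlonglongrightarrow> 0" by real_asymp
    show "(\<lambda>N. ?e (real N + 1)) \<longlonglongrightarrow> 0"
    proof (rule Lim_null_comparison[OF always_eventually lim], rule allI)
      fix N
      have "?K / (1 + (real N + 1)\<^sup>2) \<le> ?K / (1 + real N)" using sq[of N] by (intro divide_left_mono) (auto intro!: mult_pos_pos add_pos_nonneg)
      then show "norm (?e (real N + 1)) \<le> ?K / (1 + real N)" using bd[of "real N + 1"] by linarith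
    qed
    show "(\<lambda>N. ?e (- real N)) \<longlonglongrightarrow> 0"
    proof (rule Lim_null_comparison[OF always_eventually lim], rule allI)
      fix N
      have "?K / (1 + (- real N)\<^sup>2) \<le> ?K / (1 + real N)" using sq[of N] by (intro divide_left_mono) (auto intro!: mult_pos_pos add_pos_nonneg)
      then show "norm (?e (- real N)) \<le> ?K / (1 + real N)" using bd[of "- real N"] by linarith
    qed
  qed
  have "(\<lambda>N. integral {- real N..real N + 1} ?g) \<longlonglongrightarrow> (2 * of_real pi * \<i> * of_real m * of_real (exp (- (pi * m\<^sup>2 / y)) / sqrt y) - (0 - 0)) / c"
    unfolding I by (rule tendsto_divide[OF tendsto_diff[OF tendsto_mult[OF tendsto_const gaussian_fourier[OF y]] b0] tendsto_const c])
  moreover have "(2 * of_real pi * \<i> * of_real m * of_real (exp (- (pi * m\<^sup>2 / y)) / sqrt y) - (0 - 0)) / c = \<i> * of_real (m / y) * of_real (exp (- (pi * m\<^sup>2 / y)) / sqrt y)"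
    using y by (simp add: c_def field_simps)
  ultimately show ?thesis by (simp only:)
qed

text \<open>The exponent \<open>a\<close> serves both parities: 0 for even characters, 1 for odd
  ones, where without the extra factor \<open>x\<close> the terms at n and -n would cancel.\<close>

lemma gaussian_poisson:
  fixes y t :: real and a :: nat
  assumes y: "y > 0" and a: "a \<le> 1"
  defines "\<phi> \<equiv> \<lambda>x. complex_of_real (x ^ a * exp (- (pi * x\<^sup>2 * y)))"
  defines "\<phi>h \<equiv> \<lambda>m::int. (- \<i> / of_real y) ^ a / of_real (sqrt y) * of_real (of_int m ^ a * exp (- (pi * (of_int m)\<^sup>2 / y)))"
  shows "(\<lambda>n::int. norm (\<phi> (t + of_int n))) summable_on UNIV"
    and "(\<lambda>m. norm (\<phi>h m)) summable_on UNIV"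
    and "(\<Sum>\<^sub>\<infinity>n::int. \<phi> (t + of_int n)) = (\<Sum>\<^sub>\<infinity>m. \<phi>h m * cis (2 * pi * of_int m * t))"
proof -
  have cont: "continuous_on UNIV \<phi>" unfolding \<phi>_def by (intro continuous_intros)
  have bd: "norm (\<phi> x) \<le> (1 + 2 / (pi * y))\<^sup>2 / (1 + x\<^sup>2)" for x
    unfolding \<phi>_def norm_of_real by (rule gaussian_decay[OF y a])
  show hs: "(\<lambda>m. norm (\<phi>h m)) summable_on UNIV"
  proof -
    define K where "K = norm ((- \<i> / of_real y) ^ a / complex_of_real (sqrt y)) * (1 + 2 / (pi * (1 / y)))\<^sup>2"
    have "(\<lambda>m. K * (1 / (1 + (real_of_int m)\<^sup>2))) summable_on UNIV"
      by (intro summable_on_cmult_right summable_on_int_inverse_square)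
    moreover have "norm (\<phi>h m) \<le> K * (1 / (1 + (real_of_int m)\<^sup>2))" for m
    proof -
      have "\<bar>real_of_int m ^ a * exp (- (pi * (real_of_int m)\<^sup>2 * (1 / y)))\<bar> \<le> (1 + 2 / (pi * (1 / y)))\<^sup>2 / (1 + (real_of_int m)\<^sup>2)"
        using y by (intro gaussian_decay a) simp
      then have "norm ((- \<i> / of_real y) ^ a / complex_of_real (sqrt y)) * \<bar>real_of_int m ^ a * exp (- (pi * (real_of_int m)\<^sup>2 * (1 / y)))\<bar>
        \<le> norm ((- \<i> / of_real y) ^ a / complex_of_real (sqrt y)) * ((1 + 2 / (pi * (1 / y)))\<^sup>2 / (1 + (real_of_int m)\<^sup>2))"
        by (rule mult_left_mono) simp
      then show ?thesis unfolding \<phi>h_def norm_mult[of "(- \<i> / of_real y) ^ a / complex_of_real (sqrt y)"] norm_of_real K_def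
        by (simp add: mult_ac)
    qed
    ultimately show ?thesis by (rule summable_on_comparison_test) auto
  qed
  have lim: "(\<lambda>N. integral {- real N..real N + 1} (\<lambda>x. \<phi> x * cis (2 * pi * of_int m * x))) \<longlonglongrightarrow> \<phi>h (- m)" for m
  proof (cases "a = 0")
    case True
    then have "\<phi>h (- m) = of_real (exp (- (pi * (of_int m)\<^sup>2 / y)) / sqrt y)" by (simp add: \<phi>h_def)
    then show ?thesis using gaussian_fourier[OF y, of "of_int m"] True unfolding \<phi>_def by simp
  next
    case False
    then have a1: "a = 1" using a by simp
    have "\<phi>h (- m) = \<i> * of_real (of_int m / y) * of_real (exp (- (pi * (of_int m)\<^sup>2 / y)) / sqrt y)"
      using y by (simp add: \<phi>h_def a1)
    then show ?thesis using gaussian_fourier_linear[OF y, of "of_int m"] unfolding \<phi>_def a1 by simp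
  qed
  show "(\<lambda>n::int. norm (\<phi> (t + of_int n))) summable_on UNIV"
    by (rule poisson_summation[OF cont bd hs lim])
  show "(\<Sum>\<^sub>\<infinity>n::int. \<phi> (t + of_int n)) = (\<Sum>\<^sub>\<infinity>m. \<phi>h m * cis (2 * pi * of_int m * t))"
    by (rule poisson_summation[OF cont bd hs lim])
qed

lemma infsum_int_even:
  fixes F :: "int \<Rightarrow> complex"
  assumes sm: "(\<lambda>n. norm (F n)) summable_on UNIV" and even: "\<And>n. F (- n) = F n"
  shows "infsum F UNIV = F 0 + 2 * (\<Sum>n. F (int (Suc n)))"
    and "summable (\<lambda>n. norm (F (int (Suc n))))"
proof -
  let ?A = "range (\<lambda>n. int (Suc n))" and ?B = "range (\<lambda>n. - int (Suc n))"
  have inj: "inj (\<lambda>n. int (Suc n))" "inj (\<lambda>n. - int (Suc n))" by (auto simp: inj_on_def)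
  have smA: "F summable_on A" for A
    using summable_on_subset_banach[OF abs_summable_summable[OF sm]] by blast
  have "(\<lambda>n. norm (F n)) summable_on ?A"
    using summable_on_subset_banach[OF sm] by blast
  then have nn: "(\<lambda>n. norm (F (int (Suc n)))) summable_on UNIV"
    using summable_on_reindex[OF inj(1), of "\<lambda>n. norm (F n)"] by (simp add: o_def)
  then show "summable (\<lambda>n. norm (F (int (Suc n))))" by (rule summable_on_imp_summable)
  have hs: "((\<lambda>n. F (int (Suc n))) has_sum (\<Sum>n. F (int (Suc n)))) UNIV"
    using has_sum_infsum[OF abs_summable_summable[OF nn]] has_sum_imp_sums sums_unique by metis
  have A: "(F has_sum (\<Sum>n. F (int (Suc n)))) ?A"
    using hs has_sum_reindex[OF inj(1), of F] by (simp add: o_def)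
  have B: "(F has_sum (\<Sum>n. F (int (Suc n)))) ?B"
    using hs has_sum_reindex[OF inj(2), of F] by (simp add: o_def even del: of_nat_Suc)
  have U: "(F has_sum ((\<Sum>n. F (int (Suc n))) + (\<Sum>n. F (int (Suc n))))) (?A \<union> ?B)"
    by (rule has_sum_Un_disjoint[OF A B]) auto
  have Z: "(F has_sum F 0) {0}" by (rule has_sum_finiteI) auto
  have "(F has_sum (F 0 + ((\<Sum>n. F (int (Suc n))) + (\<Sum>n. F (int (Suc n)))))) ({0} \<union> (?A \<union> ?B))"
    by (rule has_sum_Un_disjoint[OF Z U]) auto
  moreover have "{0} \<union> (?A \<union> ?B) = UNIV"
  proof -
    have "x \<in> {0} \<union> (?A \<union> ?B)" for x
    proof (cases x rule: int_cases2)
      case (nonneg n) then show ?thesis by (cases n) auto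
    next
      case (nonpos n) then show ?thesis by (cases n) auto
    qed
    then show ?thesis by blast
  qed
  ultimately show "infsum F UNIV = F 0 + 2 * (\<Sum>n. F (int (Suc n)))" by (simp add: infsumI)
qed

lemma has_sum_finite_sum:
  assumes "finite A" "\<And>k. k \<in> A \<Longrightarrow> (f k has_sum S k) B"
  shows "((\<lambda>n. \<Sum>k\<in>A. f k n) has_sum (\<Sum>k\<in>A. (S k :: complex))) B"
  using assms by (induction A) (auto intro!: has_sum_add)

text \<open>Split the sum into residue classes k modulo \<open>d\<close>, apply Poisson summation at
  the point k / d to each, and sum over k first on the dual side. The inner sum is then the finite
  Fourier transform of \<open>H\<close>, which by \<open>hat\<close> reproduces
  \<open>H\<close>.\<close>

lemma twisted_gaussian_poisson:
  fixes H :: "int \<Rightarrow> complex" and d a :: nat and x :: real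
  assumes d: "d > 0" and per: "\<And>n. H (n mod int d) = H n" and a: "a \<le> 1" and x: "x > 0"
    and hat: "\<And>m::int. (\<Sum>k<d. H (int k) * cis (2 * pi * of_int m * (real k / real d))) = \<tau> * H m"
  defines "\<psi> \<equiv> \<lambda>x n. complex_of_real (of_int n ^ a * exp (- (pi * (of_int n)\<^sup>2 * x / real d)))"
  shows "(\<Sum>\<^sub>\<infinity>n. H n * \<psi> x n) = (of_nat (d ^ a) * (- \<i> / of_real (x * d)) ^ a / of_real (sqrt (x * d)) * \<tau>) * (\<Sum>\<^sub>\<infinity>n. H n * \<psi> (1 / x) n)"
    and "(\<lambda>n. norm (H n * \<psi> x n)) summable_on UNIV"
proof -
  define y where "y = x * d"
  have y: "y > 0" using x d by (simp add: y_def)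
  define \<phi> where "\<phi> v = complex_of_real (v ^ a * exp (- (pi * v\<^sup>2 * y)))" for v
  define \<phi>h where "\<phi>h m = (- \<i> / of_real y) ^ a / of_real (sqrt y) * complex_of_real (of_int m ^ a * exp (- (pi * (of_int m)\<^sup>2 / y)))" for m :: int
  note gp = gaussian_poisson[OF y a, folded \<phi>_def \<phi>h_def]
  define P where "P k = (\<Sum>\<^sub>\<infinity>m::int. \<phi> (real k / real d + of_int m))" for k
  have \<psi>\<phi>: "\<psi> x (int k + m * int d) = of_nat (d ^ a) * \<phi> (real k / real d + of_int m)" for k m
  proof -
    have e: "real_of_int (int k + m * int d) = real d * (real k / real d + of_int m)"
      using d by (simp add: field_simps)
    have "pi * (real_of_int (int k + m * int d))\<^sup>2 * x / real d = pi * (real k / real d + of_int m)\<^sup>2 * y"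
      unfolding e y_def using d by (simp add: power2_eq_square)
    then show ?thesis unfolding \<psi>_def \<phi>_def by (simp only: e power_mult_distrib) simp
  qed
  have left: "((\<lambda>n. if n mod int d = int k then H n * \<psi> x n else 0) has_sum (H (int k) * (of_nat (d ^ a) * P k))) UNIV" if k: "k < d" for k
  proof -
    let ?g = "\<lambda>m::int. int k + m * int d"
    have inj: "inj ?g" using d by (auto simp: inj_on_def)
    have im: "range ?g = {n. n mod int d = int k}"
    proof (intro equalityI subsetI)
      fix n assume "n \<in> {n. n mod int d = int k}"
      then have "n = ?g (n div int d)" using div_mult_mod_eq[of n "int d"] by simp
      then show "n \<in> range ?g" by (rule range_eqI)
    qed (use k in auto)
    have "((\<lambda>m. \<phi> (real k / real d + of_int m)) has_sum P k) UNIV"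
      unfolding P_def by (rule has_sum_infsum[OF abs_summable_summable[OF gp(1)]])
    then have "((\<lambda>m. \<psi> x (?g m)) has_sum (of_nat (d ^ a) * P k)) UNIV"
      unfolding \<psi>\<phi> by (rule has_sum_cmult_right)
    then have "(\<psi> x has_sum (of_nat (d ^ a) * P k)) {n. n mod int d = int k}"
      using has_sum_reindex[OF inj, of "\<psi> x"] unfolding im o_def by blast
    from has_sum_cmult_right[OF this, of "H (int k)"]
    have *: "((\<lambda>n. H (int k) * \<psi> x n) has_sum (H (int k) * (of_nat (d ^ a) * P k))) {n. n mod int d = int k}" .
    have e: "H (int k) * \<psi> x n = (if n mod int d = int k then H n * \<psi> x n else 0)" if "n mod int d = int k" for n
      using per[of n] that by simp
    show ?thesis
      by (rule iffD1[OF has_sum_cong_neutral *]) (use e in auto)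
  qed
  have "((\<lambda>n. \<Sum>k<d. if n mod int d = int k then H n * \<psi> x n else 0) has_sum (\<Sum>k<d. H (int k) * (of_nat (d ^ a) * P k))) UNIV"
    by (rule has_sum_finite_sum) (use left in auto)
  moreover have "(\<Sum>k<d. if n mod int d = int k then H n * \<psi> x n else 0) = H n * \<psi> x n" for n
  proof -
    have "(\<Sum>k<d. if n mod int d = int k then H n * \<psi> x n else 0) = (\<Sum>k<d. if k = nat (n mod int d) then H n * \<psi> x n else 0)"
      using d by (intro sum.cong) auto
    moreover have "nat (n mod int d) < d" using d by (simp add: nat_less_iff)
    ultimately show ?thesis by simp
  qed
  ultimately have L: "((\<lambda>n. H n * \<psi> x n) has_sum (\<Sum>k<d. H (int k) * (of_nat (d ^ a) * P k))) UNIV" by simp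
  have right: "((\<lambda>m. H (int k) * (of_nat (d ^ a) * (\<phi>h m * cis (2 * pi * of_int m * (real k / real d))))) has_sum (H (int k) * (of_nat (d ^ a) * P k))) UNIV" for k
  proof -
    have "(\<lambda>m. norm (\<phi>h m * cis (2 * pi * of_int m * (real k / real d)))) summable_on UNIV"
      using gp(2) by (simp add: norm_mult)
    from has_sum_infsum[OF abs_summable_summable[OF this]]
    have "((\<lambda>m. \<phi>h m * cis (2 * pi * of_int m * (real k / real d))) has_sum P k) UNIV"
      unfolding P_def gp(3) .
    then show ?thesis by (intro has_sum_cmult_right)
  qed
  define K where "K = of_nat (d ^ a) * (- \<i> / of_real (x * d)) ^ a / of_real (sqrt (x * d)) * \<tau>"
  have "((\<lambda>m. \<Sum>k<d. H (int k) * (of_nat (d ^ a) * (\<phi>h m * cis (2 * pi * of_int m * (real k / real d))))) has_sum (\<Sum>k<d. H (int k) * (of_nat (d ^ a) * P k))) UNIV"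
    by (rule has_sum_finite_sum) (use right in auto)
  moreover have "(\<Sum>k<d. H (int k) * (of_nat (d ^ a) * (\<phi>h m * cis (2 * pi * of_int m * (real k / real d))))) = K * (H m * \<psi> (1 / x) m)" for m
  proof -
    have A: "(\<Sum>k<d. H (int k) * (of_nat (d ^ a) * (\<phi>h m * cis (2 * pi * of_int m * (real k / real d)))))
       = of_nat (d ^ a) * \<phi>h m * (\<Sum>k<d. H (int k) * cis (2 * pi * of_int m * (real k / real d)))"
      unfolding sum_distrib_left by (intro sum.cong) (simp_all add: mult_ac)
    have B: "\<phi>h m = (- \<i> / of_real (x * d)) ^ a / of_real (sqrt (x * d)) * \<psi> (1 / x) m"
    proof -
      have "pi * (real_of_int m)\<^sup>2 / y = pi * (of_int m)\<^sup>2 * (1 / x) / real d" using x d by (simp add: y_def)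
      then show ?thesis unfolding \<phi>h_def \<psi>_def y_def[symmetric] by simp
    qed
    show ?thesis unfolding A hat unfolding B K_def by (simp only: mult_ac times_divide_eq_left times_divide_eq_right)
  qed
  ultimately have "((\<lambda>m. K * (H m * \<psi> (1 / x) m)) has_sum (\<Sum>k<d. H (int k) * (of_nat (d ^ a) * P k))) UNIV" by simp
  then have "(\<Sum>\<^sub>\<infinity>m. K * (H m * \<psi> (1 / x) m)) = (\<Sum>k<d. H (int k) * (of_nat (d ^ a) * P k))" by (rule infsumI)
  then have R: "K * (\<Sum>\<^sub>\<infinity>m. H m * \<psi> (1 / x) m) = (\<Sum>k<d. H (int k) * (of_nat (d ^ a) * P k))"
    by (simp only: infsum_cmult_right')
  then show "(\<Sum>\<^sub>\<infinity>n. H n * \<psi> x n) = (of_nat (d ^ a) * (- \<i> / of_real (x * d)) ^ a / of_real (sqrt (x * d)) * \<tau>) * (\<Sum>\<^sub>\<infinity>n. H n * \<psi> (1 / x) n)"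
    using infsumI[OF L] unfolding K_def by simp
  show "(\<lambda>n. norm (H n * \<psi> x n)) summable_on UNIV"
  proof -
    define B where "B = (\<Sum>k<d. norm (H (int k)))"
    define C where "C = (1 + 2 / (pi * (x / d)))\<^sup>2"
    have "norm (H n) \<le> B" for n
    proof -
      have "H n = H (int (nat (n mod int d)))" using per d by simp
      moreover have "nat (n mod int d) < d" using d by (simp add: nat_less_iff)
      then have "norm (H (int (nat (n mod int d)))) \<le> B"
        unfolding B_def by (intro member_le_sum) auto
      ultimately show ?thesis by (simp only:)
    qed
    moreover have "norm (\<psi> x n) \<le> C / (1 + (of_int n)\<^sup>2)" for n
      using gaussian_decay[of "x / d" a "of_int n"] x d a unfolding \<psi>_def norm_of_real C_def by simp
    ultimately have "norm (H n * \<psi> x n) \<le> B * (C / (1 + (of_int n)\<^sup>2))" for n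
      unfolding norm_mult by (intro mult_mono) (auto simp: B_def sum_nonneg)
    then have bd: "norm (H n * \<psi> x n) \<le> (B * C) * (1 / (1 + (of_int n)\<^sup>2))" for n by simp
    have sm: "(\<lambda>n::int. (B * C) * (1 / (1 + (of_int n)\<^sup>2))) summable_on UNIV"
      by (intro summable_on_cmult_right summable_on_int_inverse_square)
    show ?thesis by (rule summable_on_comparison_test[OF sm bd]) simp
  qed
qed

text \<open>The theta series in the logarithmic variable \<open>u\<close>, where \<open>x = exp u\<close>, so that
  \<open>x \<mapsto> 1 / x\<close> becomes \<open>u \<mapsto> -u\<close>.\<close>

definition theta :: "nat \<Rightarrow> nat \<Rightarrow> (nat \<Rightarrow> complex) \<Rightarrow> real \<Rightarrow> complex" where
  "theta d a h u = (\<Sum>n. (h (Suc n) * of_nat (Suc n ^ a)) * of_real (exp (- (pi * (real (Suc n))\<^sup>2 / real d * exp u))))"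

text \<open>Poisson summation produces the factor x^(a + 1/2) with x = exp u; the weight x^(1/4 +
  a/2) in \<open>E\<close> distributes it evenly over both sides. The term n = 0 of the two-sided
  sum survives only for a = 0.\<close>

lemma theta_functional_equation:
  fixes h :: "nat \<Rightarrow> complex" and d a :: nat
  assumes d: "d > 0" and per: "\<And>n. h (n mod d) = h n" and a: "a \<le> 1"
    and parity: "\<And>n. n \<le> d \<Longrightarrow> h (d - n) = (-1) ^ a * h n"
    and hat: "\<And>m. (\<Sum>k<d. h k * cis (2 * pi * real k * real m / real d)) = \<tau> * h m"
  defines "E \<equiv> \<lambda>u. of_real (exp (u * (1/4 + a/2))) * ((if a = 0 then h 0 else 0) + 2 * theta d a h u)"
  shows "E (- u) = ((- \<i>) ^ a * \<tau> / of_real (sqrt d)) * E u"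
proof -
  \<comment> \<open>The periodic extension to the integers, needed because Poisson summation is
    two-sided.\<close>
  define H where "H n = h (nat (n mod int d))" for n
  have Hper: "H (n mod int d) = H n" for n by (simp add: H_def)
  have Hint: "H (int n) = h n" for n
    using per[of n] by (simp add: H_def zmod_int[symmetric])
  have Heven: "H (- n) = (-1) ^ a * H n" for n
  proof -
    define r where "r = nat (n mod int d)"
    have r: "int r = n mod int d" "r < d" using d by (simp_all add: r_def nat_less_iff)
    have "(- n) mod int d = (int (d - r)) mod int d"
    proof -
      have "int (d - r) mod int d = (int d - n mod int d) mod int d" using r by (simp add: of_nat_diff)
      also have "\<dots> = (int d - n) mod int d" by (rule mod_diff_right_eq)
      also have "\<dots> = (- n) mod int d" using mod_add_self1[of "int d" "- n"] by simp
      finally show ?thesis ..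
    qed
    then have "H (- n) = H (int (d - r))" using Hper by metis
    also have "\<dots> = (-1) ^ a * h r" by (simp only: Hint parity[OF less_imp_le[OF r(2)]])
    also have "h r = H n" by (simp add: r_def H_def)
    finally show ?thesis .
  qed
  have Hhat: "(\<Sum>k<d. H (int k) * cis (2 * pi * of_int m * (real k / real d))) = \<tau> * H m" for m :: int
  proof -
    define r where "r = nat (m mod int d)"
    have r: "int r = m mod int d" using d by (simp add: r_def)
    have "cis (2 * pi * of_int m * (real k / real d)) = cis (2 * pi * real k * real r / real d)" for k
    proof -
      have "m = int r + (m div int d) * int d" using r by simp
      then have "real_of_int m = real r + of_int (m div int d) * real d"
        by (metis of_int_add of_int_mult of_int_of_nat_eq)
      then have "2 * pi * of_int m * (real k / real d) = 2 * pi * real k * real r / real d + 2 * pi * of_int (int k * (m div int d))"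
        using d by (simp add: field_simps)
      then have "cis (2 * pi * of_int m * (real k / real d)) = cis (2 * pi * real k * real r / real d) * cis (2 * pi * of_int (int k * (m div int d)))"
        by (simp only: cis_mult)
      moreover have "cis (2 * pi * of_int (int k * (m div int d))) = 1" by (rule cis_multiple_2pi) simp
      ultimately show ?thesis by simp
    qed
    then have "(\<Sum>k<d. H (int k) * cis (2 * pi * of_int m * (real k / real d))) = \<tau> * h r"
      using hat[of r] by (simp add: Hint)
    also have "h r = H m" by (simp add: r_def H_def)
    finally show ?thesis .
  qed
  have sum: "(\<Sum>\<^sub>\<infinity>n. H n * complex_of_real (of_int n ^ a * exp (- (pi * (of_int n)\<^sup>2 * exp v / real d)))) = (if a = 0 then h 0 else 0) + 2 * theta d a h v" for v
  proof -
    let ?F = "\<lambda>n. H n * complex_of_real (of_int n ^ a * exp (- (pi * (of_int n)\<^sup>2 * exp v / real d)))"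
    have "infsum ?F UNIV = ?F 0 + 2 * (\<Sum>n. ?F (int (Suc n)))"
    proof (rule infsum_int_even)
      show "(\<lambda>n. norm (?F n)) summable_on UNIV"
        by (rule twisted_gaussian_poisson(2)[OF d Hper a _ Hhat]) simp
      have one: "(-1) ^ a * (-1) ^ a = (1::complex)" by (simp add: power_mult_distrib[symmetric])
      show "?F (- n) = ?F n" for n
      proof -
        have "(of_int (- n) :: real) ^ a = (-1) ^ a * of_int n ^ a" by (simp add: power_minus[of "real_of_int n"])
        then have "?F (- n) = ((-1) ^ a * (-1) ^ a) * ?F n" unfolding Heven by (simp add: mult_ac)
        then show ?thesis unfolding one by simp
      qed
    qed
    moreover have "?F 0 = (if a = 0 then h 0 else 0)" using Hint[of 0] by auto
    moreover have "?F (int (Suc n)) = (h (Suc n) * of_nat (Suc n ^ a)) * of_real (exp (- (pi * (real (Suc n))\<^sup>2 / real d * exp v)))" for n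
      unfolding Hint by (simp del: of_nat_Suc add: mult_ac)
    ultimately show ?thesis unfolding theta_def by (simp only:)
  qed
  define G where "G v = (if a = 0 then h 0 else 0) + 2 * theta d a h v" for v
  have "G (- u) = (of_nat (d ^ a) * (- \<i> / of_real (exp (- u) * d)) ^ a / of_real (sqrt (exp (- u) * d)) * \<tau>) * G u"
    using twisted_gaussian_poisson(1)[OF d Hper a _ Hhat, of "exp (- u)"]
    unfolding G_def sum[symmetric] by (simp add: exp_minus inverse_eq_divide)
  also have "of_nat (d ^ a) * (- \<i> / of_real (exp (- u) * d)) ^ a / of_real (sqrt (exp (- u) * d)) * \<tau>
     = ((- \<i>) ^ a * \<tau> / of_real (sqrt d)) * of_real (exp (u * (a + 1/2)))"
  proof -
    have s: "sqrt (exp (- u) * d) = exp (- (u / 2)) * sqrt d"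
    proof -
      have "exp (- (u / 2)) ^ 2 = exp (- u)" by (simp add: exp_double[symmetric])
      then have "sqrt (exp (- u)) = exp (- (u / 2))" by (intro real_sqrt_unique) simp_all
      then show ?thesis by (simp only: real_sqrt_mult)
    qed
    have e: "exp (u * (a + 1/2)) = exp u ^ a * exp (u / 2)"
      by (simp add: exp_of_nat_mult[symmetric] exp_add[symmetric] algebra_simps)
    have "of_nat d * (- \<i> / complex_of_real (exp (- u) * d)) = (- \<i>) * of_real (exp u)"
      using d by (simp add: exp_minus field_simps)
    then have b: "of_nat (d ^ a) * (- \<i> / complex_of_real (exp (- u) * d)) ^ a = (- \<i>) ^ a * of_real (exp u) ^ a"
      unfolding of_nat_power power_mult_distrib[symmetric] by (simp only:)
    have "1 / complex_of_real (exp (- (u / 2)) * sqrt d) = of_real (exp (u / 2)) / of_real (sqrt d)"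
      by (simp add: exp_minus field_simps)
    then have "X / complex_of_real (exp (- (u / 2)) * sqrt d) * \<tau> = X * (of_real (exp (u / 2)) / of_real (sqrt d)) * \<tau>" for X
      by (metis mult.right_neutral times_divide_eq_right)
    then show ?thesis unfolding s b e by simp
  qed
  finally have "E (- u) = ((- \<i>) ^ a * \<tau> / of_real (sqrt d)) * (of_real (exp (- u * (1/4 + a/2))) * of_real (exp (u * (a + 1/2)))) * G u"
    unfolding E_def G_def[symmetric] by (simp only: mult_ac)
  also have "of_real (exp (- u * (1/4 + a/2))) * of_real (exp (u * (a + 1/2))) = complex_of_real (exp (u * (1/4 + a/2)))"
    by (simp add: of_real_mult[symmetric] exp_add[symmetric] algebra_simps del: of_real_mult)
  finally show ?thesis unfolding E_def G_def by (simp only: mult_ac)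
qed

section \<open>Mellin transforms\<close>

text \<open>Euler's integral after the substitution t = l exp u. In the logarithmic variable a
  Mellin transform is a Laplace transform over the whole line.\<close>

lemma Gamma_integral_exp:
  fixes w :: complex and l :: real
  assumes w: "Re w > 0" and l: "l > 0"
  shows "integrable lborel (\<lambda>u. of_real (exp (- (l * exp u))) * exp (of_real u * w))"
    and "(LINT u|lborel. of_real (exp (- (l * exp u))) * exp (of_real u * w)) = Gamma w * of_real l powr (- w)"
proof -
  let ?F = "\<lambda>u. complex_of_real (exp (- (l * exp u))) * exp (of_real u * w)"
  let ?f = "\<lambda>t. complex_of_real t powr (w - 1) / complex_of_real (exp t)"
  have der: "((\<lambda>u. l * exp u) has_field_derivative (l * exp u)) (at u within UNIV)" for u
    by (auto intro!: derivative_eq_intros)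
  have inj: "inj (\<lambda>u. l * exp u)" using l by (auto simp: inj_on_def)
  have im: "(\<lambda>u. l * exp u) ` UNIV = {0<..}"
  proof (intro equalityI subsetI)
    fix x :: real assume "x \<in> {0<..}"
    then have "x = l * exp (ln (x / l))" using l by simp
    then show "x \<in> range (\<lambda>u. l * exp u)" by blast
  next
    fix x :: real assume "x \<in> range (\<lambda>u. l * exp u)"
    then obtain u where "x = l * exp u" by blast
    then show "x \<in> {0<..}" using l by simp
  qed
  have "?f absolutely_integrable_on {0<..} \<and> integral {0<..} ?f = Gamma w"
    using absolutely_integrable_Gamma_integral'[OF w] Gamma_integral_complex'[OF w] by (simp add: integral_unique)
  then have "(\<lambda>u. \<bar>l * exp u\<bar> *\<^sub>R ?f (l * exp u)) absolutely_integrable_on UNIV \<and> integral UNIV (\<lambda>u. \<bar>l * exp u\<bar> *\<^sub>R ?f (l * exp u)) = Gamma w"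
    using has_absolute_integral_change_of_variables_real[OF _ der inj, of ?f "Gamma w"] unfolding im by simp
  moreover have "\<bar>l * exp u\<bar> *\<^sub>R ?f (l * exp u) = of_real l powr w * ?F u" for u
  proof -
    have pos: "l * exp u > 0" using l by simp
    have ln: "ln (l * exp u) = ln l + u" using l by (simp add: ln_mult)
    have "\<bar>l * exp u\<bar> *\<^sub>R ?f (l * exp u) = of_real (l * exp u) powr 1 * of_real (l * exp u) powr (w - 1) / of_real (exp (l * exp u))"
      using pos by (simp add: scaleR_conv_of_real)
    also have "of_real (l * exp u) powr 1 * of_real (l * exp u) powr (w - 1) = of_real (l * exp u) powr w"
      by (subst powr_add[symmetric]) simp
    also have "\<dots> = exp (w * of_real (ln l + u))"
    proof -
      have "complex_of_real (l * exp u) \<noteq> 0" unfolding of_real_eq_0_iff using pos by linarith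
      then show ?thesis unfolding powr_def Ln_of_real[OF pos] ln by (simp only: if_False)
    qed
    also have "\<dots> = of_real l powr w * exp (of_real u * w)"
      using l by (simp add: powr_def Ln_of_real exp_add[symmetric] algebra_simps)
    finally show ?thesis by (simp add: exp_minus field_simps)
  qed
  ultimately have *: "(\<lambda>u. of_real l powr w * ?F u) absolutely_integrable_on UNIV" "integral UNIV (\<lambda>u. of_real l powr w * ?F u) = Gamma w"
    by simp_all
  have meas: "(\<lambda>u. of_real l powr w * ?F u) \<in> borel_measurable lborel" by measurable
  have "integrable lebesgue (\<lambda>u. of_real l powr w * ?F u)"
    using *(1) by (simp add: set_integrable_def)
  then have I: "integrable lborel (\<lambda>u. of_real l powr w * ?F u)"
    using integrable_completion[OF meas] by simp
  have lw: "of_real l powr w * of_real l powr (- w) = (1::complex)"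
    using l by (simp add: powr_minus)
  have "integrable lborel (\<lambda>u. of_real l powr (- w) * (of_real l powr w * ?F u))"
    by (rule integrable_mult_right[OF I])
  then show int: "integrable lborel ?F"
    by (simp only: mult.assoc[symmetric] mult.commute[of "of_real l powr (- w)"] lw mult_1_left)
  have "(LINT u|lborel. of_real l powr w * ?F u) = Gamma w"
    by (rule trans[OF sym[OF integral_unique[OF has_integral_integral_lborel[OF I]]] *(2)])
  then have "of_real l powr w * (LINT u|lborel. ?F u) = Gamma w" by simp
  then have "Gamma w * of_real l powr (- w) = (of_real l powr w * of_real l powr (- w)) * (LINT u|lborel. ?F u)"
    by (simp add: mult_ac)
  then show "(LINT u|lborel. ?F u) = Gamma w * of_real l powr (- w)"
    unfolding lw by simp
qed

lemma Gamma_integral_exp_real: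
  fixes s l :: real
  assumes s: "s > 0" and l: "l > 0"
  shows "integrable lborel (\<lambda>u. exp (- (l * exp u)) * exp (u * s))"
    and "(LINT u|lborel. exp (- (l * exp u)) * exp (u * s)) = Gamma s * l powr (- s)"
proof -
  have eq: "(\<lambda>u. complex_of_real (exp (- (l * exp u))) * exp (of_real u * of_real s)) = (\<lambda>u. complex_of_real (exp (- (l * exp u)) * exp (u * s)))"
    by (simp add: fun_eq_iff exp_of_real[symmetric])
  show "integrable lborel (\<lambda>u. exp (- (l * exp u)) * exp (u * s))"
    using Gamma_integral_exp(1)[of "of_real s" l] s l unfolding eq complex_of_real_integrable_eq by simp
  have "complex_of_real (LINT u|lborel. exp (- (l * exp u)) * exp (u * s)) = complex_of_real (Gamma s * l powr (- s))"
    using Gamma_integral_exp(2)[of "of_real s" l] s l unfolding eq integral_complex_of_real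
    by (simp add: Gamma_complex_of_real powr_of_real[symmetric])
  then show "(LINT u|lborel. exp (- (l * exp u)) * exp (u * s)) = Gamma s * l powr (- s)"
    unfolding of_real_eq_iff .
qed

text \<open>Integrating term by term is legitimate because the integral of the norm of each term is
  again a Gamma integral, and \<open>sm\<close> makes these summable.\<close>

lemma mellin_exp_series:
  fixes w :: complex and l :: "nat \<Rightarrow> real" and c :: "nat \<Rightarrow> complex"
  assumes w: "Re w > 0" and l: "\<And>n. l n > 0"
    and sm: "summable (\<lambda>n. norm (c n) * l n powr (- Re w))"
    and pt: "\<And>u. summable (\<lambda>n. norm (c n) * exp (- (l n * exp u)))"
  shows "integrable lborel (\<lambda>u. (\<Sum>n. c n * of_real (exp (- (l n * exp u)))) * exp (of_real u * w))"
    and "(LINT u|lborel. (\<Sum>n. c n * of_real (exp (- (l n * exp u)))) * exp (of_real u * w)) = Gamma w * (\<Sum>n. c n * of_real (l n) powr (- w))"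
    and "summable (\<lambda>n. c n * of_real (l n) powr (- w))"
proof -
  let ?f = "\<lambda>n u. c n * (of_real (exp (- (l n * exp u))) * exp (of_real u * w))"
  have int: "integrable lborel (?f n)" for n
    by (intro integrable_mult_right Gamma_integral_exp w l)
  have nf: "norm (?f n u) = norm (c n) * exp (- (l n * exp u)) * exp (u * Re w)" for n u
    by (simp add: norm_mult)
  have ptu: "summable (\<lambda>n. norm (?f n u))" for u
    unfolding nf by (intro summable_mult2 pt)
  have nint: "(LINT u|lborel. norm (?f n u)) = Gamma (Re w) * (norm (c n) * l n powr (- Re w))" for n
  proof -
    have "(LINT u|lborel. norm (?f n u)) = (LINT u|lborel. norm (c n) * (exp (- (l n * exp u)) * exp (u * Re w)))"
      unfolding nf by (simp only: mult.assoc)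
    also have "\<dots> = norm (c n) * (LINT u|lborel. exp (- (l n * exp u)) * exp (u * Re w))" by simp
    finally show ?thesis using Gamma_integral_exp_real(2)[OF w l] by (simp add: mult_ac)
  qed
  have smi: "summable (\<lambda>n. LINT u|lborel. norm (?f n u))"
    unfolding nint by (intro summable_mult sm)
  have eq: "(\<Sum>n. ?f n u) = (\<Sum>n. c n * of_real (exp (- (l n * exp u)))) * exp (of_real u * w)" for u
  proof -
    have "summable (\<lambda>n. c n * of_real (exp (- (l n * exp u))))"
      by (rule summable_norm_cancel) (use pt[of u] in \<open>simp add: norm_mult\<close>)
    from suminf_mult2[OF this, of "exp (of_real u * w)"] show ?thesis by (simp add: mult.assoc)
  qed
  have ae: "AE u in lborel. summable (\<lambda>n. norm (?f n u))" using ptu by simp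
  show "integrable lborel (\<lambda>u. (\<Sum>n. c n * of_real (exp (- (l n * exp u)))) * exp (of_real u * w))"
    using integrable_suminf[OF int ae smi] unfolding eq .
  have li: "integral\<^sup>L lborel (?f n) = Gamma w * (c n * of_real (l n) powr (- w))" for n
    using Gamma_integral_exp[OF w l] by (simp add: mult_ac)
  show sm2: "summable (\<lambda>n. c n * of_real (l n) powr (- w))"
  proof (rule summable_norm_cancel)
    have "norm (c n * of_real (l n) powr (- w)) = norm (c n) * l n powr (- Re w)" for n
      using l[of n] by (simp add: norm_mult norm_powr_real_powr)
    then show "summable (\<lambda>n. norm (c n * of_real (l n) powr (- w)))" using sm by simp
  qed
  show "(LINT u|lborel. (\<Sum>n. c n * of_real (exp (- (l n * exp u)))) * exp (of_real u * w)) = Gamma w * (\<Sum>n. c n * of_real (l n) powr (- w))"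
    using integral_suminf[OF int ae smi] unfolding eq li suminf_mult[OF sm2] .
qed

text \<open>The Gamma integrand exp(u - exp u) is comparable to exp u for u \<le> 0; together with
  its mirror image it dominates on both half-lines.\<close>

lemma integrable_exp_minus_abs: "integrable lborel (\<lambda>u::real. exp (- \<bar>u\<bar>))"
proof -
  let ?G = "\<lambda>u::real. exp (- (1 * exp u)) * exp (u * 1)"
  have G: "integrable lborel ?G" by (rule Gamma_integral_exp_real) auto
  have G': "integrable lborel (\<lambda>u. ?G (0 + (-1) * u))"
    using lborel_integrable_real_affine_iff[of "-1" ?G 0] G by simp
  have key: "exp u \<le> exp 1 * ?G u" if "u \<le> 0" for u :: real
  proof -
    have "exp (- exp u) \<ge> exp (-1)" using that by simp
    then have "exp 1 * (exp (- exp u) * exp u) \<ge> exp 1 * (exp (-1) * exp u)"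
      by (intro mult_left_mono mult_right_mono) auto
    moreover have "exp 1 * (exp (-1) * exp u) = exp u" by (simp add: exp_minus)
    ultimately show ?thesis by simp
  qed
  show ?thesis
  proof (rule Bochner_Integration.integrable_bound)
    show "integrable lborel (\<lambda>u. exp 1 * ?G u + exp 1 * ?G (0 + (-1) * u))"
      by (intro Bochner_Integration.integrable_add integrable_mult_right G G')
    show "AE u in lborel. norm (exp (- \<bar>u\<bar>)) \<le> norm (exp 1 * ?G u + exp 1 * ?G (0 + (-1) * u))"
    proof (rule AE_I2)
      fix u :: real
      have pos: "exp 1 * ?G x \<ge> 0" for x :: real by simp
      have "exp (- \<bar>u\<bar>) \<le> exp 1 * ?G u + exp 1 * ?G (0 + (-1) * u)"
      proof (cases "u \<le> 0")
        case True
        then have "exp (- \<bar>u\<bar>) = exp u" by simp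
        then show ?thesis using key[OF True] pos[of "0 + (-1) * u"] by linarith
      next
        case False
        then have "exp (- \<bar>u\<bar>) = exp (0 + (-1) * u)" by simp
        moreover have "exp (0 + (-1) * u) \<le> exp 1 * ?G (0 + (-1) * u)" using False by (intro key) simp
        ultimately show ?thesis using pos[of u] by linarith
      qed
      then show "norm (exp (- \<bar>u\<bar>)) \<le> norm (exp 1 * ?G u + exp 1 * ?G (0 + (-1) * u))"
        using pos[of u] pos[of "0 + (-1) * u"] unfolding real_norm_def by (simp only: abs_of_nonneg add_nonneg_nonneg exp_ge_zero)
    qed
  qed simp
qed

text \<open>Because \<open>T\<close> decays faster than every exponential, exp(u w) can be expanded
  and integrated term by term. The result is a power series that converges everywhere, so no
  differentiation under the integral sign occurs; the same domination gives the bound on vertical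
  strips.\<close>

lemma laplace_entire:
  fixes T :: "real \<Rightarrow> complex"
  assumes meas: "T \<in> borel_measurable borel"
    and bd: "\<And>c::nat. \<exists>K. \<forall>u. norm (T u) \<le> K * exp (- real c * \<bar>u\<bar>)"
  defines "\<Phi> \<equiv> \<lambda>w. LINT u|lborel. T u * exp (of_real u * w)"
  shows "integrable lborel (\<lambda>u. T u * exp (of_real u * w))"
    and "\<Phi> holomorphic_on UNIV"
    and "\<exists>B. \<forall>w. \<bar>Re w\<bar> \<le> R \<longrightarrow> norm (\<Phi> w) \<le> B"
proof -
  have dom: "integrable lborel (\<lambda>u. norm (T u) * exp (\<bar>u\<bar> * r))" for r
  proof -
    define c where "c = nat \<lceil>r\<rceil> + 1"
    have c: "real c \<ge> r + 1" unfolding c_def by linarith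
    obtain K where K: "\<And>u. norm (T u) \<le> K * exp (- real c * \<bar>u\<bar>)" using bd[of c] by blast
    have K0: "K \<ge> 0" using order_trans[OF norm_ge_zero K[of 0]] by simp
    show ?thesis
    proof (rule Bochner_Integration.integrable_bound)
      show "integrable lborel (\<lambda>u. K * exp (- \<bar>u\<bar>))" by (intro integrable_mult_right integrable_exp_minus_abs)
      show "AE u in lborel. norm (norm (T u) * exp (\<bar>u\<bar> * r)) \<le> norm (K * exp (- \<bar>u\<bar>))"
      proof (rule AE_I2)
        fix u :: real
        have "norm (T u) * exp (\<bar>u\<bar> * r) \<le> K * exp (- real c * \<bar>u\<bar>) * exp (\<bar>u\<bar> * r)"
          using K by (intro mult_right_mono) auto
        also have "\<dots> = K * exp (\<bar>u\<bar> * (r - real c))" by (simp add: exp_add[symmetric] algebra_simps)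
        also have "\<dots> \<le> K * exp (\<bar>u\<bar> * (- 1))"
        proof -
          have "\<bar>u\<bar> * (r - real c) \<le> \<bar>u\<bar> * (- 1)" by (rule mult_left_mono) (use c in auto)
          then show ?thesis using K0 by (intro mult_left_mono) (simp_all only: exp_le_cancel_iff)
        qed
        finally show "norm (norm (T u) * exp (\<bar>u\<bar> * r)) \<le> norm (K * exp (- \<bar>u\<bar>))" using K0 by simp
      qed
    qed (use meas in measurable)
  qed
  have nexp: "norm (T u * exp (of_real u * w)) \<le> norm (T u) * exp (\<bar>u\<bar> * \<bar>Re w\<bar>)" for u w
  proof -
    have "u * Re w \<le> \<bar>u\<bar> * \<bar>Re w\<bar>" by (metis abs_ge_self abs_mult)
    then show ?thesis by (simp add: norm_mult mult_left_mono)
  qed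
  show int: "integrable lborel (\<lambda>u. T u * exp (of_real u * w))" for w
    by (rule Bochner_Integration.integrable_bound[OF dom[of "\<bar>Re w\<bar>"]]) (use meas nexp in \<open>auto simp: abs_mult\<close>)
  show "\<exists>B. \<forall>w. \<bar>Re w\<bar> \<le> R \<longrightarrow> norm (\<Phi> w) \<le> B"
  proof (intro exI allI impI)
    fix w :: complex assume w: "\<bar>Re w\<bar> \<le> R"
    have "norm (\<Phi> w) \<le> (LINT u|lborel. norm (T u * exp (of_real u * w)))"
      unfolding \<Phi>_def by (rule integral_norm_bound)
    also have "\<dots> \<le> (LINT u|lborel. norm (T u) * exp (\<bar>u\<bar> * R))"
    proof (rule integral_mono)
      show "integrable lborel (\<lambda>u. norm (T u * exp (of_real u * w)))" using int by (rule integrable_norm)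
      show "integrable lborel (\<lambda>u. norm (T u) * exp (\<bar>u\<bar> * R))" by (rule dom)
      fix u :: real
      have "norm (T u) * exp (\<bar>u\<bar> * \<bar>Re w\<bar>) \<le> norm (T u) * exp (\<bar>u\<bar> * R)"
        using w by (auto intro!: mult_left_mono)
      then show "norm (T u * exp (of_real u * w)) \<le> norm (T u) * exp (\<bar>u\<bar> * R)"
        using nexp order_trans by blast
    qed
    finally show "norm (\<Phi> w) \<le> (LINT u|lborel. norm (T u) * exp (\<bar>u\<bar> * R))" .
  qed
  \<comment> \<open>The Taylor coefficients at 0: the moments of \<open>T\<close> divided by
    k!.\<close>
  define a where "a k = (LINT u|lborel. T u * of_real u ^ k / fact k)" for k
  have sums: "(\<lambda>k. a k * w ^ k) sums \<Phi> w" for w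
  proof -
    let ?f = "\<lambda>k u. T u * (of_real u ^ k / fact k) * w ^ k"
    have nf: "norm (?f k u) = norm (T u) * ((\<bar>u\<bar> * norm w) ^ k / fact k)" for k u
      by (simp add: norm_mult norm_divide norm_power power_mult_distrib)
    have es: "(\<lambda>k. (\<bar>u\<bar> * norm w) ^ k / fact k) sums exp (\<bar>u\<bar> * norm w)" for u
      using exp_converges[of "\<bar>u\<bar> * norm w"] by (simp add: field_simps)
    have part: "(\<Sum>k<n. norm (?f k u)) \<le> norm (T u) * exp (\<bar>u\<bar> * norm w)" for n u
    proof -
      have "(\<Sum>k<n. (\<bar>u\<bar> * norm w) ^ k / fact k) \<le> exp (\<bar>u\<bar> * norm w)"
      proof -
        have "(\<Sum>k<n. (\<bar>u\<bar> * norm w) ^ k / fact k) \<le> (\<Sum>k. (\<bar>u\<bar> * norm w) ^ k / fact k)"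
          using es[of u] by (intro sum_le_suminf) (auto simp: sums_iff)
        then show ?thesis using es[of u] by (simp only: sums_iff)
      qed
      then show ?thesis unfolding nf sum_distrib_left[symmetric] by (rule mult_left_mono) simp
    qed
    have ik: "integrable lborel (?f k)" for k
    proof (rule Bochner_Integration.integrable_bound[OF dom[of "norm w"]])
      show "?f k \<in> borel_measurable lborel" using meas by measurable
      show "AE u in lborel. norm (?f k u) \<le> norm (norm (T u) * exp (\<bar>u\<bar> * norm w))"
      proof (rule AE_I2)
        fix u :: real
        have "norm (?f k u) \<le> (\<Sum>j<Suc k. norm (?f j u))" by (rule member_le_sum) auto
        then show "norm (?f k u) \<le> norm (norm (T u) * exp (\<bar>u\<bar> * norm w))" using part[of u "Suc k"] by simp
      qed
    qed
    have pts: "summable (\<lambda>k. norm (?f k u))" for u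
      unfolding nf using es[of u] by (intro summable_mult) (auto simp: sums_iff)
    have smi: "summable (\<lambda>k. LINT u|lborel. norm (?f k u))"
    proof (rule summableI_nonneg_bounded)
      fix n
      have "(\<Sum>k<n. LINT u|lborel. norm (?f k u)) = (LINT u|lborel. (\<Sum>k<n. norm (?f k u)))"
        by (rule Bochner_Integration.integral_sum[symmetric]) (rule integrable_norm[OF ik])
      also have "\<dots> \<le> (LINT u|lborel. norm (T u) * exp (\<bar>u\<bar> * norm w))"
        by (rule integral_mono[OF _ dom part]) (intro Bochner_Integration.integrable_sum integrable_norm[OF ik])
      finally show "(\<Sum>k<n. LINT u|lborel. norm (?f k u)) \<le> (LINT u|lborel. norm (T u) * exp (\<bar>u\<bar> * norm w))" .
    qed (simp add: integral_nonneg_AE)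
    have "(\<lambda>k. integral\<^sup>L lborel (?f k)) sums (LINT u|lborel. (\<Sum>k. ?f k u))"
      by (rule sums_integral[OF ik _ smi]) (use pts in simp)
    moreover have "integral\<^sup>L lborel (?f k) = a k * w ^ k" for k by (simp add: a_def)
    moreover have "(\<Sum>k. ?f k u) = T u * exp (of_real u * w)" for u
    proof -
      have "(\<lambda>k. (of_real u * w) ^ k / fact k) sums exp (of_real u * w)"
        using exp_converges[of "of_real u * w"] by (simp add: scaleR_conv_of_real field_simps)
      from sums_mult[OF this, of "T u"] show ?thesis
        by (simp add: power_mult_distrib sums_iff mult_ac)
    qed
    ultimately show ?thesis by (simp add: \<Phi>_def)
  qed
  have "\<Phi> holomorphic_on ball 0 r" for r
    by (rule power_series_holomorphic[where a = a]) (use sums in simp)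
  then have "\<Phi> field_differentiable (at z)" for z
    using holomorphic_on_imp_differentiable_at[of \<Phi> "ball 0 (norm z + 1)" z] by simp
  then show "\<Phi> holomorphic_on UNIV" by (simp add: holomorphic_on_def field_differentiable_at_within)
qed

section \<open>Real primitive characters\<close>

lemma periodic_mod:
  fixes h :: "nat \<Rightarrow> 'a"
  assumes "\<And>n. h (n + d) = h n"
  shows "h (n mod d) = h n"
proof -
  have "h (r + k * d) = h r" for r k
  proof (induction k)
    case (Suc k)
    have "h (r + Suc k * d) = h ((r + k * d) + d)" by (simp add: algebra_simps)
    then show ?case using Suc assms by simp
  qed simp
  from this[of "n mod d" "n div d"] show ?thesis by (simp add: mod_div_mult_eq)
qed

text \<open>For \<open>d\<close> dividing \<open>q\<close> this is the surjectivity of reduction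
  from units modulo \<open>q\<close> to units modulo \<open>d\<close>. The witness \<open>t\<close>
  is the product of the primes of \<open>q\<close> that do not divide \<open>n\<close>: each prime
  of \<open>q\<close> then divides exactly one of \<open>n\<close> and \<open>d * t\<close>.\<close>

lemma coprime_shift:
  fixes n d q :: nat
  assumes "coprime n d" "q > 0"
  shows "\<exists>t. coprime (n + d * t) q"
proof -
  define t where "t = \<Prod>{p \<in> prime_factors q. \<not> p dvd n}"
  have fin: "finite {p \<in> prime_factors q. \<not> p dvd n}" by simp
  have "coprime (n + d * t) q"
  proof (rule ccontr)
    assume "\<not> coprime (n + d * t) q"
    then obtain p where p: "prime p" "p dvd n + d * t" "p dvd q"
      by (metis coprime_iff_gcd_eq_1 gcd_nat.bounded_iff prime_factor_nat)
    have pq: "p \<in> prime_factors q" using p assms(2) by (simp add: prime_factors_dvd)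
    show False
    proof (cases "p dvd n")
      case True
      then have "p dvd d * t" using p(2) by (simp add: dvd_add_right_iff)
      moreover have "\<not> p dvd d" using True assms(1) p(1) by (metis coprime_common_divisor_nat not_prime_1)
      ultimately have "p dvd t" using p(1) prime_dvd_mult_iff by blast
      then obtain r where r: "r \<in> {p \<in> prime_factors q. \<not> p dvd n}" "p dvd r"
        unfolding t_def using prime_dvd_prod_iff[OF fin p(1), of "\<lambda>x. x"] by auto
      then have "prime r" by auto
      then have "p = r" using p(1) r(2) primes_dvd_imp_eq by blast
      then show False using r(1) True by simp
    next
      case False
      then have "p dvd t" unfolding t_def using fin pq by (intro dvd_prodI[of _ _ "\<lambda>x. x"]) auto
      then have "p dvd d * t" by simp
      then show False using p(2) False by (metis dvd_add_left_iff)
    qed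
  qed
  then show ?thesis by blast
qed

lemma sum_roots_of_unity:
  fixes d :: nat and j :: int
  assumes d: "d > 0"
  shows "(\<Sum>m<d. cis (2 * pi * real m * of_int j / real d)) = (if int d dvd j then of_nat d else 0)"
proof -
  define z where "z = cis (2 * pi * of_int j / real d)"
  have pow: "cis (2 * pi * real m * of_int j / real d) = z ^ m" for m
    unfolding z_def Complex.DeMoivre by (rule arg_cong[of _ _ cis]) simp
  have zd: "z ^ d = 1"
  proof -
    have "z ^ d = cis (2 * pi * of_int j)"
      unfolding z_def Complex.DeMoivre using d by (intro arg_cong[of _ _ cis]) simp
    then show ?thesis using cis_multiple_2pi[of "of_int j"] by simp
  qed
  show ?thesis
  proof (cases "z = 1")
    case True
    then have "cos (2 * pi * of_int j / real d) = 1" by (simp add: z_def complex_eq_iff)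
    then obtain k :: int where "2 * pi * of_int j / real d = of_int k * 2 * pi"
      unfolding cos_one_2pi_int by auto
    then have "of_int j = of_int k * real d" using d by (simp add: field_simps)
    then have "(of_int j :: real) = of_int (k * int d)" by simp
    then have "j = k * int d" unfolding of_int_eq_iff .
    then show ?thesis unfolding pow True by simp
  next
    case False
    have "\<not> int d dvd j"
    proof
      assume "int d dvd j"
      then obtain k where "j = int d * k" by blast
      then have "z = 1" using d cis_multiple_2pi[of "of_int k"] by (simp add: z_def mult_ac)
      then show False using False by simp
    qed
    then show ?thesis unfolding pow using geometric_sum[OF False, of d] zd by simp
  qed
qed

lemma bij_betw_mult_mod:
  fixes b d :: nat
  assumes "coprime b d" "d > 0"
  shows "bij_betw (\<lambda>k. b * k mod d) {..<d} {..<d}"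
proof -
  have "inj_on (\<lambda>k. b * k mod d) {..<d}"
  proof (rule inj_onI)
    fix x y assume xy: "x \<in> {..<d}" "y \<in> {..<d}" "b * x mod d = b * y mod d"
    then have "[b * x = b * y] (mod d)" by (simp add: cong_def)
    then have "[x = y] (mod d)" using assms(1) cong_mult_lcancel_nat by blast
    then show "x = y" using xy by (simp add: cong_def)
  qed
  moreover have "(\<lambda>k. b * k mod d) ` {..<d} \<subseteq> {..<d}" using assms(2) by auto
  ultimately show ?thesis by (simp add: bij_betw_def endo_inj_surj)
qed

lemma cis_period_mod:
  fixes m d :: nat and j :: int
  shows "cis (2 * pi * real (m mod d) * of_int j / real d) = cis (2 * pi * real m * of_int j / real d)"
proof (cases "d = 0")
  case False
  have "real m = real (m mod d) + real (m div d) * real d"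
    by (metis mod_div_mult_eq of_nat_add of_nat_mult)
  then have "2 * pi * real m * of_int j / real d = 2 * pi * real (m mod d) * of_int j / real d + 2 * pi * of_int (int (m div d) * j)"
    using False by (simp add: field_simps)
  then have "cis (2 * pi * real m * of_int j / real d) = cis (2 * pi * real (m mod d) * of_int j / real d) * cis (2 * pi * of_int (int (m div d) * j))"
    by (simp only: cis_mult)
  moreover have "cis (2 * pi * of_int (int (m div d) * j)) = 1"
    by (rule cis_multiple_2pi) simp
  ultimately show ?thesis by simp
qed simp

text \<open>The conductor is found as the least modulus carrying a nonzero function that transforms like
  the character; minimality then yields uniqueness up to scalars, and since the finite Fourier
  transform preserves such functions, it acts on the primitive character by a scalar.\<close>

theorem primitive_real_character:
  assumes chi: "dirichlet_character q chi" and real: "real_character chi"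
    and np: "chi \<noteq> principal_character q"
  obtains d :: nat and h :: "nat \<Rightarrow> complex" and \<tau> :: complex
  where "d > 1" "\<And>n. h (n + d) = h n" "\<And>m n. h (m * n) = h m * h n" "\<And>n. h n \<in> {-1, 0, 1}"
    "h 0 = 0" "h 1 = 1" "\<And>n. coprime n q \<Longrightarrow> h n = chi n" "\<tau> \<noteq> 0"
    "\<And>m. (\<Sum>k<d. h k * cis (2 * pi * real k * real m / real d)) = \<tau> * h m"
proof -
  have cper: "\<And>n. chi (n + q) = chi n" and cmult: "\<And>m n. chi (m * n) = chi m * chi n"
    and cnz: "\<And>n. chi n \<noteq> 0 \<longleftrightarrow> coprime n q" and q0: "q > 0"
    using chi by (auto simp: dirichlet_character_def)
  \<comment> \<open>Unlike multiplicativity this condition is linear in \<open>h\<close>, so that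
    rescaling and the finite Fourier transform respect it; multiplicativity is recovered
    afterwards.\<close>
  define V where "V d h \<longleftrightarrow> (\<forall>n. h (n + d) = h n) \<and> (\<forall>b n. coprime b q \<longrightarrow> h (b * n) = chi b * h n)"
    for d and h :: "nat \<Rightarrow> complex"
  define P where "P d \<longleftrightarrow> d > 0 \<and> d dvd q \<and> (\<exists>h. V d h \<and> (\<exists>n. h n \<noteq> 0))" for d
  have "chi 1 \<noteq> 0" using cnz[of 1] by simp
  then have Pq: "P q" unfolding P_def V_def using cper cmult q0 by auto
  define d where "d = (LEAST d. P d)"
  have Pd: "P d" unfolding d_def using Pq by (rule LeastI)
  have least: "d \<le> e" if "P e" for e unfolding d_def using that by (rule Least_le)
  have d0: "d > 0" and dq: "d dvd q" using Pd by (auto simp: P_def)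
  have copd: "coprime b d" if "coprime b q" for b using that dq coprime_divisors[of b b d q] by auto
  \<comment> \<open>If a prime \<open>p\<close> divides both \<open>n\<close> and \<open>d\<close>,
    then n \<mapsto> h(p n) has the smaller period d / p and transforms in the same way, so
    minimality of \<open>d\<close> forces it to vanish.\<close>
  have van: "h n = 0" if V: "V d h" and nc: "\<not> coprime n d" for h n
  proof -
    obtain p where p: "prime p" "p dvd n" "p dvd d"
      using nc by (metis coprime_iff_gcd_eq_1 gcd_nat.bounded_iff prime_factor_nat)
    obtain e where e: "d = p * e" using p(3) by blast
    have e0: "e > 0" "e < d" using e d0 prime_gt_1_nat[OF p(1)] by auto
    have "V e (\<lambda>n. h (p * n))"
      using V unfolding V_def by (auto simp: e algebra_simps)
    moreover have "e dvd q" using dq e by (metis dvd_mult_right)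
    ultimately have "\<not> (\<exists>n. h (p * n) \<noteq> 0)" using least[of e] e0 unfolding P_def by auto
    moreover obtain k where "n = p * k" using p(2) by blast
    ultimately show ?thesis by simp
  qed
  have rep: "\<exists>n'. coprime n' q \<and> n' mod d = n mod d" if "coprime n d" for n
    using coprime_shift[OF that q0] by auto
  have Vmod: "h (n mod d) = h n" if "V d h" for h n
    by (rule periodic_mod) (use that in \<open>simp add: V_def\<close>)
  obtain h1 n1 where h1: "V d h1" "h1 n1 \<noteq> 0" using Pd by (auto simp: P_def)
  have Vrep: "h n = chi n' * h 1" if "V d h" "coprime n' q" "n' mod d = n mod d" for h n n'
  proof -
    have "h n = h n'" using Vmod[OF that(1), of n] Vmod[OF that(1), of n'] that(3) by simp
    also have "\<dots> = chi n' * h 1" using that(1,2) unfolding V_def by (metis mult.right_neutral)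
    finally show ?thesis .
  qed
  have "coprime n1 d" using van[OF h1(1)] h1(2) by blast
  from rep[OF this] have h11: "h1 1 \<noteq> 0" using Vrep[OF h1(1)] h1(2) by force
  define h where "h n = h1 n / h1 1" for n
  have Vh: "V d h" using h1(1) by (simp add: V_def h_def)
  have one: "h 1 = 1" using h11 by (simp add: h_def)
  have uniq: "g n = g 1 * h n" if "V d g" for g n
  proof (cases "coprime n d")
    case True
    from rep[OF this] obtain n' where "coprime n' q" "n' mod d = n mod d" by blast
    then show ?thesis using Vrep[OF that] Vrep[OF Vh] one by simp
  next
    case False
    then show ?thesis using van[OF that] van[OF Vh] by simp
  qed
  have per: "h (n + d) = h n" for n using Vh by (simp add: V_def)
  have hmod: "h (n mod d) = h n" for n by (rule Vmod[OF Vh])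
  have hchi: "h n = chi n" if "coprime n q" for n
    using Vh that one unfolding V_def by (metis mult.right_neutral)
  have vals: "h n \<in> {-1, 0, 1}" for n
  proof (cases "coprime n d")
    case True
    from rep[OF this] obtain n' where "coprime n' q" "n' mod d = n mod d" by blast
    then show ?thesis using Vrep[OF Vh] one real_character_values[OF chi real] by fastforce
  qed (use van[OF Vh] in simp)
  have mult: "h (m * n) = h m * h n" for m n
  proof (cases "coprime m d")
    case True
    from rep[OF this] obtain m' where m': "coprime m' q" "m' mod d = m mod d" by blast
    have "h (m * n) = h (m' * n)" using hmod[of "m * n"] hmod[of "m' * n"] m'(2) by (metis mod_mult_left_eq)
    also have "\<dots> = chi m' * h n" using Vh m'(1) by (simp add: V_def)
    also have "chi m' = h m" using Vrep[OF Vh m'] one by simp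
    finally show ?thesis .
  next
    case False
    then have "\<not> coprime (m * n) d" by auto
    then show ?thesis using False van[OF Vh] by simp
  qed
  have d1: "d > 1"
  proof (rule ccontr)
    assume "\<not> d > 1"
    then have "d = 1" using d0 by simp
    then have "h n = 1" for n using hmod[of n] hmod[of 1] one by simp
    then have "chi n = principal_character q n" for n
      using hchi[of n] cnz[of n] by (auto simp: principal_character_def)
    then show False using np by blast
  qed
  have h0: "h 0 = 0" using van[OF Vh, of 0] d1 by simp
  define hat where "hat m = (\<Sum>k<d. h k * cis (2 * pi * real k * real m / real d))" for m
  have hatj: "hat m = (\<Sum>k<d. h k * cis (2 * pi * real k * of_int (int m) / real d))" for m
    by (simp add: hat_def)
  have "V d hat" unfolding V_def
  proof safe
    fix n
    have "cis (2 * pi * real k * real (n + d) / real d) = cis (2 * pi * real k * real n / real d)" for k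
      using cis_period_mod[of "n + d" d "int k"] cis_period_mod[of n d "int k"] by (simp add: mult_ac)
    then show "hat (n + d) = hat n" by (simp add: hat_def)
  next
    fix b n assume b: "coprime b q"
    \<comment> \<open>Here the character has to be real: substituting b k for k produces the inverse
      of \<open>chi b\<close>, which equals \<open>chi b\<close> only because the value is 1 or
      -1.\<close>
    have cb: "chi b * chi b = 1" using real_character_values[OF chi real b] by auto
    have "chi b * hat (b * n) = (\<Sum>k<d. h (b * k mod d) * cis (2 * pi * real (b * k mod d) * of_int (int n) / real d))"
      unfolding hat_def sum_distrib_left cis_period_mod hmod mult hchi[OF b]
      by (intro sum.cong) (simp_all add: mult_ac)
    also have "\<dots> = hat n"
      unfolding hatj using sum.reindex_bij_betw[OF bij_betw_mult_mod[OF copd[OF b] d0], of "\<lambda>k. h k * cis (2 * pi * real k * of_int (int n) / real d)"] .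
    finally show "hat (b * n) = chi b * hat n" using cb by (metis mult.assoc mult_1)
  qed
  then have hathat: "hat m = hat 1 * h m" for m by (rule uniq)
  define \<tau>' where "\<tau>' = hat 1"
  have hh: "hat m = \<tau>' * h m" for m unfolding \<tau>'_def by (rule hathat)
  have "\<tau>' \<noteq> 0" unfolding \<tau>'_def
  proof
    assume "hat 1 = 0"
    then have "hat m = 0" for m using hathat[of m] by simp
    \<comment> \<open>Fourier inversion at the point 1: the sum on the left also evaluates to d
      times \<open>h 1\<close>, that is to \<open>d\<close>.\<close>
    then have "(\<Sum>m<d. hat m * cis (2 * pi * real m * of_int (-1) / real d)) = 0"
      by simp
    moreover have "(\<Sum>m<d. hat m * cis (2 * pi * real m * of_int (-1) / real d)) = (\<Sum>m<d. \<Sum>k<d. h k * cis (2 * pi * real m * of_int (int k - 1) / real d))"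
    proof (intro sum.cong refl)
      fix m
      have "cis (2 * pi * real k * real m / real d) * cis (2 * pi * real m * of_int (-1) / real d) = cis (2 * pi * real m * of_int (int k - 1) / real d)" for k
        unfolding cis_mult using d0 by (simp add: field_simps)
      then show "hat m * cis (2 * pi * real m * of_int (-1) / real d) = (\<Sum>k<d. h k * cis (2 * pi * real m * of_int (int k - 1) / real d))"
        unfolding hat_def sum_distrib_right mult.assoc by simp
    qed
    also have "\<dots> = (\<Sum>k<d. h k * (\<Sum>m<d. cis (2 * pi * real m * of_int (int k - 1) / real d)))"
      by (subst sum.swap) (simp add: sum_distrib_left)
    also have "\<dots> = (\<Sum>k<d. if k = 1 then of_nat d else 0)"
    proof (intro sum.cong refl)
      fix k assume k: "k \<in> {..<d}"
      have "int d dvd int k - 1 \<longleftrightarrow> k = 1"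
      proof
        assume *: "int d dvd int k - 1"
        show "k = 1"
        proof (rule ccontr)
          assume "k \<noteq> 1"
          then have "int k - 1 \<noteq> 0" by simp
          from dvd_imp_le_int[OF this *] have "int d \<le> \<bar>int k - 1\<bar>" by simp
          moreover have "int k < int d" using k by simp
          ultimately show False using d1 by linarith
        qed
      qed simp
      then show "h k * (\<Sum>m<d. cis (2 * pi * real m * of_int (int k - 1) / real d)) = (if k = 1 then of_nat d else 0)"
        unfolding sum_roots_of_unity[OF d0] using one by simp
    qed
    also have "\<dots> = of_nat d" using d1 by simp
    finally show False using d0 by simp
  qed
  then show thesis
    using that[OF d1 per mult vals h0 one hchi _ hh[unfolded hat_def]] by blast
qed

section \<open>Growth of the Gamma function\<close>

lemma norm_Gamma_le:
  assumes "Re s > 0"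
  shows "norm (Gamma s) \<le> Gamma (Re s)"
proof -
  let ?f = "\<lambda>u. of_real (exp (- (1 * exp u))) * exp (of_real u * s)"
  have "norm (Gamma s) = norm (LINT u|lborel. ?f u)"
    using Gamma_integral_exp(2)[OF assms, of 1] by simp
  also have "\<dots> \<le> (LINT u|lborel. norm (?f u))" by (rule integral_norm_bound)
  also have "\<dots> = (LINT u|lborel. exp (- (1 * exp u)) * exp (u * Re s))"
    by (simp add: norm_mult)
  also have "\<dots> = Gamma (Re s)" using Gamma_integral_exp_real(2)[OF assms, of 1] by simp
  finally show ?thesis .
qed

text \<open>Restrict the integral to u between m and m + 1. As \<open>m\<close> is arbitrary, Gamma
  outgrows every exponential, with an explicit constant.\<close>

lemma Gamma_real_lower:
  fixes x m :: real
  assumes x: "x > 0"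
  shows "exp (m * x) * exp (- exp (m + 1)) \<le> Gamma x"
proof -
  let ?f = "\<lambda>u. exp (- (1 * exp u)) * exp (u * x)"
  let ?c = "exp (m * x) * exp (- exp (m + 1))"
  have int: "integrable lborel ?f" using Gamma_integral_exp_real(1)[OF x, of 1] by simp
  have "(LINT u|lborel. indicator {m..m+1} u *\<^sub>R ?c) \<le> (LINT u|lborel. ?f u)"
  proof (rule integral_mono[OF _ int])
    show "integrable lborel (\<lambda>u. indicator {m..m+1} u *\<^sub>R ?c)" by simp
    fix u :: real
    show "indicator {m..m+1} u *\<^sub>R ?c \<le> ?f u"
    proof (cases "u \<in> {m..m+1}")
      case True
      have "exp (m * x) \<le> exp (u * x)" using True x by (simp add: mult_right_mono)
      moreover have "exp (- exp (m + 1)) \<le> exp (- exp u)" using True by simp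
      ultimately have "?c \<le> exp (u * x) * exp (- exp u)" by (intro mult_mono) auto
      then show ?thesis using True by (simp add: mult.commute)
    qed simp
  qed
  moreover have "(LINT u|lborel. indicator {m..m+1} u *\<^sub>R ?c) = ?c" by simp
  moreover have "(LINT u|lborel. ?f u) = Gamma x" using Gamma_integral_exp_real(2)[OF x, of 1] by simp
  ultimately show ?thesis by linarith
qed

text \<open>Compare the limit products factor by factor: |s + k| / (Re s + k) is at most the same
  ratio for the point with equal imaginary part and real part 1, since moving to the right brings
  the ratio closer to 1. Lower bounds for Gamma are thereby reduced to a single line.\<close>

lemma norm_rGamma_le_shift:
  assumes "Re s \<ge> 1"
  shows "norm (rGamma s) \<le> rGamma (Re s) * norm (rGamma (Complex 1 (Im s)))"
proof -
  define s1 where "s1 = Complex 1 (Im s)"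
  have ineq: "norm (rGamma_series s n) * rGamma_series (1::real) n \<le> rGamma_series (Re s) n * norm (rGamma_series s1 n)" for n
  proof -
    have t: "norm (s + of_nat k) * (1 + of_nat k) \<le> (Re s + of_nat k) * norm (s1 + of_nat k)" for k
    proof (rule power2_le_imp_le)
      have "(Im s)\<^sup>2 * (1 + real k)\<^sup>2 \<le> (Im s)\<^sup>2 * (Re s + real k)\<^sup>2"
        using assms by (intro mult_left_mono power_mono) auto
      moreover have gen: "(r + i) * q \<le> r * (q + i)" if "i * q \<le> i * r" for r i q :: real
        using that by (simp add: algebra_simps)
      moreover have n: "(norm (s + of_nat k))\<^sup>2 = (Re s + real k)\<^sup>2 + (Im s)\<^sup>2" "(norm (s1 + of_nat k))\<^sup>2 = (1 + real k)\<^sup>2 + (Im s)\<^sup>2"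
        by (simp_all add: cmod_power2 s1_def)
      ultimately show "(norm (s + of_nat k) * (1 + of_nat k))\<^sup>2 \<le> ((Re s + of_nat k) * norm (s1 + of_nat k))\<^sup>2"
        unfolding power_mult_distrib n by blast
      show "0 \<le> (Re s + of_nat k) * norm (s1 + of_nat k)" using assms by simp
    qed
    have "(\<Prod>k = 0..<n+1. norm (s + of_nat k) * (1 + of_nat k)) \<le> (\<Prod>k = 0..<n+1. (Re s + of_nat k) * norm (s1 + of_nat k))"
      by (rule prod_mono) (use t in auto)
    then have p: "norm (pochhammer s (n+1)) * pochhammer 1 (n+1) \<le> pochhammer (Re s) (n+1) * norm (pochhammer s1 (n+1))"
      unfolding pochhammer_prod prod_norm[symmetric] prod.distrib by simp
    let ?F = "fact n * exp (Re s * ln (real n)) * (fact n * exp (1 * ln (real n)))"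
    have F: "?F > 0" by simp
    have e: "norm (exp (z * complex_of_real (ln (real n)))) = exp (Re z * ln (real n))" for z by simp
    have 1: "norm (rGamma_series s n) * rGamma_series (1::real) n = norm (pochhammer s (n+1)) * pochhammer 1 (n+1) / ?F"
      unfolding rGamma_series_def norm_divide norm_mult e by simp
    have 2: "rGamma_series (Re s) n * norm (rGamma_series s1 n) = pochhammer (Re s) (n+1) * norm (pochhammer s1 (n+1)) / ?F"
      unfolding rGamma_series_def norm_divide norm_mult e by (simp add: s1_def)
    show ?thesis unfolding 1 2 using p F by (intro divide_right_mono) auto
  qed
  have "norm (rGamma s) * rGamma (1::real) \<le> rGamma (Re s) * norm (rGamma s1)"
  proof (rule LIMSEQ_le)
    show "(\<lambda>n. norm (rGamma_series s n) * rGamma_series (1::real) n) \<longlonglongrightarrow> norm (rGamma s) * rGamma (1::real)"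
      by (intro tendsto_intros)
    show "(\<lambda>n. rGamma_series (Re s) n * norm (rGamma_series s1 n)) \<longlonglongrightarrow> rGamma (Re s) * norm (rGamma s1)"
      by (intro tendsto_intros)
  qed (use ineq in blast)
  then show ?thesis by (simp add: s1_def)
qed

text \<open>For z = 1 + i t the reflection formula gives |t| |1/\<Gamma>(z)|^2 = |sin(pi z)| / pi,
  because 1 - z and the conjugate of z differ by 1. Compactness handles |t| \<le> 1. The exponent is
  not the sharp one; any exponential in |t| suffices later.\<close>

lemma norm_rGamma_line:
  "\<exists>C>0. \<forall>t::real. norm (rGamma (Complex 1 t)) \<le> C * exp (pi * \<bar>t\<bar>)"
proof -
  have big: "norm (rGamma (Complex 1 t)) \<le> exp (pi * \<bar>t\<bar>)" if t: "\<bar>t\<bar> \<ge> 1" for t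
  proof -
    let ?z = "Complex 1 t"
    have z1: "1 - ?z = - (\<i> * of_real t)" by (simp add: complex_eq_iff)
    have r1: "rGamma (- (\<i> * of_real t)) = - (\<i> * of_real t) * rGamma (cnj ?z)"
    proof -
      have "- (\<i> * of_real t) + 1 = cnj ?z" by (simp add: complex_eq_iff)
      then show ?thesis using rGamma_plus1[of "- (\<i> * complex_of_real t)"] by simp
    qed
    have 1: "norm (rGamma ?z * rGamma (1 - ?z)) = \<bar>t\<bar> * (norm (rGamma ?z))\<^sup>2"
      unfolding z1 r1 by (simp add: norm_mult cnj_rGamma[symmetric] power2_eq_square del: complex_cnj)
    have 2: "norm (sin (of_real pi * ?z)) \<le> exp (pi * \<bar>t\<bar>)"
    proof -
      have a: "norm (exp (\<i> * (of_real pi * ?z))) \<le> exp (pi * \<bar>t\<bar>)" "norm (exp (- (\<i> * (of_real pi * ?z)))) \<le> exp (pi * \<bar>t\<bar>)"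
        by (auto simp: abs_if mult_le_0_iff)
      have "norm (exp (\<i> * (of_real pi * ?z)) - exp (- (\<i> * (of_real pi * ?z)))) \<le> exp (pi * \<bar>t\<bar>) + exp (pi * \<bar>t\<bar>)"
        by (rule order_trans[OF norm_triangle_ineq4 add_mono[OF a]])
      then show ?thesis unfolding sin_exp_eq by (simp add: norm_divide norm_mult)
    qed
    have "\<bar>t\<bar> * (norm (rGamma ?z))\<^sup>2 = norm (sin (of_real pi * ?z)) / pi"
      using 1 unfolding rGamma_reflection_complex by (simp add: norm_divide)
    also have "\<dots> \<le> exp (pi * \<bar>t\<bar>) / pi" by (rule divide_right_mono[OF 2]) simp
    finally have "\<bar>t\<bar> * (norm (rGamma ?z))\<^sup>2 \<le> exp (pi * \<bar>t\<bar>) / pi" .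
    moreover have "1 * (norm (rGamma ?z))\<^sup>2 \<le> \<bar>t\<bar> * (norm (rGamma ?z))\<^sup>2" using t by (intro mult_right_mono) auto
    moreover have "exp (pi * \<bar>t\<bar>) / pi \<le> exp (pi * \<bar>t\<bar>) / 1" using pi_gt3 by (intro divide_left_mono) auto
    moreover have "exp (pi * \<bar>t\<bar>) \<le> (exp (pi * \<bar>t\<bar>))\<^sup>2" by (rule self_le_power) auto
    ultimately have "(norm (rGamma ?z))\<^sup>2 \<le> (exp (pi * \<bar>t\<bar>))\<^sup>2" by linarith
    then show ?thesis by (rule power2_le_imp_le) simp
  qed
  have "bounded ((\<lambda>t. rGamma (Complex 1 t)) ` {-1..1})"
  proof (intro compact_imp_bounded compact_continuous_image)
    show "continuous_on {-1..1} (\<lambda>t. rGamma (Complex 1 t))"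
      by (rule continuous_on_compose2[OF holomorphic_on_imp_continuous_on[OF holomorphic_rGamma[of UNIV]]])
         (auto simp: Complex_eq intro!: continuous_intros)
  qed simp
  then obtain B where B: "B > 0" "\<And>t. t \<in> {-1..1} \<Longrightarrow> norm (rGamma (Complex 1 t)) \<le> B"
    unfolding bounded_pos by blast
  show ?thesis
  proof (intro exI conjI allI)
    show "1 + B > 0" using B by simp
    fix t :: real
    have e1: "exp (pi * \<bar>t\<bar>) \<ge> 1" by simp
    show "norm (rGamma (Complex 1 t)) \<le> (1 + B) * exp (pi * \<bar>t\<bar>)"
    proof (cases "\<bar>t\<bar> \<ge> 1")
      case True
      have "exp (pi * \<bar>t\<bar>) \<le> (1 + B) * exp (pi * \<bar>t\<bar>)" using B e1 by simp
      then show ?thesis using big[OF True] by linarith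
    next
      case False
      then have "t \<in> {-1..1}" by (auto simp: abs_if split: if_splits)
      then have "norm (rGamma (Complex 1 t)) \<le> B" by (rule B(2))
      also have "B * 1 \<le> (1 + B) * exp (pi * \<bar>t\<bar>)" using B e1 by (intro mult_mono) auto
      finally show ?thesis by simp
    qed
  qed
qed

text \<open>The comparison with the line is applied to s + 1, whose real part exceeds 1; going back
  by \<Gamma>(s + 1) = s \<Gamma>(s) leaves the factors \<open>Re s\<close> and
  \<open>norm s\<close>.\<close>

lemma norm_Gamma_lower:
  "\<exists>C>0. \<forall>s. Re s > 0 \<longrightarrow> Re s * Gamma (Re s) \<le> C * exp (pi * \<bar>Im s\<bar>) * norm s * norm (Gamma s)"
proof -
  obtain C where C: "C > 0" "\<And>t. norm (rGamma (Complex 1 t)) \<le> C * exp (pi * \<bar>t\<bar>)" using norm_rGamma_line by blast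
  have "Re s * Gamma (Re s) \<le> C * exp (pi * \<bar>Im s\<bar>) * norm s * norm (Gamma s)" if s: "Re s > 0" for s
  proof -
    have ns: "s \<notin> \<int>\<^sub>\<le>\<^sub>0" using s by (auto elim!: nonpos_Ints_cases)
    have rs: "Re s \<notin> \<int>\<^sub>\<le>\<^sub>0" using s by (auto elim!: nonpos_Ints_cases)
    have "norm (rGamma (s + 1)) \<le> rGamma (Re s + 1) * norm (rGamma (Complex 1 (Im s)))"
      using norm_rGamma_le_shift[of "s + 1"] s by simp
    also have "\<dots> \<le> rGamma (Re s + 1) * (C * exp (pi * \<bar>Im s\<bar>))"
      using s by (intro mult_left_mono C) (simp add: rGamma_inverse_Gamma)
    finally have "norm (inverse (s * Gamma s)) \<le> inverse (Re s * Gamma (Re s)) * (C * exp (pi * \<bar>Im s\<bar>))"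
      using Gamma_plus1[OF ns] Gamma_plus1[OF rs] by (simp add: rGamma_inverse_Gamma add.commute)
    moreover have "norm (s * Gamma s) > 0" using ns s by (auto simp: Gamma_eq_zero_iff)
    moreover have "Re s * Gamma (Re s) > 0" using s by simp
    moreover have "y \<le> w * x" if "inverse x \<le> inverse y * w" "x > 0" "y > 0" for x y w :: real
      using that by (simp add: field_simps)
    ultimately have "Re s * Gamma (Re s) \<le> C * exp (pi * \<bar>Im s\<bar>) * norm (s * Gamma s)"
      unfolding norm_inverse by blast
    then show ?thesis by (simp add: norm_mult mult.assoc)
  qed
  then show ?thesis using C(1) by blast
qed

text \<open>Growth of exponential type on \<open>S\<close>. The summand 1 in the exponent lets
  constant factors be absorbed. The bound is one-sided, hence the sign conditions in the rules for
  products.\<close>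

definition expb :: "complex set \<Rightarrow> (complex \<Rightarrow> real) \<Rightarrow> bool" where
  "expb S f \<longleftrightarrow> (\<exists>C\<ge>0. \<forall>s\<in>S. f s \<le> exp (C * (1 + norm s)))"

lemma expb_const: "expb S (\<lambda>_. c)"
  unfolding expb_def
proof (intro exI conjI ballI)
  fix s :: complex assume "s \<in> S"
  have "c \<le> \<bar>c\<bar> * 1" by simp
  also have "\<dots> \<le> \<bar>c\<bar> * (1 + norm s)" by (intro mult_left_mono) auto
  also have "\<dots> \<le> exp (\<bar>c\<bar> * (1 + norm s))" using exp_ge_add_one_self[of "\<bar>c\<bar> * (1 + norm s)"] by linarith
  finally show "c \<le> exp (\<bar>c\<bar> * (1 + norm s))" .
qed simp

lemma expb_mono:
  assumes "expb S f" "T \<subseteq> S" "\<And>s. s \<in> T \<Longrightarrow> g s \<le> f s"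
  shows "expb T g"
  using assms unfolding expb_def by (meson order_trans subsetD)

lemma expb_mult:
  assumes "expb S f" "expb S g" "\<And>s. s \<in> S \<Longrightarrow> f s \<ge> 0" "\<And>s. s \<in> S \<Longrightarrow> g s \<ge> 0"
  shows "expb S (\<lambda>s. f s * g s)"
proof -
  obtain C D where C: "C \<ge> 0" "\<And>s. s \<in> S \<Longrightarrow> f s \<le> exp (C * (1 + norm s))"
    and D: "D \<ge> 0" "\<And>s. s \<in> S \<Longrightarrow> g s \<le> exp (D * (1 + norm s))" using assms(1,2) unfolding expb_def by blast
  have "f s * g s \<le> exp ((C + D) * (1 + norm s))" if "s \<in> S" for s
  proof -
    have "f s * g s \<le> exp (C * (1 + norm s)) * exp (D * (1 + norm s))"
      using C(2)[OF that] D(2)[OF that] assms(3,4)[OF that] by (intro mult_mono) auto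
    then show ?thesis by (simp add: exp_add[symmetric] algebra_simps)
  qed
  then show ?thesis unfolding expb_def using C D by (intro exI[of _ "C + D"]) auto
qed

lemma expb_power:
  assumes "expb S f" "\<And>s. s \<in> S \<Longrightarrow> f s \<ge> 0"
  shows "expb S (\<lambda>s. f s ^ n)"
  by (induction n) (use assms in \<open>auto intro!: expb_const expb_mult\<close>)

lemma expb_norm: "expb S (\<lambda>s. c + norm s)"
  unfolding expb_def
proof (intro exI conjI ballI)
  fix s :: complex
  have "c + norm s \<le> (\<bar>c\<bar> + 1) * (1 + norm s)"
  proof -
    have "0 \<le> \<bar>c\<bar> * norm s" by simp
    moreover have "(\<bar>c\<bar> + 1) * (1 + norm s) = \<bar>c\<bar> + 1 + \<bar>c\<bar> * norm s + norm s" by (simp add: algebra_simps)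
    ultimately show ?thesis by linarith
  qed
  also have "\<dots> \<le> exp ((\<bar>c\<bar> + 1) * (1 + norm s))"
    using exp_ge_add_one_self[of "(\<bar>c\<bar> + 1) * (1 + norm s)"] by linarith
  finally show "c + norm s \<le> exp ((\<bar>c\<bar> + 1) * (1 + norm s))" .
qed simp

lemma expb_comp:
  assumes "expb T f" "\<And>s. s \<in> S \<Longrightarrow> \<phi> s \<in> T" "\<And>s. s \<in> S \<Longrightarrow> norm (\<phi> s) \<le> c + norm s" 
  shows "expb S (\<lambda>s. f (\<phi> s))"
proof -
  obtain C where C: "C \<ge> 0" "\<And>s. s \<in> T \<Longrightarrow> f s \<le> exp (C * (1 + norm s))" using assms(1) unfolding expb_def by blast
  have "f (\<phi> s) \<le> exp (C * (1 + \<bar>c\<bar>) * (1 + norm s))" if "s \<in> S" for s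
  proof -
    have "1 + norm (\<phi> s) \<le> 1 + \<bar>c\<bar> + norm s" using assms(3)[OF that] by linarith
    also have "\<dots> \<le> (1 + \<bar>c\<bar>) * (1 + norm s)"
    proof -
      have "0 \<le> \<bar>c\<bar> * norm s" by simp
      then show ?thesis by (simp add: algebra_simps)
    qed
    finally have "C * (1 + norm (\<phi> s)) \<le> C * ((1 + \<bar>c\<bar>) * (1 + norm s))" using C(1) by (rule mult_left_mono)
    then have "exp (C * (1 + norm (\<phi> s))) \<le> exp (C * (1 + \<bar>c\<bar>) * (1 + norm s))" by (simp add: mult.assoc)
    then show ?thesis using C(2)[OF assms(2)[OF that]] by linarith
  qed
  then show ?thesis unfolding expb_def using C(1) by (intro exI[of _ "C * (1 + \<bar>c\<bar>)"]) auto
qed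

lemma expb_Un:
  assumes "expb S f" "expb T f"
  shows "expb (S \<union> T) f"
proof -
  obtain C D where C: "C \<ge> 0" "\<And>s. s \<in> S \<Longrightarrow> f s \<le> exp (C * (1 + norm s))"
    and D: "D \<ge> 0" "\<And>s. s \<in> T \<Longrightarrow> f s \<le> exp (D * (1 + norm s))" using assms unfolding expb_def by blast
  have "f s \<le> exp ((C + D) * (1 + norm s))" if "s \<in> S \<union> T" for s
  proof -
    have e: "exp (C * (1 + norm s)) \<le> exp ((C + D) * (1 + norm s))" "exp (D * (1 + norm s)) \<le> exp ((C + D) * (1 + norm s))"
      using C(1) D(1) by (auto intro!: mult_right_mono)
    show ?thesis
    proof (cases "s \<in> S")
      case True
      then show ?thesis using order_trans[OF C(2) e(1)] by blast
    next
      case False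
      then have "s \<in> T" using that by blast
      then show ?thesis using order_trans[OF D(2) e(2)] by blast
    qed
  qed
  then show ?thesis unfolding expb_def using C(1) D(1) by (intro exI[of _ "C + D"]) auto
qed

text \<open>On the circle of radius \<open>R\<close> about \<open>0\<close> the polynomial \<open>s\<^sup>2 - 2 c s + R\<^sup>2\<close> has modulus
  \<open>2 R \<bar>Re s - c\<bar>\<close>, so it cancels a singularity of the bound along the line \<open>Re s = c\<close>.\<close>

lemma expb_remove_lines:
  fixes P :: "complex \<Rightarrow> complex" and J :: "real set"
  assumes hol: "P holomorphic_on UNIV" and J: "finite J" "\<And>c. c \<in> J \<Longrightarrow> \<bar>c\<bar> \<le> 1"
    and bd: "expb UNIV (\<lambda>s. norm (P s) * (\<Prod>c\<in>J. \<bar>Re s - c\<bar>) ^ n)"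
  shows "expb UNIV (\<lambda>s. norm (P s))"
proof -
  obtain C where C: "C \<ge> 0" "\<And>s. norm (P s) * (\<Prod>c\<in>J. \<bar>Re s - c\<bar>) ^ n \<le> exp (C * (1 + norm s))"
    using bd unfolding expb_def by blast
  let ?N = "card J * n"
  have main: "norm (P s) \<le> (16 + 4 * norm s) ^ ?N * exp (C * (9 + 2 * norm s))" for s
  proof -
    \<comment> \<open>With R \<ge> 2 |s| and R \<ge> 8 each polynomial satisfies |p c s| \<ge> R^2 -
      R^2/4 - R \<ge> 1, so |P s| \<le> |Q s| and the maximum principle for \<open>Q\<close> on the
      disc bounds \<open>P\<close>.\<close>
    define R where "R = 2 * norm s + 8"
    have R: "R \<ge> 8" "norm s \<le> R / 2" by (auto simp: R_def)
    define p where "p c z = z\<^sup>2 - 2 * of_real c * z + of_real (R\<^sup>2)" for c :: real and z :: complex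
    define Q where "Q z = P z * (\<Prod>c\<in>J. p c z) ^ n" for z
    have "norm (Q s) \<le> (2 * R) ^ ?N * exp (C * (1 + R))"
    proof (rule maximum_modulus_frontier[of Q "ball 0 R"])
      have "Q holomorphic_on UNIV" unfolding Q_def p_def by (intro holomorphic_intros hol)
      then show "Q holomorphic_on interior (ball 0 R)" "continuous_on (closure (ball 0 R)) Q"
        by (auto intro: holomorphic_on_subset holomorphic_on_imp_continuous_on)
      show "bounded (ball (0::complex) R)" by simp
      show "s \<in> ball 0 R" using R by simp
      fix z :: complex assume "z \<in> frontier (ball 0 R)"
      then have z: "norm z = R" using R by (simp add: frontier_ball)
      have "norm (p c z) = 2 * R * \<bar>Re z - c\<bar>" for c
      proof -
        have "complex_of_real (R\<^sup>2) = z * cnj z" using complex_norm_square[of z] z by simp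
        then have "p c z = z * (z + cnj z - 2 * of_real c)" by (simp add: p_def power2_eq_square algebra_simps)
        also have "z + cnj z - 2 * of_real c = of_real (2 * (Re z - c))" by (simp add: complex_eq_iff)
        finally have "norm (p c z) = norm z * \<bar>2 * (Re z - c)\<bar>" by (simp only: norm_mult norm_of_real)
        then show ?thesis using z by (simp only: abs_mult abs_numeral mult_ac)
      qed
      then have "norm (Q z) = norm (P z) * (\<Prod>c\<in>J. 2 * R * \<bar>Re z - c\<bar>) ^ n"
        by (simp add: Q_def norm_mult norm_power prod_norm[symmetric])
      also have "(\<Prod>c\<in>J. 2 * R * \<bar>Re z - c\<bar>) = (2 * R) ^ card J * (\<Prod>c\<in>J. \<bar>Re z - c\<bar>)"
        by (simp add: prod.distrib)
      also have "norm (P z) * ((2 * R) ^ card J * (\<Prod>c\<in>J. \<bar>Re z - c\<bar>)) ^ n = (2 * R) ^ ?N * (norm (P z) * (\<Prod>c\<in>J. \<bar>Re z - c\<bar>) ^ n)"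
        unfolding power_mult_distrib[of "(2 * R) ^ card J"] power_mult by (rule mult.left_commute)
      also have "\<dots> \<le> (2 * R) ^ ?N * exp (C * (1 + R))"
        using C(2)[of z] z R by (intro mult_left_mono) auto
      finally show "norm (Q z) \<le> (2 * R) ^ ?N * exp (C * (1 + R))" .
    qed
    moreover have "norm (P s) \<le> norm (Q s)"
    proof -
      have p1: "norm (p c s) \<ge> 1" if "c \<in> J" for c
      proof -
        have n2: "norm (s\<^sup>2) \<le> (R / 2)\<^sup>2" unfolding norm_power using R by (intro power_mono) auto
        have n1: "norm (2 * of_real c * s) \<le> 2 * 1 * (R / 2)"
          unfolding norm_mult using J(2)[OF that] R by (intro mult_mono) auto
        have "complex_of_real (R\<^sup>2) = p c s - s\<^sup>2 + 2 * of_real c * s" by (simp add: p_def)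
        then have "R\<^sup>2 \<le> norm (p c s) + norm (s\<^sup>2) + norm (2 * of_real c * s)"
          by (metis (no_types, lifting) abs_of_nonneg add_mono_thms_linordered_semiring(3) norm_of_real norm_triangle_ineq norm_triangle_ineq4 order_trans zero_le_power2)
        then have "norm (p c s) \<ge> R\<^sup>2 - (R/2)\<^sup>2 - R" using n1 n2 by linarith
        moreover have "R\<^sup>2 - (R/2)\<^sup>2 - R = R * (3 * R / 4 - 1)" by (simp add: power2_eq_square algebra_simps)
        moreover have "8 * 1 \<le> R * (3 * R / 4 - 1)" using R by (intro mult_mono) auto
        ultimately show ?thesis by linarith
      qed
      have "1 \<le> (\<Prod>c\<in>J. norm (p c s))" by (rule prod_ge_1) (use p1 in auto)
      then have "1 \<le> (\<Prod>c\<in>J. norm (p c s)) ^ n" by (rule one_le_power)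
      then have "norm (P s) * 1 \<le> norm (P s) * (\<Prod>c\<in>J. norm (p c s)) ^ n" by (intro mult_left_mono) auto
      then show ?thesis by (simp add: Q_def norm_mult norm_power prod_norm[symmetric])
    qed
    ultimately show ?thesis by (simp add: R_def algebra_simps)
  qed
  have "expb UNIV (\<lambda>s. (16 + 4 * norm s) ^ ?N * exp (C * (9 + 2 * norm s)))"
  proof (intro expb_mult expb_power)
    show "expb UNIV (\<lambda>s::complex. 16 + 4 * norm s)"
      by (rule expb_mono[OF expb_mult[OF expb_const[of _ 4] expb_norm[of _ 4]]]) auto
    show "expb UNIV (\<lambda>s::complex. exp (C * (9 + 2 * norm s)))"
      unfolding expb_def using C(1)
      by (intro exI[of _ "9 * C"]) (auto simp: algebra_simps mult_left_mono)
  qed auto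
  then show ?thesis by (rule expb_mono) (use main in auto)
qed

section \<open>Entire quotients and a uniqueness theorem of Liouville type\<close>

lemma entire_eq_at:
  fixes D :: "complex \<Rightarrow> complex"
  assumes D: "D holomorphic_on UNIV" "D b \<noteq> 0"
    and p: "continuous (at w) p1" "continuous (at w) p2" "\<forall>\<^sub>F z in at w. D z * p1 z = D z * p2 z"
  shows "p1 w = (p2 w :: complex)"
proof -
  have "\<forall>\<^sub>F z in at w. D z \<noteq> 0 \<and> z \<in> UNIV"
    by (rule non_zero_neighbour_alt[OF D(1), of w b]) (use D(2) in auto)
  with p(3) have "\<forall>\<^sub>F z in at w. p1 z = p2 z" by eventually_elim auto
  moreover have "(p1 \<longlongrightarrow> p1 w) (at w)" "(p2 \<longlongrightarrow> p2 w) (at w)" using p by (auto simp: continuous_at)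
  ultimately show ?thesis
    using tendsto_cong[of p1 p2 "at w"] tendsto_unique[of "at w" p2 "p1 w" "p2 w"] by simp
qed

text \<open>\<open>D\<close> is not identically zero, so its zeros are isolated; two local quotients
  therefore agree on overlaps, and the values at the centres glue to an entire function.\<close>

lemma entire_quotient:
  fixes N D :: "complex \<Rightarrow> complex"
  assumes D: "D holomorphic_on UNIV" "D b \<noteq> 0"
    and loc: "\<And>z. \<exists>r>0. \<exists>p. p holomorphic_on ball z r \<and> (\<forall>w\<in>ball z r. N w = D w * p w)"
  shows "\<exists>P. P holomorphic_on UNIV \<and> (\<forall>w. N w = D w * P w)"
proof -
  obtain r p where r: "\<And>z. r z > 0" and p: "\<And>z. p z holomorphic_on ball z (r z)"
    and Np: "\<And>z w. w \<in> ball z (r z) \<Longrightarrow> N w = D w * p z w"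
    using loc by metis
  define P where "P z = p z z" for z
  have eq: "P w = p z w" if w: "w \<in> ball z (r z)" for w z
    unfolding P_def
  proof (rule entire_eq_at[OF D, of w "p w" "p z"])
    have c: "continuous (at w) (p y)" if "w \<in> ball y (r y)" for y
      using holomorphic_on_imp_continuous_on[OF p[of y]] that by (simp add: continuous_on_eq_continuous_at)
    show "continuous (at w) (p w)" using c[of w] r[of w] by simp
    show "continuous (at w) (p z)" using c[of z] w by simp
    have "\<forall>\<^sub>F y in nhds w. y \<in> ball w (r w) \<inter> ball z (r z)"
      using w r[of w] by (intro eventually_nhds_in_open) auto
    then have "\<forall>\<^sub>F y in at w. y \<in> ball w (r w) \<inter> ball z (r z)" by (simp add: eventually_nhds_conv_at)
    then show "\<forall>\<^sub>F y in at w. D y * p w y = D y * p z y"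
      by eventually_elim (simp add: Np[symmetric] del: mem_ball)
  qed
  have "P holomorphic_on ball z (r z)" for z
    using p[of z] holomorphic_cong[OF refl, of "ball z (r z)" P "p z"] eq by blast
  then have "P field_differentiable (at z)" for z
    using holomorphic_on_imp_differentiable_at[of P "ball z (r z)" z] r[of z] by simp
  then have "P holomorphic_on UNIV" by (simp add: holomorphic_on_def field_differentiable_at_within)
  moreover have "N w = D w * P w" for w using Np[of w w] r[of w] by (simp add: P_def)
  ultimately show ?thesis by blast
qed

text \<open>Multiply the four functions P(s), P(i s), P(-s), P(-i s). At every point one of the four
  arguments has real part at least |s| / 2, where the decay can be made to beat the exponential
  growth of the other three. The product tends to 0 at infinity and vanishes by Liouville, which is
  impossible for factors with isolated zeros.\<close>

lemma superexponential_decay_imp_zero: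
  fixes P :: "complex \<Rightarrow> complex"
  assumes hol: "P holomorphic_on UNIV" and bd: "expb UNIV (\<lambda>s. norm (P s))"
    and dec: "expb {s. Re s > 2} (\<lambda>s. norm (P s) * Gamma (Re s + 1))"
  shows "P s = 0"
proof (rule ccontr)
  assume nz: "P s \<noteq> 0"
  obtain C1 where C1: "C1 \<ge> 0" "\<And>s. norm (P s) \<le> exp (C1 * (1 + norm s))" using bd unfolding expb_def by blast
  obtain C2 where C2: "C2 \<ge> 0" "\<And>s. Re s > 2 \<Longrightarrow> norm (P s) * Gamma (Re s + 1) \<le> exp (C2 * (1 + norm s))"
    using dec unfolding expb_def by blast
  define C where "C = C1 + C2"
  have C: "C \<ge> 0" "\<And>s. norm (P s) \<le> exp (C * (1 + norm s))"
    "\<And>s. Re s > 2 \<Longrightarrow> norm (P s) * Gamma (Re s + 1) \<le> exp (C * (1 + norm s))"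
  proof -
    have e: "exp (C1 * (1 + norm s)) \<le> exp (C * (1 + norm s))" "exp (C2 * (1 + norm s)) \<le> exp (C * (1 + norm s))" for s :: complex
      using C1(1) C2(1) by (auto simp: C_def intro!: mult_right_mono)
    show "C \<ge> 0" using C1(1) C2(1) by (simp add: C_def)
    show "norm (P s) \<le> exp (C * (1 + norm s))" for s by (rule order_trans[OF C1(2) e(1)])
    show "norm (P s) * Gamma (Re s + 1) \<le> exp (C * (1 + norm s))" if "Re s > 2" for s
      by (rule order_trans[OF C2(2)[OF that] e(2)])
  qed
  \<comment> \<open>Chosen so that m |s| / 2 = 4 C |s| + |s|. After paying C |s| for the bound on
    \<open>P\<close> times Gamma, the decay exp(-(3 C + 1) |s|) remains; three factors of size exp(C
    |s|) then leave exp(-|s|).\<close>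
  define m where "m = 8 * C + 2"
  define K where "K = exp (C + exp (m + 1))"
  have right: "norm (P s) \<le> K * exp ((- 3 * C - 1) * norm s)" if s: "Re s > 2" "2 * Re s \<ge> norm s" for s
  proof -
    have "exp (m * (Re s + 1)) * exp (- exp (m + 1)) \<le> Gamma (Re s + 1)" using s by (intro Gamma_real_lower) simp
    then have "norm (P s) * (exp (m * (Re s + 1)) * exp (- exp (m + 1))) \<le> norm (P s) * Gamma (Re s + 1)"
      by (rule mult_left_mono) simp
    also have "\<dots> \<le> exp (C * (1 + norm s))" using C(3) s by simp
    finally have le: "norm (P s) * (exp (m * (Re s + 1)) * exp (- exp (m + 1))) \<le> exp (C * (1 + norm s))" .
    have g: "x \<le> e * exp (- A) * exp (- B)" if "x * (exp A * exp B) \<le> e" for x e A B :: real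
      using that by (simp add: exp_minus field_simps)
    from g[OF le] have "norm (P s) \<le> exp (C * (1 + norm s)) * exp (- (m * (Re s + 1))) * exp (exp (m + 1))"
      by simp
    also have "\<dots> = exp (C * (1 + norm s) - m * (Re s + 1) + exp (m + 1))" by (simp add: exp_add exp_diff exp_minus field_simps)
    also have "\<dots> \<le> exp (C + exp (m + 1) + (- 3 * C - 1) * norm s)"
    proof -
      have "m * norm s \<le> m * (2 * Re s)" using s C(1) by (intro mult_left_mono) (auto simp: m_def)
      then have "m * norm s / 2 \<le> m * (Re s + 1)" using C(1) by (simp add: m_def algebra_simps)
      moreover have "m * norm s / 2 = 4 * (C * norm s) + norm s" by (simp add: m_def algebra_simps)
      ultimately show ?thesis by (simp add: algebra_simps)
    qed
    finally show ?thesis by (simp add: K_def exp_add)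
  qed
  define Q where "Q s = (P s * P (\<i> * s)) * (P (- s) * P (- (\<i> * s)))" for s
  have Qhol: "Q holomorphic_on UNIV" unfolding Q_def
    by (intro holomorphic_intros holomorphic_on_compose_gen[OF _ hol, unfolded o_def] hol) auto
  have Qbd: "norm (Q s) \<le> K * exp (3 * C) * exp (- norm s)" if s: "norm s > 4" for s
  proof -
    define E where "E = exp (C * (1 + norm s))"
    define F where "F = K * exp ((- 3 * C - 1) * norm s)"
    have E: "norm (P s) \<le> E" "norm (P (\<i> * s)) \<le> E" "norm (P (- s)) \<le> E" "norm (P (- (\<i> * s))) \<le> E"
      using C(2)[of s] C(2)[of "\<i> * s"] C(2)[of "- s"] C(2)[of "- (\<i> * s)"] by (simp_all add: E_def norm_mult)
    have E0: "E \<ge> 0" by (simp add: E_def)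
    have F0: "F \<ge> 0" by (simp add: F_def K_def)
    have "norm s \<le> \<bar>Re s\<bar> + \<bar>Im s\<bar>" by (rule cmod_le)
    then have "2 * \<bar>Re s\<bar> \<ge> norm s \<or> 2 * \<bar>Im s\<bar> \<ge> norm s" by linarith
    then consider "2 * Re s \<ge> norm s" | "2 * Re (\<i> * s) \<ge> norm s" | "2 * Re (- s) \<ge> norm s" | "2 * Re (- (\<i> * s)) \<ge> norm s"
      by (auto simp: abs_if split: if_splits)
    then have cs: "norm (P s) \<le> F \<or> norm (P (\<i> * s)) \<le> F \<or> norm (P (- s)) \<le> F \<or> norm (P (- (\<i> * s))) \<le> F"
      by cases (use right[of s] right[of "\<i> * s"] right[of "- s"] right[of "- (\<i> * s)"] s in \<open>simp_all add: F_def norm_mult\<close>)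
    have nQ: "norm (Q s) = (norm (P s) * norm (P (\<i> * s))) * (norm (P (- s)) * norm (P (- (\<i> * s))))"
      by (simp add: Q_def norm_mult)
    have four: "(a * b) * (c * d) \<le> (x * y) * (z * w)" if "0 \<le> a" "0 \<le> b" "0 \<le> c" "0 \<le> d" "a \<le> x" "b \<le> y" "c \<le> z" "d \<le> w" for a b c d x y z w :: real
      using that by (intro mult_mono) (auto intro!: mult_nonneg_nonneg intro: order_trans)
    have "norm (Q s) \<le> (F * E) * (E * E)"
      using cs
    proof (elim disjE)
      assume "norm (P s) \<le> F" then show ?thesis unfolding nQ using E by (intro four) auto
    next
      assume "norm (P (\<i> * s)) \<le> F" then have "norm (Q s) \<le> (E * F) * (E * E)" unfolding nQ using E by (intro four) auto
      then show ?thesis by (simp only: mult_ac)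
    next
      assume "norm (P (- s)) \<le> F" then have "norm (Q s) \<le> (E * E) * (F * E)" unfolding nQ using E by (intro four) auto
      then show ?thesis by (simp only: mult_ac)
    next
      assume "norm (P (- (\<i> * s))) \<le> F" then have "norm (Q s) \<le> (E * E) * (E * F)" unfolding nQ using E by (intro four) auto
      then show ?thesis by (simp only: mult_ac)
    qed
    also have "(F * E) * (E * E) = K * exp ((- 3 * C - 1) * norm s + 3 * (C * (1 + norm s)))"
    proof -
      have "E * (E * E) = exp (3 * (C * (1 + norm s)))" unfolding E_def by (simp add: exp_add[symmetric])
      then have "(F * E) * (E * E) = F * exp (3 * (C * (1 + norm s)))" by (simp add: mult.assoc)
      then show ?thesis by (simp add: F_def exp_add)
    qed
    also have "(- 3 * C - 1) * norm s + 3 * (C * (1 + norm s)) = 3 * C + - norm s" by (simp add: algebra_simps)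
    finally show ?thesis by (simp only: exp_add mult.assoc)
  qed
  have "(Q \<longlongrightarrow> 0) at_infinity"
  proof (rule Lim_null_comparison)
    show "\<forall>\<^sub>F s in at_infinity. norm (Q s) \<le> K * exp (3 * C) * exp (- norm s)"
      unfolding eventually_at_infinity using Qbd by (intro exI[of _ 5]) auto
    have "((\<lambda>s::complex. exp (- norm s)) \<longlongrightarrow> 0) at_infinity"
      by (rule filterlim_compose[OF exp_at_bot]) (simp add: filterlim_uminus_at_bot filterlim_norm_at_top)
    then show "((\<lambda>s::complex. K * exp (3 * C) * exp (- norm s)) \<longlongrightarrow> 0) at_infinity"
      by (rule tendsto_mult_right_zero)
  qed
  then have Q0: "Q z = 0" for z by (rule Liouville_weak_0[OF Qhol])
  have ev: "\<forall>\<^sub>F z in at 0. P (c * z) \<noteq> 0 \<and> z \<in> UNIV" if "c \<noteq> 0" for c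
    by (rule non_zero_neighbour_alt[of _ _ _ "s / c"])
      (use that nz in \<open>auto intro!: holomorphic_intros holomorphic_on_compose_gen[OF _ hol, unfolded o_def]\<close>)
  have ne: "(1::complex) \<noteq> 0" "\<i> \<noteq> 0" "(-1::complex) \<noteq> 0" "- \<i> \<noteq> 0" by simp_all
  have "\<forall>\<^sub>F z in at (0::complex). False"
    using ev[OF ne(1)] ev[OF ne(2)] ev[OF ne(3)] ev[OF ne(4)]
  proof eventually_elim
    case (elim z)
    then have "Q z \<noteq> 0" by (simp add: Q_def)
    then show ?case using Q0 by simp
  qed
  then show False by simp
qed

section \<open>Cancellation of zeros\<close>

text \<open>The nearest line supplies the minimum; every other factor is at most 1 + |s| because |c|
  \<le> 1. The cap at 1 costs one more such factor.\<close>

lemma prod_dist_le: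
  fixes J :: "real set"
  assumes J: "finite J" "J \<noteq> {}" "\<And>c. c \<in> J \<Longrightarrow> \<bar>c\<bar> \<le> 1"
  shows "(\<Prod>c\<in>J. \<bar>Re s - c\<bar>) \<le> min 1 (Min ((\<lambda>c. \<bar>Re s - c\<bar>) ` J)) * (1 + norm s) ^ card J"
proof -
  define X where "X = 1 + norm s"
  have X: "X \<ge> 1" by (simp add: X_def)
  have le: "\<bar>Re s - c\<bar> \<le> X" if "c \<in> J" for c
    using J(3)[OF that] abs_Re_le_cmod[of s] by (simp add: X_def)
  obtain c0 where c0: "c0 \<in> J" "Min ((\<lambda>c. \<bar>Re s - c\<bar>) ` J) = \<bar>Re s - c0\<bar>"
  proof -
    have "Min ((\<lambda>c. \<bar>Re s - c\<bar>) ` J) \<in> (\<lambda>c. \<bar>Re s - c\<bar>) ` J"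
      using J(1,2) by (intro Min_in) auto
    then show ?thesis using that by (elim imageE)
  qed
  have "(\<Prod>c\<in>J. \<bar>Re s - c\<bar>) = \<bar>Re s - c0\<bar> * (\<Prod>c\<in>J - {c0}. \<bar>Re s - c\<bar>)"
    using J(1) c0(1) by (rule prod.remove)
  also have "\<dots> \<le> \<bar>Re s - c0\<bar> * (\<Prod>c\<in>J - {c0}. X)"
    by (intro mult_left_mono prod_mono) (auto intro: le)
  also have "\<dots> = \<bar>Re s - c0\<bar> * X ^ (card J - 1)" using J(1) c0(1) by (simp add: card_Diff_singleton)
  also have "\<dots> \<le> (min 1 \<bar>Re s - c0\<bar> * X) * X ^ (card J - 1)"
  proof (rule mult_right_mono)
    show "\<bar>Re s - c0\<bar> \<le> min 1 \<bar>Re s - c0\<bar> * X"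
    proof (cases "\<bar>Re s - c0\<bar> \<le> 1")
      case True
      have "\<bar>Re s - c0\<bar> * 1 \<le> \<bar>Re s - c0\<bar> * X" using X by (intro mult_left_mono) auto
      then show ?thesis using True by (simp add: min_def)
    next
      case False
      then show ?thesis using le[OF c0(1)] by (simp add: min_def)
    qed
  qed (use X in simp)
  also have "\<dots> = min 1 \<bar>Re s - c0\<bar> * X ^ card J"
  proof -
    have "card J = Suc (card J - 1)" using J(1,2) by (simp add: card_gt_0_iff)
    then have "X ^ card J = X * X ^ (card J - 1)" by (metis power_Suc)
    then show ?thesis by (simp only: mult.assoc)
  qed
  finally show ?thesis by (simp only: c0(2) X_def)
qed

text \<open>Here \<open>k\<close> is the Dirichlet series of the summatory function up to elementary factors, and the
  assumption \<open>klim\<close> says that on the line \<open>Re s = 1/4\<close> it stays strictly below a simple pole.\<close>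

locale zero_cancellation =
  fixes \<Lambda> \<Xi> k :: "complex \<Rightarrow> complex" and \<kappa> b :: complex and a :: nat
  assumes Lhol: "\<Lambda> holomorphic_on UNIV"
    and Lfe: "\<And>s. \<Lambda> (1 - s) = \<kappa> * \<Lambda> s" and kappa: "\<kappa> \<noteq> 0"
    and Lstrip: "\<And>R. \<exists>B. \<forall>s. \<bar>Re s\<bar> \<le> R \<longrightarrow> norm (\<Lambda> s) \<le> B"
    and Lgrow: "expb {s. Re s \<ge> 2} (\<lambda>s. norm (\<Lambda> s) / Gamma ((Re s + real a) / 2))"
    and Lnz: "\<Lambda> b \<noteq> 0"
    and Xhol: "\<Xi> holomorphic_on UNIV"
    and Xfe: "\<And>s. \<Xi> (1/2 - s) = \<Xi> s"
    and Xnz: "\<And>s. Re s \<ge> 1/2 \<Longrightarrow> \<Xi> s \<noteq> 0"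
    and Xlow: "expb {s. Re s > 1/2} (\<lambda>s. (Re s - 1/2)\<^sup>2 * Gamma (Re s) / norm (\<Xi> s))"
    and khol: "k holomorphic_on {s. Re s > 1/4}"
    and kL: "\<And>s. Re s > 1/4 \<Longrightarrow> \<Lambda> s * (s * (2 * s - 1) * Gamma s) = \<Xi> s * Gamma ((s + of_nat a) / 2) * k s"
    and kbd: "expb {s. 1/4 < Re s \<and> Re s \<le> 2} (\<lambda>s. norm (k s) * (Re s - 1/4))"
    and klim: "\<And>t. ((\<lambda>e. e * norm (k (Complex (1/4 + e) t))) \<longlongrightarrow> 0) (at_right 0)"
    and a1: "a \<le> 1"
begin

text \<open>Both products are symmetric about Re s = -1/4, \<open>N\<close> up to a constant factor:
  the map s \<mapsto> -1/2 - s reverses the order of the shifts. Everything below is proved for Re s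
  \<ge> -1/4 and then reflected.\<close>

definition "N s = \<Lambda> s * \<Lambda> (s + 1/2) * \<Lambda> (s + 1) * \<Lambda> (s + 3/2)"
definition "D s = \<Xi> s * \<Xi> (s + 1/2) * \<Xi> (s + 1)"
text \<open>The ratio \<Lambda>/\<Xi>, solved from \<open>kL\<close>. The assumptions speak of
  \<open>k\<close> instead because the denominator here vanishes at s = 1/2.\<close>

definition "k2 s = Gamma ((s + of_nat a) / 2) * k s / (s * (2 * s - 1) * Gamma s)"
text \<open>The bounds for the quotient \<open>N / D\<close> degenerate on the lines \<open>Re s = c\<close> with \<open>c \<in> J\<close>.\<close>

definition "J = {-1, -3/4, -1/2, -1/4, 0, 1/4, 1/2 :: real}"
definition "\<delta> s = min 1 (Min ((\<lambda>c. \<bar>Re s - c\<bar>) ` J))"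

section \<open>Divisibility of \<open>N\<close> by \<open>D\<close>\<close>

lemma Lhol': "\<Lambda> holomorphic_on A" using Lhol holomorphic_on_subset by blast
lemma Xhol': "\<Xi> holomorphic_on A" using Xhol holomorphic_on_subset by blast
lemma Lcomp: "f holomorphic_on A \<Longrightarrow> (\<lambda>s. \<Lambda> (f s)) holomorphic_on A"
  using holomorphic_on_compose_gen[OF _ Lhol, of f A] by (simp add: o_def)
lemma Xcomp: "f holomorphic_on A \<Longrightarrow> (\<lambda>s. \<Xi> (f s)) holomorphic_on A"
  using holomorphic_on_compose_gen[OF _ Xhol, of f A] by (simp add: o_def)

lemma Nhol: "N holomorphic_on A" unfolding N_def by (intro holomorphic_intros Lcomp Lhol')
lemma Dhol: "D holomorphic_on A" unfolding D_def by (intro holomorphic_intros Xcomp Xhol')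

lemma D1: "D 1 \<noteq> 0" unfolding D_def using Xnz by simp

lemma Lhalf: "\<Lambda> (1/2 - s) = \<kappa> * \<Lambda> (s + 1/2)"
proof -
  have "1/2 - s = 1 - (s + 1/2)" by (simp add: field_simps)
  then show ?thesis using Lfe[of "s + 1/2"] by metis
qed

lemma N_reflect: "N (-1/2 - s) = \<kappa> ^ 4 * N s"
proof -
  have e: "1 - (s + 3/2) = -1/2 - s" "1 - (s + 1) = -1/2 - s + 1/2" "1 - (s + 1/2) = -1/2 - s + 1" "1 - s = -1/2 - s + 3/2"
    by (simp_all add: field_simps)
  have "\<Lambda> (-1/2 - s) = \<kappa> * \<Lambda> (s + 3/2)" "\<Lambda> (-1/2 - s + 1/2) = \<kappa> * \<Lambda> (s + 1)"
    "\<Lambda> (-1/2 - s + 1) = \<kappa> * \<Lambda> (s + 1/2)" "\<Lambda> (-1/2 - s + 3/2) = \<kappa> * \<Lambda> s"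
    using Lfe[of "s + 3/2"] Lfe[of "s + 1"] Lfe[of "s + 1/2"] Lfe[of s] unfolding e by simp_all
  then show ?thesis unfolding N_def by (simp only:) (simp add: power4_eq_xxxx)
qed

lemma D_reflect: "D (-1/2 - s) = D s"
proof -
  have e: "1/2 - (s + 1) = -1/2 - s" "1/2 - (s + 1/2) = -1/2 - s + 1/2" "1/2 - s = -1/2 - s + 1"
    by (simp_all add: field_simps)
  have "\<Xi> (-1/2 - s) = \<Xi> (s + 1)" "\<Xi> (-1/2 - s + 1/2) = \<Xi> (s + 1/2)" "\<Xi> (-1/2 - s + 1) = \<Xi> s"
    using Xfe[of "s + 1"] Xfe[of "s + 1/2"] Xfe[of s] unfolding e by simp_all
  then show ?thesis unfolding D_def by (simp only:) simp
qed

lemma Gamma_pos_nz: "Re s > 0 \<Longrightarrow> Gamma s \<noteq> (0::complex)"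
  by (auto simp: Gamma_eq_zero_iff elim!: nonpos_Ints_cases)

lemma ratio:
  assumes "Re s > 1/4" "Re s \<noteq> 1/2" "\<Xi> s \<noteq> 0"
  shows "\<Lambda> s = \<Xi> s * k2 s"
proof -
  have "s \<noteq> 0" using assms(1) by auto
  moreover have "2 * s - 1 \<noteq> 0"
  proof
    assume "2 * s - 1 = 0"
    then have "Re (2 * s - 1) = Re 0" by (rule arg_cong)
    then show False using assms(2) by simp
  qed
  moreover have "Gamma s \<noteq> 0" using assms(1) by (intro Gamma_pos_nz) simp
  ultimately have "s * (2 * s - 1) * Gamma s \<noteq> 0" by simp
  then show ?thesis using kL[OF assms(1)] unfolding k2_def by (simp add: field_simps)
qed

text \<open>Let n and m be the orders of \<Lambda> and \<Xi> at \<open>z\<close>, and approach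
  \<open>z\<close> horizontally along z + e from the right. If m > n, dividing \<open>kL\<close> by
  e^n leaves a nonzero limit on the left and, on the right, a bounded factor times e |k(z + e)|,
  which tends to 0.\<close>

lemma quotient_local:
  assumes z: "Re z \<ge> 1/4"
  shows "\<exists>r>0. \<exists>p. p holomorphic_on ball z r \<and> (\<forall>w\<in>ball z r. \<Lambda> w = \<Xi> w * p w)"
proof (cases "\<Xi> z = 0")
  case False
  have "continuous_on UNIV \<Xi>" using Xhol holomorphic_on_imp_continuous_on by blast
  then have "open {w. \<Xi> w \<noteq> 0}" by (intro open_Collect_neq continuous_on_const)
  then obtain r where r: "r > 0" "ball z r \<subseteq> {w. \<Xi> w \<noteq> 0}" using False open_contains_ball by blast
  show ?thesis
  proof (intro exI conjI ballI)
    show "r > 0" by fact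
    show "(\<lambda>w. \<Lambda> w / \<Xi> w) holomorphic_on ball z r"
      using r(2) by (intro holomorphic_intros Lhol' Xhol') auto
    show "\<Lambda> w = \<Xi> w * (\<Lambda> w / \<Xi> w)" if "w \<in> ball z r" for w using r(2) that by auto
  qed
next
  case True
  have z2: "Re z < 1/2" using Xnz[of z] True by force
  define n where "n = nat (zorder \<Lambda> z)"
  define m where "m = nat (zorder \<Xi> z)"
  define f where "f = zor_poly \<Lambda> z"
  define g where "g = zor_poly \<Xi> z"
  have "\<exists>w\<in>UNIV. \<Lambda> w \<noteq> 0" using Lnz by blast
  from zorder_exist_zero[OF Lhol open_UNIV connected_UNIV UNIV_I this]
  obtain r1 where r1: "r1 > 0" "f holomorphic_on cball z r1"
    "\<And>w. w \<in> cball z r1 \<Longrightarrow> \<Lambda> w = f w * (w - z) ^ n \<and> f w \<noteq> 0" unfolding n_def f_def by blast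
  have "\<exists>w\<in>UNIV. \<Xi> w \<noteq> 0" using Xnz[of 1] by auto
  from zorder_exist_zero[OF Xhol open_UNIV connected_UNIV UNIV_I this]
  obtain r2 where r2: "r2 > 0" "g holomorphic_on cball z r2"
    "\<And>w. w \<in> cball z r2 \<Longrightarrow> \<Xi> w = g w * (w - z) ^ m \<and> g w \<noteq> 0" unfolding m_def g_def by blast
  define r where "r = min r1 r2"
  have r: "r > 0" "ball z r \<subseteq> cball z r1" "ball z r \<subseteq> cball z r2" using r1(1) r2(1) by (auto simp: r_def)
  have "m \<le> n"
  proof (rule ccontr)
    assume "\<not> m \<le> n"
    then obtain j where j: "m = n + Suc j" by (metis add_Suc_right less_imp_Suc_add not_le)
    define w where "w e = z + of_real e" for e
    define G1 where "G1 s = s * (2 * s - 1) * Gamma s" for s :: complex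
    define G2 where "G2 s = Gamma ((s + of_nat a) / 2)" for s :: complex
    have zl: "Re z > 0" using z by linarith
    have z0: "G1 z \<noteq> 0" unfolding G1_def
    proof -
      have "z \<noteq> 0" using zl by auto
      moreover have "2 * z - 1 \<noteq> 0"
      proof
        assume "2 * z - 1 = 0"
        then have "Re (2 * z - 1) = Re 0" by (rule arg_cong)
        then show False using z2 by simp
      qed
      ultimately show "z * (2 * z - 1) * Gamma z \<noteq> 0" using Gamma_pos_nz[OF zl] by simp
    qed
    have wt: "(w \<longlongrightarrow> z) (at_right 0)"
    proof -
      have "((\<lambda>e. z + complex_of_real e) \<longlongrightarrow> z + of_real 0) (at_right 0)" by (intro tendsto_intros)
      then show ?thesis by (simp add: w_def[abs_def])
    qed
    have cf: "isCont f z" using r1 holomorphic_on_imp_continuous_on[OF r1(2)] by (intro continuous_on_interior[of "cball z r1"]) auto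
    have cg: "isCont g z" using r2 holomorphic_on_imp_continuous_on[OF r2(2)] by (intro continuous_on_interior[of "cball z r2"]) auto
    have nzi: "z \<notin> \<int>\<^sub>\<le>\<^sub>0" "(z + of_nat a) / 2 \<notin> \<int>\<^sub>\<le>\<^sub>0"
    proof -
      show "z \<notin> \<int>\<^sub>\<le>\<^sub>0" using zl by (auto elim!: nonpos_Ints_cases)
      have "Re ((z + of_nat a) / 2) > 0" using zl by simp
      then show "(z + of_nat a) / 2 \<notin> \<int>\<^sub>\<le>\<^sub>0" by (metis Gamma_eq_zero_iff Gamma_pos_nz)
    qed
    have cG1: "isCont G1 z" unfolding G1_def using nzi by (intro continuous_intros) auto
    have cG2: "isCont G2 z" unfolding G2_def using nzi by (intro continuous_intros) auto
    have tL: "((\<lambda>e. norm (f (w e) * G1 (w e))) \<longlongrightarrow> norm (f z * G1 z)) (at_right 0)"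
      by (intro tendsto_intros isCont_tendsto_compose[OF cf wt] isCont_tendsto_compose[OF cG1 wt])
    \<comment> \<open>On the line Re z = 1/4 this is the assumption \<open>klim\<close>; to the
      right of it \<open>k\<close> is continuous.\<close>
    have ek: "((\<lambda>e. e * norm (k (w e))) \<longlongrightarrow> 0) (at_right 0)"
    proof (cases "Re z = 1/4")
      case True
      then have "w e = Complex (1/4 + e) (Im z)" for e by (simp add: w_def complex_eq_iff)
      then show ?thesis using klim[of "Im z"] by simp
    next
      case False
      then have "z \<in> {s. Re s > 1/4}" using z by simp
      moreover have "open {s. Re s > 1/4}" by (rule open_halfspace_Re_gt)
      ultimately have "isCont k z" using holomorphic_on_imp_continuous_on[OF khol] by (simp add: continuous_on_eq_continuous_at)
      then have "((\<lambda>e. e * norm (k (w e))) \<longlongrightarrow> 0 * norm (k z)) (at_right 0)"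
        by (intro tendsto_intros isCont_tendsto_compose[OF _ wt])
      then show ?thesis by simp
    qed
    have tR: "((\<lambda>e. norm (g (w e) * G2 (w e)) * e ^ j * (e * norm (k (w e)))) \<longlongrightarrow> norm (g z * G2 z) * 0 ^ j * 0) (at_right 0)"
      by (intro tendsto_intros isCont_tendsto_compose[OF cg wt] isCont_tendsto_compose[OF cG2 wt] ek)
    have "\<forall>\<^sub>F e in at_right 0. norm (f (w e) * G1 (w e)) = norm (g (w e) * G2 (w e)) * e ^ j * (e * norm (k (w e)))"
      unfolding eventually_at_right_field
    proof (intro exI conjI allI impI)
      show "r > 0" by fact
      fix e assume e: "0 < e" "e < r"
      then have wb: "w e \<in> ball z r" by (simp add: w_def dist_norm)
      have L: "\<Lambda> (w e) = f (w e) * of_real e ^ n" and X: "\<Xi> (w e) = g (w e) * of_real e ^ m"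
        using r1(3) r2(3) r wb by (auto simp: w_def)
      have "Re (w e) > 1/4" using z e by (simp add: w_def)
      from kL[OF this] have "f (w e) * of_real e ^ n * G1 (w e) = g (w e) * of_real e ^ m * G2 (w e) * k (w e)"
        unfolding L X G1_def G2_def .
      also have "\<dots> = of_real e ^ n * (g (w e) * G2 (w e) * of_real e ^ j * (of_real e * k (w e)))"
        unfolding j by (simp add: power_add mult_ac)
      finally have "of_real e ^ n * (f (w e) * G1 (w e)) = of_real e ^ n * (g (w e) * G2 (w e) * of_real e ^ j * (of_real e * k (w e)))"
        by (simp only: mult_ac)
      then have "f (w e) * G1 (w e) = g (w e) * G2 (w e) * of_real e ^ j * (of_real e * k (w e))"
        using e by simp
      then show "norm (f (w e) * G1 (w e)) = norm (g (w e) * G2 (w e)) * e ^ j * (e * norm (k (w e)))"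
        using e by (simp add: norm_mult norm_power)
    qed
    then have "((\<lambda>e. norm (f (w e) * G1 (w e))) \<longlongrightarrow> norm (g z * G2 z) * 0 ^ j * 0) (at_right 0)"
      using tR by (subst tendsto_cong) auto
    then have "norm (f z * G1 z) = norm (g z * G2 z) * 0 ^ j * 0"
      by (intro tendsto_unique[OF _ tL]) auto
    moreover have "f z \<noteq> 0" using r1 by simp
    ultimately show False using z0 by simp
  qed
  show ?thesis
  proof (intro exI conjI ballI)
    show "r > 0" by fact
    show "(\<lambda>w. f w / g w * (w - z) ^ (n - m)) holomorphic_on ball z r"
      using r r2(3) holomorphic_on_subset[OF r1(2)] holomorphic_on_subset[OF r2(2)] by (intro holomorphic_intros) auto
    fix w assume "w \<in> ball z r"
    then have w: "w \<in> cball z r1" "w \<in> cball z r2" using r by auto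
    have "(w - z) ^ n = (w - z) ^ m * (w - z) ^ (n - m)" using \<open>m \<le> n\<close> by (simp add: power_add[symmetric])
    then show "\<Lambda> w = \<Xi> w * (f w / g w * (w - z) ^ (n - m))"
      using r1(3)[OF w(1)] r2(3)[OF w(2)] by simp
  qed
qed

lemma Xnz_left: "Re s \<le> 0 \<Longrightarrow> \<Xi> s \<noteq> 0"
  using Xnz[of "1/2 - s"] Xfe[of s] by simp

lemma ball_nonzero:
  assumes "f holomorphic_on UNIV" "f (z::complex) \<noteq> (0::complex)" "r > 0"
  shows "\<exists>r'>0. r' \<le> r \<and> (\<forall>w\<in>ball z r'. f w \<noteq> 0)"
proof -
  have "continuous_on UNIV f" using assms(1) holomorphic_on_imp_continuous_on by blast
  then have "open {w. f w \<noteq> 0}" by (intro open_Collect_neq continuous_on_const)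
  then obtain r1 where r: "r1 > 0" "ball z r1 \<subseteq> {w. f w \<noteq> 0}" using assms(2) open_contains_ball by blast
  then show ?thesis using assms(3) by (intro exI[of _ "min r r1"]) auto
qed

text \<open>\<open>F\<close> and \<open>E\<close> are the pair of factors in which the zero cancels;
  \<open>G\<close> and \<open>H\<close> collect the remaining factors, and \<open>H\<close> does not
  vanish at \<open>z\<close>.\<close>

lemma full_quotient_aux:
  assumes rp: "r > 0" "p holomorphic_on ball z r" "\<And>w. w \<in> ball z r \<Longrightarrow> F w = E w * p w"
    and GH: "G holomorphic_on UNIV" "H holomorphic_on UNIV" "H z \<noteq> 0"
    and ND: "\<And>w. N w = F w * G w" "\<And>w. D w = E w * H w"
  shows "\<exists>r>0. \<exists>p. p holomorphic_on ball z r \<and> (\<forall>w\<in>ball z r. N w = D w * p w)"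
proof -
  obtain r' where r': "r' > 0" "r' \<le> r" "\<And>w. w \<in> ball z r' \<Longrightarrow> H w \<noteq> 0"
    using ball_nonzero[OF GH(2,3) rp(1)] by blast
  have sub: "ball z r' \<subseteq> ball z r" using r'(2) by auto
  show ?thesis
  proof (intro exI conjI ballI)
    show "r' > 0" by fact
    show "(\<lambda>w. p w * G w / H w) holomorphic_on ball z r'"
      using r'(3) holomorphic_on_subset[OF rp(2) sub] holomorphic_on_subset[OF GH(1)] holomorphic_on_subset[OF GH(2)]
      by (intro holomorphic_intros) auto
    fix w assume w: "w \<in> ball z r'"
    then show "N w = D w * (p w * G w / H w)"
      using rp(3)[of w] sub r'(3)[OF w] by (auto simp: ND)
  qed
qed

text \<open>A zero of \<Xi>(z + 1/2) here has Re(z + 1/2) \<ge> 1/4 and is matched by \<Lambda>(z +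
  1/2). A zero of \<Xi>(z) is matched by \<Lambda>(z) if Re z \<ge> 1/4; otherwise 1/2 - z is a zero
  to which the local lemma applies, and \<Lambda>(1/2 - z) is a multiple of \<Lambda>(z +
  1/2).\<close>

lemma quotient_right:
  assumes z: "Re z \<ge> -1/4"
  shows "\<exists>r>0. \<exists>p. p holomorphic_on ball z r \<and> (\<forall>w\<in>ball z r. N w = D w * p w)"
proof -
  have X3: "\<Xi> (z + 1) \<noteq> 0" using z by (intro Xnz) simp
  consider "D z \<noteq> 0" | "\<Xi> (z + 1/2) = 0" | "\<Xi> z = 0" using X3 by (auto simp: D_def)
  then show ?thesis
  proof cases
    case 1
    show ?thesis
    proof (rule full_quotient_aux[where r = 1 and F = "\<lambda>_. 1" and E = "\<lambda>_. 1" and p = "\<lambda>_. 1"])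
      show "D z \<noteq> 0" by fact
    qed (auto intro: Nhol Dhol)
  next
    case 2
    then have "\<not> Re (z + 1/2) \<ge> 1/2" using Xnz[of "z + 1/2"] by blast
    then have zneg: "Re z < 0" by simp
    have "Re (z + 1/2) \<ge> 1/4" using z by simp
    from quotient_local[OF this] obtain r p where rp: "r > 0" "p holomorphic_on ball (z + 1/2) r"
      "\<And>w. w \<in> ball (z + 1/2) r \<Longrightarrow> \<Lambda> w = \<Xi> w * p w" by blast
    have sh: "w + 1/2 \<in> ball (z + 1/2) r" if "w \<in> ball z r" for w using that by (simp add: dist_norm)
    show ?thesis
    proof (rule full_quotient_aux[where r = r and F = "\<lambda>w. \<Lambda> (w + 1/2)" and E = "\<lambda>w. \<Xi> (w + 1/2)" and p = "\<lambda>w. p (w + 1/2)"])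
      show "r > 0" by fact
      show "(\<lambda>w. p (w + 1/2)) holomorphic_on ball z r"
        by (rule holomorphic_on_compose_gen[OF _ rp(2), unfolded o_def]) (use sh in \<open>auto intro!: holomorphic_intros\<close>)
      show "\<Lambda> (w + 1/2) = \<Xi> (w + 1/2) * p (w + 1/2)" if "w \<in> ball z r" for w using rp(3) sh that by blast
      show "(\<lambda>w. \<Lambda> w * \<Lambda> (w + 1) * \<Lambda> (w + 3/2)) holomorphic_on UNIV" by (intro holomorphic_intros Lcomp Lhol')
      show "(\<lambda>w. \<Xi> w * \<Xi> (w + 1)) holomorphic_on UNIV" by (intro holomorphic_intros Xcomp Xhol')
      show "\<Xi> z * \<Xi> (z + 1) \<noteq> 0" using X3 Xnz_left[of z] zneg by simp
    qed (simp_all add: N_def D_def mult_ac)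
  next
    case 3
    then have z1: "0 < Re z" "Re z < 1/2" using Xnz[of z] Xnz_left[of z] by force+
    have nz: "\<Xi> (z + 1/2) * \<Xi> (z + 1) \<noteq> 0" using X3 z1 Xnz[of "z + 1/2"] by simp
    show ?thesis
    proof (cases "Re z \<ge> 1/4")
      case True
      from quotient_local[OF this] obtain r p where rp: "r > 0" "p holomorphic_on ball z r"
        "\<And>w. w \<in> ball z r \<Longrightarrow> \<Lambda> w = \<Xi> w * p w" by blast
      show ?thesis
      proof (rule full_quotient_aux[OF rp, where G = "\<lambda>w. \<Lambda> (w + 1/2) * \<Lambda> (w + 1) * \<Lambda> (w + 3/2)" and H = "\<lambda>w. \<Xi> (w + 1/2) * \<Xi> (w + 1)"])
        show "\<Xi> (z + 1/2) * \<Xi> (z + 1) \<noteq> 0" by fact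
      qed (simp_all add: N_def D_def mult_ac, (intro holomorphic_intros Lcomp Xcomp Lhol' Xhol')+)
    next
      case False
      then have "Re (1/2 - z) \<ge> 1/4" by simp
      from quotient_local[OF this] obtain r p where rp: "r > 0" "p holomorphic_on ball (1/2 - z) r"
        "\<And>w. w \<in> ball (1/2 - z) r \<Longrightarrow> \<Lambda> w = \<Xi> w * p w" by blast
      have sh: "1/2 - w \<in> ball (1/2 - z) r" if "w \<in> ball z r" for w using that by (simp add: dist_norm norm_minus_commute)
      show ?thesis
      proof (rule full_quotient_aux[where r = r and F = "\<lambda>w. \<Lambda> (w + 1/2)" and E = \<Xi> and p = "\<lambda>w. p (1/2 - w) / \<kappa>"])
        show "r > 0" by fact
        have "(\<lambda>w. p (1/2 - w)) holomorphic_on ball z r"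
          by (rule holomorphic_on_compose_gen[OF _ rp(2), unfolded o_def]) (use sh in \<open>auto intro!: holomorphic_intros\<close>)
        then show "(\<lambda>w. p (1/2 - w) / \<kappa>) holomorphic_on ball z r" using kappa by (intro holomorphic_intros) auto
        show "\<Lambda> (w + 1/2) = \<Xi> w * (p (1/2 - w) / \<kappa>)" if "w \<in> ball z r" for w
          using rp(3)[OF sh[OF that]] kappa unfolding Lhalf Xfe by (simp add: field_simps)
        show "(\<lambda>w. \<Lambda> w * \<Lambda> (w + 1) * \<Lambda> (w + 3/2)) holomorphic_on UNIV" by (intro holomorphic_intros Lcomp Lhol')
        show "(\<lambda>w. \<Xi> (w + 1/2) * \<Xi> (w + 1)) holomorphic_on UNIV" by (intro holomorphic_intros Xcomp Xhol')
        show "\<Xi> (z + 1/2) * \<Xi> (z + 1) \<noteq> 0" by fact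
      qed (simp_all add: N_def D_def mult_ac)
    qed
  qed
qed

lemma quotient_all: "\<exists>r>0. \<exists>p. p holomorphic_on ball z r \<and> (\<forall>w\<in>ball z r. N w = D w * p w)"
proof (cases "Re z \<ge> -1/4")
  case True
  then show ?thesis by (rule quotient_right)
next
  case False
  then have "Re (-1/2 - z) \<ge> -1/4" by simp
  from quotient_right[OF this] obtain r p where rp: "r > 0" "p holomorphic_on ball (-1/2 - z) r"
    "\<And>w. w \<in> ball (-1/2 - z) r \<Longrightarrow> N w = D w * p w" by blast
  have sh: "-1/2 - w \<in> ball (-1/2 - z) r" if "w \<in> ball z r" for w using that by (simp add: dist_norm norm_minus_commute)
  show ?thesis
  proof (intro exI conjI ballI)
    show "r > 0" by fact
    have "(\<lambda>w. p (-1/2 - w)) holomorphic_on ball z r"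
      by (rule holomorphic_on_compose_gen[OF _ rp(2), unfolded o_def]) (use sh in \<open>auto intro!: holomorphic_intros\<close>)
    then show "(\<lambda>w. p (-1/2 - w) / \<kappa> ^ 4) holomorphic_on ball z r" using kappa by (intro holomorphic_intros) auto
    show "N w = D w * (p (-1/2 - w) / \<kappa> ^ 4)" if "w \<in> ball z r" for w
      using rp(3)[OF sh[OF that]] kappa unfolding N_reflect D_reflect by (simp add: field_simps)
  qed
qed

definition "P = (SOME P. P holomorphic_on UNIV \<and> (\<forall>w. N w = D w * P w))"

lemma P: "P holomorphic_on UNIV" "N w = D w * P w"
proof -
  have "\<exists>P. P holomorphic_on UNIV \<and> (\<forall>w. N w = D w * P w)"
    by (rule entire_quotient[OF Dhol D1 quotient_all])
  from someI_ex[OF this] show "P holomorphic_on UNIV" "N w = D w * P w" unfolding P_def[symmetric] by auto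
qed

lemma P_reflect: "P (-1/2 - s) = \<kappa> ^ 4 * P s"
proof (rule entire_eq_at[OF Dhol D1, where ?p1.0 = "\<lambda>s. P (-1/2 - s)" and ?p2.0 = "\<lambda>s. \<kappa> ^ 4 * P s"])
  have c: "isCont P z" for z
    using holomorphic_on_imp_continuous_on[OF P(1)] by (simp add: continuous_on_eq_continuous_at)
  show "continuous (at s) (\<lambda>s. P (-1/2 - s))"
    by (rule isCont_o2[OF _ c]) (intro continuous_intros)
  show "continuous (at s) (\<lambda>s. \<kappa> ^ 4 * P s)" by (intro continuous_intros c)
  have "D z * P (-1/2 - z) = D z * (\<kappa> ^ 4 * P z)" for z
    using P(2)[of "-1/2 - z"] P(2)[of z] unfolding N_reflect D_reflect by auto
  then show "\<forall>\<^sub>F z in at s. D z * P (-1/2 - z) = D z * (\<kappa> ^ 4 * P z)" by simp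
qed

end

section \<open>Growth of the quotient\<close>

lemma Gamma_real_ge: "x > 0 \<Longrightarrow> exp (- exp 1) \<le> Gamma (x::real)"
  using Gamma_real_lower[of x 0] by simp

text \<open>The interval is the range of (x + a) / 2 for 1/4 \<le> x \<le> 2 and 0 \<le> a \<le>
  1.\<close>

lemma Gamma_bounded_above: "\<exists>G>0. \<forall>x\<in>{1/8..3/2}. Gamma (x::real) \<le> G"
proof -
  have "continuous_on {1/8..3/2} (Gamma :: real \<Rightarrow> real)"
    by (intro continuous_on_Gamma) (auto elim!: nonpos_Ints_cases)
  then have "bounded (Gamma ` {1/8..3/2::real})" by (intro compact_imp_bounded compact_continuous_image) auto
  then obtain G where "G > 0" "\<And>x. x \<in> {1/8..3/2} \<Longrightarrow> norm (Gamma (x::real)) \<le> G"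
    unfolding bounded_pos by blast
  then show ?thesis by (intro exI[of _ G]) auto
qed

lemma expb_exp_Im: "expb S (\<lambda>s. exp (pi * \<bar>Im s\<bar>))"
  unfolding expb_def
proof (intro exI conjI ballI)
  fix s :: complex
  have "\<bar>Im s\<bar> \<le> 1 + norm s" using abs_Im_le_cmod[of s] by linarith
  then show "exp (pi * \<bar>Im s\<bar>) \<le> exp (pi * (1 + norm s))" by simp
qed simp

context zero_cancellation
begin

lemma J: "finite J" "J \<noteq> {}" "\<And>c. c \<in> J \<Longrightarrow> \<bar>c\<bar> \<le> 1" by (auto simp: J_def)

lemma delta_le: "c \<in> J \<Longrightarrow> \<delta> s \<le> \<bar>Re s - c\<bar>" "\<delta> s \<le> 1" "\<delta> s \<ge> 0"
proof -
  show "c \<in> J \<Longrightarrow> \<delta> s \<le> \<bar>Re s - c\<bar>" unfolding \<delta>_def using J(1) by (intro min.coboundedI2 Min_le) auto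
  show "\<delta> s \<le> 1" by (simp add: \<delta>_def)
  show "\<delta> s \<ge> 0" unfolding \<delta>_def using J(1,2) by (simp add: Min_ge_iff)
qed

text \<open>The factor Re s - 1/4 tames \<open>k\<close>, and |Re s - 1/2| compensates for the zero
  of 2 s - 1 in the denominator. The other Gamma factors are controlled from both sides.\<close>

lemma k2_bound: "expb {s. 1/4 < Re s \<and> Re s \<le> 2 \<and> Re s \<noteq> 1/2} (\<lambda>s. norm (k2 s) * ((Re s - 1/4) * \<bar>Re s - 1/2\<bar>))"
proof -
  let ?S = "{s. 1/4 < Re s \<and> Re s \<le> 2 \<and> Re s \<noteq> 1/2}"
  obtain G where G: "G > 0" "\<And>x. x \<in> {1/8..3/2} \<Longrightarrow> Gamma (x::real) \<le> G" using Gamma_bounded_above by blast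
  obtain C where C: "C > 0" "\<And>s. Re s > 0 \<Longrightarrow> Re s * Gamma (Re s) \<le> C * exp (pi * \<bar>Im s\<bar>) * norm s * norm (Gamma s)"
    using norm_Gamma_lower by blast
  \<comment> \<open>A lower bound for Re s times \<Gamma>(Re s): 1/4 from the strip, exp(-e) from
    \<open>Gamma_real_ge\<close>.\<close>
  define c where "c = exp (- exp 1) / (4::real)"
  have c: "c > 0" by (simp add: c_def)
  have main: "norm (k2 s) * ((Re s - 1/4) * \<bar>Re s - 1/2\<bar>) \<le> (G * C / c) * (exp (pi * \<bar>Im s\<bar>) * (norm (k s) * (Re s - 1/4)))" if s: "s \<in> ?S" for s
  proof -
    have s1: "Re s > 1/4" "Re s \<le> 2" "Re s \<noteq> 1/2" using s by auto
    have g1: "norm (Gamma ((s + of_nat a) / 2)) \<le> G"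
    proof -
      have "norm (Gamma ((s + of_nat a) / 2)) \<le> Gamma (Re ((s + of_nat a) / 2))"
        using s1 by (intro norm_Gamma_le) simp
      also have "\<dots> \<le> G" using s1 a1 by (intro G) auto
      finally show ?thesis .
    qed
    have g2: "c \<le> C * exp (pi * \<bar>Im s\<bar>) * (norm s * norm (Gamma s))"
    proof -
      have "1/4 * exp (- exp 1) \<le> Re s * Gamma (Re s)" using s1 Gamma_real_ge[of "Re s"] by (intro mult_mono) auto
      then show ?thesis using C(2)[of s] s1 by (simp add: c_def mult_ac)
    qed
    have X: "norm s * norm (Gamma s) > 0" 
    proof -
      have "s \<noteq> 0" using s1(1) by auto
      moreover have "Gamma s \<noteq> 0" using s1(1) by (intro Gamma_pos_nz) simp
      ultimately show ?thesis by simp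
    qed
    have g3: "\<bar>Re s - 1/2\<bar> \<le> norm (2 * s - 1)" using abs_Re_le_cmod[of "2 * s - 1"] by simp
    have Y: "norm (2 * s - 1) > 0" using g3 s1 by linarith
    have "norm (k2 s) = norm (Gamma ((s + of_nat a) / 2)) * norm (k s) / ((norm s * norm (Gamma s)) * norm (2 * s - 1))"
      by (simp add: k2_def norm_mult norm_divide mult_ac)
    also have "\<dots> \<le> G * norm (k s) / ((c / (C * exp (pi * \<bar>Im s\<bar>))) * \<bar>Re s - 1/2\<bar>)"
    proof (rule frac_le)
      show "norm (Gamma ((s + of_nat a) / 2)) * norm (k s) \<le> G * norm (k s)" using g1 by (rule mult_right_mono) simp
      have "c / (C * exp (pi * \<bar>Im s\<bar>)) \<le> norm s * norm (Gamma s)"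
        using g2 C(1) by (simp add: pos_divide_le_eq mult_ac)
      then show "c / (C * exp (pi * \<bar>Im s\<bar>)) * \<bar>Re s - 1/2\<bar> \<le> norm s * norm (Gamma s) * norm (2 * s - 1)"
        using g3 by (rule mult_mono) auto
    qed (use G c C s1 in auto)
    finally have "norm (k2 s) * ((Re s - 1/4) * \<bar>Re s - 1/2\<bar>) \<le> G * norm (k s) / ((c / (C * exp (pi * \<bar>Im s\<bar>))) * \<bar>Re s - 1/2\<bar>) * ((Re s - 1/4) * \<bar>Re s - 1/2\<bar>)"
      using s1 by (intro mult_right_mono) auto
    also have "\<dots> = (G * C / c) * (exp (pi * \<bar>Im s\<bar>) * (norm (k s) * (Re s - 1/4)))"
      using c C(1) s1(3) by (simp add: field_simps)
    finally show ?thesis .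
  qed
  have sub: "?S \<subseteq> {s. 1/4 < Re s \<and> Re s \<le> 2}" by auto
  have "expb {s. 1/4 < Re s \<and> Re s \<le> 2} (\<lambda>s. (G * C / c) * (exp (pi * \<bar>Im s\<bar>) * (norm (k s) * (Re s - 1/4))))"
    using G(1) C(1) c by (intro expb_mult expb_const expb_exp_Im kbd) auto
  then show ?thesis by (rule expb_mono[OF _ sub main])
qed

lemma X_inv: "expb {s. Re s > 1/2} (\<lambda>s. (Re s - 1/2)\<^sup>2 / norm (\<Xi> s))"
proof -
  have "expb {s. Re s > 1/2} (\<lambda>s. exp (exp 1) * ((Re s - 1/2)\<^sup>2 * Gamma (Re s) / norm (\<Xi> s)))"
    by (intro expb_mult expb_const Xlow) auto
  then show ?thesis
  proof (rule expb_mono)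
    fix s assume "s \<in> {s. Re s > 1/2}"
    then have "1 \<le> exp (exp 1) * Gamma (Re s)"
      using Gamma_real_ge[of "Re s"] by (simp add: exp_minus field_simps)
    then have "(Re s - 1/2)\<^sup>2 / norm (\<Xi> s) * 1 \<le> (Re s - 1/2)\<^sup>2 / norm (\<Xi> s) * (exp (exp 1) * Gamma (Re s))"
      by (intro mult_left_mono) auto
    then show "(Re s - 1/2)\<^sup>2 / norm (\<Xi> s) \<le> exp (exp 1) * ((Re s - 1/2)\<^sup>2 * Gamma (Re s) / norm (\<Xi> s))"
      by (simp add: mult_ac)
  qed simp
qed

text \<open>The pattern shared by three strips: one factor of \<open>N\<close> is \<open>k2\<close>
  at \<phi>(s) times the factor \<open>E\<close> of \<open>D\<close>, and \<open>E\<close> cancels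
  even where it is tiny. Of the other two factors of \<open>D\<close>, one is evaluated at \<psi>(s)
  and one at s + 1, both in the half-plane where 1/\<Xi> is controlled; the three leftover \<Lambda>
  are bounded on vertical strips.\<close>

lemma region_aux:
  fixes S :: "complex set" and \<phi> \<psi> :: "complex \<Rightarrow> complex"
  assumes \<phi>: "\<And>s. s \<in> S \<Longrightarrow> \<phi> s \<in> {s. 1/4 < Re s \<and> Re s \<le> 2 \<and> Re s \<noteq> 1/2}" "\<And>s. s \<in> S \<Longrightarrow> norm (\<phi> s) \<le> 1 + norm s"
    and \<psi>: "\<And>s. s \<in> S \<Longrightarrow> Re (\<psi> s) > 1/2" "\<And>s. s \<in> S \<Longrightarrow> norm (\<psi> s) \<le> 1 + norm s"
    and S: "\<And>s. s \<in> S \<Longrightarrow> \<bar>Re s\<bar> \<le> 2" "\<And>s. s \<in> S \<Longrightarrow> Re s > -1/2"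
    and N: "\<And>s. s \<in> S \<Longrightarrow> norm (N s) = norm (k2 (\<phi> s)) * c * norm (E s) * norm (\<Lambda> (f1 s)) * norm (\<Lambda> (f2 s)) * norm (\<Lambda> (f3 s))"
    and D: "\<And>s. s \<in> S \<Longrightarrow> norm (D s) = norm (E s) * norm (\<Xi> (\<psi> s)) * norm (\<Xi> (s + 1))"
    and f: "\<And>s. s \<in> S \<Longrightarrow> \<bar>Re (f1 s)\<bar> \<le> 5 \<and> \<bar>Re (f2 s)\<bar> \<le> 5 \<and> \<bar>Re (f3 s)\<bar> \<le> 5"
    and c: "c \<ge> 0" and nz: "\<And>s. s \<in> S \<Longrightarrow> D s \<noteq> 0"
    and \<delta>: "\<And>s. s \<in> S \<Longrightarrow> \<delta> s \<le> Re (\<phi> s) - 1/4" "\<And>s. s \<in> S \<Longrightarrow> \<delta> s \<le> \<bar>Re (\<phi> s) - 1/2\<bar>"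
      "\<And>s. s \<in> S \<Longrightarrow> \<delta> s \<le> Re (\<psi> s) - 1/2"
  shows "expb S (\<lambda>s. norm (P s) * \<delta> s ^ 6)"
proof -
  obtain B where B: "\<And>s. \<bar>Re s\<bar> \<le> 5 \<Longrightarrow> norm (\<Lambda> s) \<le> B" using Lstrip[of 5] by blast
  have B0: "B \<ge> 0" using B[of 0] by (simp add: order_trans[OF norm_ge_zero])
  let ?k = "\<lambda>s. norm (k2 s) * ((Re s - 1/4) * \<bar>Re s - 1/2\<bar>)"
  let ?x = "\<lambda>s. (Re s - 1/2)\<^sup>2 / norm (\<Xi> s)"
  have A: "expb S (\<lambda>s. ?k (\<phi> s))" by (rule expb_comp[OF k2_bound \<phi>])
  have B1: "expb S (\<lambda>s. ?x (\<psi> s))" by (rule expb_comp[OF X_inv]) (use \<psi> in auto)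
  have n1: "norm (s + 1) \<le> 1 + norm s" for s :: complex using norm_triangle_ineq[of s 1] by simp
  have C1: "expb S (\<lambda>s. ?x (s + 1))"
  proof (rule expb_comp[OF X_inv _ n1])
    fix s assume "s \<in> S"
    then show "s + 1 \<in> {s. Re s > 1/2}" using S(2)[of s] by simp
  qed
  have k0: "0 \<le> ?k (\<phi> s)" if "s \<in> S" for s using \<phi>(1)[OF that] by simp
  have "expb S (\<lambda>s. (c * B ^ 3) * (?k (\<phi> s) * (?x (\<psi> s) * ?x (s + 1))))"
    by (rule expb_mult[OF expb_const expb_mult[OF A expb_mult[OF B1 C1]]]) (use k0 c B0 in auto)
  then show ?thesis
  proof (rule expb_mono)
    fix s assume s: "s \<in> S"
    have "norm (P s) = norm (N s) / norm (D s)"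
      using P(2)[of s] nz[OF s] by (simp add: norm_divide[symmetric])
    also have "\<dots> = (norm (k2 (\<phi> s)) * c * (norm (\<Lambda> (f1 s)) * norm (\<Lambda> (f2 s)) * norm (\<Lambda> (f3 s)))) / (norm (\<Xi> (\<psi> s)) * norm (\<Xi> (s + 1)))"
    proof -
      have Enz: "norm (E s) \<noteq> 0" using nz[OF s] D[OF s] by auto
      have gen: "(k * c * e * x * y * z) / (e * u * v) = (k * c * (x * y * z)) / (u * v)" if "e \<noteq> 0" for k e x y z u v :: real
      proof -
        have "k * c * e * x * y * z = e * (k * c * (x * y * z))" "e * u * v = e * (u * v)" by (simp_all only: mult_ac)
        then show ?thesis using that by simp
      qed
      show ?thesis unfolding N[OF s] D[OF s] by (rule gen[OF Enz])
    qed
    also have "\<dots> \<le> (norm (k2 (\<phi> s)) * c * (B * B * B)) / (norm (\<Xi> (\<psi> s)) * norm (\<Xi> (s + 1)))"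
      using f[OF s] c B0 by (intro divide_right_mono mult_left_mono mult_mono B) auto
    also have "norm (k2 (\<phi> s)) * c * (B * B * B) / (norm (\<Xi> (\<psi> s)) * norm (\<Xi> (s + 1)))
      = (c * B ^ 3) * (norm (k2 (\<phi> s)) * (1 / norm (\<Xi> (\<psi> s)) * (1 / norm (\<Xi> (s + 1)))))"
      by (simp add: power3_eq_cube mult_ac)
    finally have le: "norm (P s) \<le> (c * B ^ 3) * (norm (k2 (\<phi> s)) * (1 / norm (\<Xi> (\<psi> s)) * (1 / norm (\<Xi> (s + 1)))))" .
    \<comment> \<open>Two powers pay for the two lines of \<open>k2_bound\<close>, and two more for
      each of the two uses of \<open>X_inv\<close>.\<close>
    have d6: "\<delta> s ^ 6 = (\<delta> s * \<delta> s) * ((\<delta> s)\<^sup>2 * (\<delta> s)\<^sup>2)" by (simp add: eval_nat_numeral)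
    have "norm (P s) * \<delta> s ^ 6 \<le> (c * B ^ 3) * (norm (k2 (\<phi> s)) * (1 / norm (\<Xi> (\<psi> s)) * (1 / norm (\<Xi> (s + 1))))) * ((\<delta> s * \<delta> s) * ((\<delta> s)\<^sup>2 * (\<delta> s)\<^sup>2))"
      unfolding d6 using le delta_le(3)[of s] by (intro mult_right_mono) auto
    also have "\<dots> = (c * B ^ 3) * ((norm (k2 (\<phi> s)) * (\<delta> s * \<delta> s)) * (((\<delta> s)\<^sup>2 / norm (\<Xi> (\<psi> s))) * ((\<delta> s)\<^sup>2 / norm (\<Xi> (s + 1)))))"
      by (simp add: mult_ac)
    also have "\<dots> \<le> (c * B ^ 3) * (?k (\<phi> s) * (?x (\<psi> s) * ?x (s + 1)))"
    proof (intro mult_left_mono mult_mono divide_right_mono power_mono)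
      show "\<delta> s \<le> Re (\<phi> s) - 1/4" "\<delta> s \<le> \<bar>Re (\<phi> s) - 1/2\<bar>" "\<delta> s \<le> Re (\<psi> s) - 1/2" using \<delta>[OF s] by auto
      show "\<delta> s \<le> Re (s + 1) - 1/2" using delta_le(1)[of "-1/2" s] S(2)[OF s] by (simp add: J_def)
    qed (use \<phi>(1)[OF s] delta_le(3)[of s] c B0 in auto)
    finally show "norm (P s) * \<delta> s ^ 6 \<le> (c * B ^ 3) * (?k (\<phi> s) * (?x (\<psi> s) * ?x (s + 1)))" .
  qed simp
qed

lemma norm_half_minus: "norm (1/2 - s :: complex) \<le> 1 + norm s"
  using norm_triangle_ineq4[of "1/2" s] by simp

lemma norm_half_plus: "norm (s + 1/2 :: complex) \<le> 1 + norm s"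
  using norm_triangle_ineq[of s "1/2"] by simp

text \<open>Here \<Lambda>(s) absorbs \<Xi>(s) directly.\<close>

lemma region1: "expb {s. 1/4 < Re s \<and> Re s \<le> 2 \<and> Re s \<notin> J \<and> D s \<noteq> 0} (\<lambda>s. norm (P s) * \<delta> s ^ 6)"
proof (rule region_aux[where \<phi> = "\<lambda>s. s" and \<psi> = "\<lambda>s. s + 1/2" and E = \<Xi> and c = 1 and ?f1.0 = "\<lambda>s. s + 1/2" and ?f2.0 = "\<lambda>s. s + 1" and ?f3.0 = "\<lambda>s. s + 3/2"])
  fix s assume s: "s \<in> {s. 1/4 < Re s \<and> Re s \<le> 2 \<and> Re s \<notin> J \<and> D s \<noteq> 0}"
  then have r: "\<Lambda> s = \<Xi> s * k2 s" by (intro ratio) (auto simp: J_def D_def)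
  show "norm (N s) = norm (k2 s) * 1 * norm (\<Xi> s) * norm (\<Lambda> (s + 1/2)) * norm (\<Lambda> (s + 1)) * norm (\<Lambda> (s + 3/2))"
    unfolding N_def r by (simp add: norm_mult mult_ac)
  show "norm (D s) = norm (\<Xi> s) * norm (\<Xi> (s + 1/2)) * norm (\<Xi> (s + 1))" unfolding D_def by (simp add: norm_mult)
  show "\<delta> s \<le> Re s - 1/4" "\<delta> s \<le> \<bar>Re s - 1/2\<bar>" "\<delta> s \<le> Re (s + 1/2) - 1/2"
    using delta_le(1)[of "1/4" s] delta_le(1)[of "1/2" s] delta_le(1)[of 0 s] s by (auto simp: J_def)
qed (use norm_half_plus in \<open>auto simp: J_def\<close>)

text \<open>Here 1/2 - s lies between 1/4 and 1/2, and the two functional equations turn its ratio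
  into \<Lambda>(s + 1/2) absorbing \<Xi>(s).\<close>

lemma region2: "expb {s. 0 < Re s \<and> Re s < 1/4 \<and> D s \<noteq> 0} (\<lambda>s. norm (P s) * \<delta> s ^ 6)"
proof (rule region_aux[where \<phi> = "\<lambda>s. 1/2 - s" and \<psi> = "\<lambda>s. s + 1/2" and E = \<Xi> and c = "1 / norm \<kappa>" and ?f1.0 = "\<lambda>s. s" and ?f2.0 = "\<lambda>s. s + 1" and ?f3.0 = "\<lambda>s. s + 3/2"])
  fix s assume s: "s \<in> {s. 0 < Re s \<and> Re s < 1/4 \<and> D s \<noteq> 0}"
  then have "\<Lambda> (1/2 - s) = \<Xi> (1/2 - s) * k2 (1/2 - s)" by (intro ratio) (auto simp: D_def Xfe)
  then have r: "\<Lambda> (s + 1/2) = \<Xi> s * k2 (1/2 - s) / \<kappa>" unfolding Lhalf Xfe using kappa by (simp add: field_simps)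
  show "norm (N s) = norm (k2 (1/2 - s)) * (1 / norm \<kappa>) * norm (\<Xi> s) * norm (\<Lambda> s) * norm (\<Lambda> (s + 1)) * norm (\<Lambda> (s + 3/2))"
    unfolding N_def r by (simp add: norm_mult norm_divide mult_ac)
  show "norm (D s) = norm (\<Xi> s) * norm (\<Xi> (s + 1/2)) * norm (\<Xi> (s + 1))" unfolding D_def by (simp add: norm_mult)
  show "\<delta> s \<le> Re (1/2 - s) - 1/4" "\<delta> s \<le> \<bar>Re (1/2 - s) - 1/2\<bar>" "\<delta> s \<le> Re (s + 1/2) - 1/2"
    using delta_le(1)[of "1/4" s] delta_le(1)[of 0 s] s by (auto simp: J_def)
qed (use norm_half_plus norm_half_minus in \<open>auto simp: J_def\<close>)

text \<open>Here \<Lambda>(s + 1/2) absorbs \<Xi>(s + 1/2), and \<Xi>(s) is read as \<Xi>(1/2 - s),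
  in the zero-free half-plane.\<close>

lemma region3: "expb {s. -1/4 < Re s \<and> Re s < 0 \<and> D s \<noteq> 0} (\<lambda>s. norm (P s) * \<delta> s ^ 6)"
proof (rule region_aux[where \<phi> = "\<lambda>s. s + 1/2" and \<psi> = "\<lambda>s. 1/2 - s" and E = "\<lambda>s. \<Xi> (s + 1/2)" and c = 1 and ?f1.0 = "\<lambda>s. s" and ?f2.0 = "\<lambda>s. s + 1" and ?f3.0 = "\<lambda>s. s + 3/2"])
  fix s assume s: "s \<in> {s. -1/4 < Re s \<and> Re s < 0 \<and> D s \<noteq> 0}"
  then have r: "\<Lambda> (s + 1/2) = \<Xi> (s + 1/2) * k2 (s + 1/2)" by (intro ratio) (auto simp: D_def)
  show "norm (N s) = norm (k2 (s + 1/2)) * 1 * norm (\<Xi> (s + 1/2)) * norm (\<Lambda> s) * norm (\<Lambda> (s + 1)) * norm (\<Lambda> (s + 3/2))"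
    unfolding N_def r by (simp add: norm_mult mult_ac)
  show "norm (D s) = norm (\<Xi> (s + 1/2)) * norm (\<Xi> (1/2 - s)) * norm (\<Xi> (s + 1))" unfolding D_def Xfe by (simp add: norm_mult mult_ac)
  show "\<delta> s \<le> Re (s + 1/2) - 1/4" "\<delta> s \<le> \<bar>Re (s + 1/2) - 1/2\<bar>" "\<delta> s \<le> Re (1/2 - s) - 1/2"
    using delta_le(1)[of "-1/4" s] delta_le(1)[of 0 s] s by (auto simp: J_def)
qed (use norm_half_plus norm_half_minus in \<open>auto simp: J_def\<close>)

text \<open>Legendre duplication for the two pairs of arguments that differ by 1/2. Each pair costs
  a factor 4, which exceeds sqrt(pi), and each removal of the parity \<open>a\<close> costs at most
  1 + x.\<close>

lemma Gamma_quotient: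
  fixes x :: real
  assumes x: "x > 2"
  shows "Gamma ((x + a) / 2) * Gamma ((x + 1/2 + a) / 2) * Gamma ((x + 1 + a) / 2) * Gamma ((x + 3/2 + a) / 2)
    \<le> 16 * (1 + x)\<^sup>2 * (Gamma x * Gamma (x + 1/2))"
proof -
  have dup: "Gamma y * Gamma (y + 1/2) \<le> 4 * Gamma (2 * y)" if y: "y > 1/2" for y :: real
  proof -
    have ny: "complex_of_real y \<notin> \<int>\<^sub>\<le>\<^sub>0" "complex_of_real y + 1/2 \<notin> \<int>\<^sub>\<le>\<^sub>0"
    proof -
      show "complex_of_real y \<notin> \<int>\<^sub>\<le>\<^sub>0" using y by (auto elim!: nonpos_Ints_cases simp: complex_eq_iff)
      have "Re (complex_of_real y + 1/2) > 0" using y by simp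
      then show "complex_of_real y + 1/2 \<notin> \<int>\<^sub>\<le>\<^sub>0" by (metis Gamma_eq_zero_iff Gamma_pos_nz)
    qed
    have "complex_of_real (Gamma y * Gamma (y + 1/2)) = Gamma (of_real y) * Gamma (of_real y + 1/2)"
      by (simp add: Gamma_complex_of_real[symmetric])
    also have "\<dots> = exp ((1 - 2 * of_real y) * of_real (ln 2)) * of_real (sqrt pi) * Gamma (2 * of_real y)"
      by (rule Gamma_legendre_duplication[OF ny])
    also have "\<dots> = complex_of_real (exp ((1 - 2 * y) * ln 2) * sqrt pi * Gamma (2 * y))"
      by (simp add: Gamma_complex_of_real[symmetric] exp_of_real[symmetric])
    finally have "Gamma y * Gamma (y + 1/2) = exp ((1 - 2 * y) * ln 2) * sqrt pi * Gamma (2 * y)"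
      unfolding of_real_eq_iff .
    also have "\<dots> \<le> 1 * 4 * Gamma (2 * y)"
    proof (intro mult_mono)
      show "exp ((1 - 2 * y) * ln 2) \<le> 1" using y by (simp add: mult_nonpos_nonneg)
      show "sqrt pi \<le> 4" by (rule real_le_lsqrt) (use pi_less_4 in auto)
    qed (use y in auto)
    finally show ?thesis by simp
  qed
  have d1: "Gamma ((x + a) / 2) * Gamma ((x + 1 + a) / 2) \<le> 4 * Gamma (x + a)"
    using dup[of "(x + a) / 2"] x by (simp add: add_divide_distrib algebra_simps)
  have d2: "Gamma ((x + 1/2 + a) / 2) * Gamma ((x + 3/2 + a) / 2) \<le> 4 * Gamma (x + 1/2 + a)"
    using dup[of "(x + 1/2 + a) / 2"] x by (simp add: add_divide_distrib algebra_simps)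
  have sh: "Gamma (y + a) \<le> (1 + x) * Gamma y" if "y > 0" "y \<le> 1 + x" for y :: real
  proof (cases "a = 0")
    case True
    have "1 * Gamma y \<le> (1 + x) * Gamma y" using that x Gamma_real_pos[OF that(1)] by (intro mult_right_mono) auto
    then show ?thesis using True by simp
  next
    case False
    then have "a = 1" using a1 by simp
    moreover have "Gamma (y + 1) = y * Gamma y" using that by (intro Gamma_plus1) (auto elim!: nonpos_Ints_cases)
    ultimately show ?thesis using that by (simp add: mult_right_mono)
  qed
  have "Gamma ((x + a) / 2) * Gamma ((x + 1/2 + a) / 2) * Gamma ((x + 1 + a) / 2) * Gamma ((x + 3/2 + a) / 2)
    = (Gamma ((x + a) / 2) * Gamma ((x + 1 + a) / 2)) * (Gamma ((x + 1/2 + a) / 2) * Gamma ((x + 3/2 + a) / 2))"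
    by (simp only: mult_ac)
  also have "\<dots> \<le> (4 * Gamma (x + a)) * (4 * Gamma (x + 1/2 + a))"
    by (rule mult_mono[OF d1 d2]) (use x in auto)
  also have "\<dots> \<le> (4 * ((1 + x) * Gamma x)) * (4 * ((1 + x) * Gamma (x + 1/2)))"
    using sh[of x] sh[of "x + 1/2"] x by (intro mult_mono mult_left_mono) auto
  also have "\<dots> = 16 * (1 + x)\<^sup>2 * (Gamma x * Gamma (x + 1/2))" by (simp add: power2_eq_square)
  finally show ?thesis .
qed

text \<open>The numerator contributes about \<Gamma>(x) \<Gamma>(x + 1/2), which the lower bounds
  for \<Xi>(s) and \<Xi>(s + 1/2) cancel; the lower bound for \<Xi>(s + 1) is left over and yields
  the decay by \<Gamma>(x + 1).\<close>

lemma region4: "expb {s. Re s > 2} (\<lambda>s. norm (P s) * Gamma (Re s + 1))"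
proof -
  let ?S = "{s. Re s > 2}"
  let ?L = "\<lambda>s. norm (\<Lambda> s) / Gamma ((Re s + real a) / 2)"
  let ?X = "\<lambda>s. (Re s - 1/2)\<^sup>2 * Gamma (Re s) / norm (\<Xi> s)"
  have nc: "norm (s + complex_of_real c) \<le> c + norm s" if "c \<ge> 0" for s c
    using norm_triangle_ineq[of s "of_real c"] that by simp
  have Lsh: "expb ?S (\<lambda>s. ?L (s + of_real c))" if "c \<ge> 0" for c
    by (rule expb_comp[OF Lgrow, of _ _ c]) (use that nc in auto)
  have Xsh: "expb ?S (\<lambda>s. ?X (s + of_real c))" if "c \<ge> 0" for c
    by (rule expb_comp[OF Xlow, of _ _ c]) (use that nc in auto)
  have "expb ?S (\<lambda>s. 16 * ((1 + norm s)\<^sup>2 * ((?L (s + of_real 0) * ?L (s + of_real (1/2)) * (?L (s + of_real 1) * ?L (s + of_real (3/2))))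
      * (?X (s + of_real 0) * (?X (s + of_real (1/2)) * ?X (s + of_real 1))))))"
    by (intro expb_mult expb_const expb_power expb_norm Lsh Xsh) auto
  then show ?thesis
  proof (rule expb_mono)
    fix s assume "s \<in> ?S"
    then have s: "Re s > 2" by simp
    define x where "x = Re s"
    have x: "x > 2" using s by (simp add: x_def)
    define g where "g y = Gamma ((y + real a) / 2)" for y
    have gp: "g y > 0" if "y > 0" for y using that by (simp add: g_def)
    have Gp: "Gamma x > 0" "Gamma (x + 1/2) > 0" "Gamma (x + 1) > 0" using x by auto
    define l0 l1 l2 l3 where "l0 = norm (\<Lambda> s)" and "l1 = norm (\<Lambda> (s + 1/2))" and "l2 = norm (\<Lambda> (s + 1))" and "l3 = norm (\<Lambda> (s + 3/2))"
    define x0 x1 x2 where "x0 = norm (\<Xi> s)" and "x1 = norm (\<Xi> (s + 1/2))" and "x2 = norm (\<Xi> (s + 1))"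
    have xp: "x0 > 0" "x1 > 0" "x2 > 0" using Xnz[of s] Xnz[of "s + 1/2"] Xnz[of "s + 1"] s by (auto simp: x0_def x1_def x2_def)
    have Dnz: "D s \<noteq> 0" using xp by (auto simp: D_def x0_def x1_def x2_def)
    have "norm (P s) = norm (N s) / norm (D s)" using P(2)[of s] Dnz by (simp add: norm_divide[symmetric])
    then have Pn: "norm (P s) = l0 * l1 * l2 * l3 / (x0 * x1 * x2)"
      by (simp add: N_def D_def norm_mult l0_def l1_def l2_def l3_def x0_def x1_def x2_def)
    define T where "T = l0 * l1 * l2 * l3 / (x0 * x1 * x2) * Gamma (x + 1)"
    have T0: "T \<ge> 0" unfolding T_def using xp Gp by (simp add: l0_def l1_def l2_def l3_def)
    have gq: "g x * g (x + 1/2) * g (x + 1) * g (x + 3/2) \<le> 16 * (1 + norm s)\<^sup>2 * (Gamma x * Gamma (x + 1/2))"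
    proof -
      have "(1 + x)\<^sup>2 \<le> (1 + norm s)\<^sup>2" using complex_Re_le_cmod[of s] x by (intro power_mono) (auto simp: x_def)
      then have "16 * (1 + x)\<^sup>2 * (Gamma x * Gamma (x + 1/2)) \<le> 16 * (1 + norm s)\<^sup>2 * (Gamma x * Gamma (x + 1/2))"
        using Gp by (intro mult_right_mono mult_left_mono) auto
      then show ?thesis using Gamma_quotient[OF x] unfolding g_def by linarith
    qed
    define Y where "Y = g x * g (x + 1/2) * g (x + 1) * g (x + 3/2)"
    have Y: "Y > 0" unfolding Y_def using gp x by simp
    \<comment> \<open>The factors (Re s - 1/2)^2 of the three lower bounds for \<Xi>. They are at
      least 1 in this half-plane and are inserted only to match the shape of
      \<open>Xlow\<close>.\<close>
    define W where "W = (x - 1/2)\<^sup>2 * (x + 1/2 - 1/2)\<^sup>2 * (x + 1 - 1/2)\<^sup>2"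
    have W: "W \<ge> 1"
    proof -
      have "1 * 1 * 1 \<le> W" unfolding W_def using x by (intro mult_mono one_le_power) auto
      then show ?thesis by simp
    qed
    have "T = (l0 * l1 * l2 * l3 / Y) * (Y * (Gamma (x + 1) / (x0 * x1 * x2)))"
      unfolding T_def using Y by simp
    also have "\<dots> \<le> (l0 * l1 * l2 * l3 / Y) * ((16 * (1 + norm s)\<^sup>2 * (Gamma x * Gamma (x + 1/2))) * (Gamma (x + 1) / (x0 * x1 * x2)))"
      using gq[folded Y_def] Y xp Gp by (intro mult_left_mono mult_right_mono) (auto simp: l0_def l1_def l2_def l3_def)
    also have "\<dots> = 1 * (16 * ((1 + norm s)\<^sup>2 * ((l0 * l1 * l2 * l3 / Y) * (Gamma x * Gamma (x + 1/2) * Gamma (x + 1) / (x0 * x1 * x2)))))"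
      by (simp add: mult_ac)
    also have "\<dots> \<le> W * (16 * ((1 + norm s)\<^sup>2 * ((l0 * l1 * l2 * l3 / Y) * (Gamma x * Gamma (x + 1/2) * Gamma (x + 1) / (x0 * x1 * x2)))))"
      using W Y xp Gp by (intro mult_right_mono) (auto simp: l0_def l1_def l2_def l3_def)
    finally have "T \<le> 16 * ((1 + norm s)\<^sup>2 * ((l0 * l1 * l2 * l3 / Y) * (W * (Gamma x * Gamma (x + 1/2) * Gamma (x + 1)) / (x0 * x1 * x2))))"
      by (simp add: mult_ac)
    also have "l0 * l1 * l2 * l3 / Y = ?L (s + of_real 0) * ?L (s + of_real (1/2)) * (?L (s + of_real 1) * ?L (s + of_real (3/2)))"
      unfolding Y_def g_def l0_def l1_def l2_def l3_def x_def by simp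
    also have "W * (Gamma x * Gamma (x + 1/2) * Gamma (x + 1)) / (x0 * x1 * x2) = ?X (s + of_real 0) * (?X (s + of_real (1/2)) * ?X (s + of_real 1))"
      unfolding W_def x0_def x1_def x2_def x_def by (simp add: mult_ac)
    finally show "norm (P s) * Gamma (Re s + 1) \<le> 16 * ((1 + norm s)\<^sup>2 * ((?L (s + of_real 0) * ?L (s + of_real (1/2)) * (?L (s + of_real 1) * ?L (s + of_real (3/2))))
      * (?X (s + of_real 0) * (?X (s + of_real (1/2)) * ?X (s + of_real 1)))))"
      unfolding T_def Pn x_def .
  qed simp
qed

text \<open>The product over all lines replaces \<delta> because it is the form that
  \<open>expb_remove_lines\<close> can undo.\<close>

definition "f s = norm (P s) * (\<Prod>c\<in>J. \<bar>Re s - c\<bar>) ^ 6"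

lemma f_delta: "f s \<le> (norm (P s) * \<delta> s ^ 6) * (1 + norm s) ^ 42"
proof -
  \<comment> \<open>Seven lines to the sixth power: this is the origin of the exponent 42.\<close>
  have "card J = 7" by (simp add: J_def)
  then have "(\<Prod>c\<in>J. \<bar>Re s - c\<bar>) \<le> \<delta> s * (1 + norm s) ^ 7"
    using prod_dist_le[OF J, of s] by (simp add: \<delta>_def)
  then have "(\<Prod>c\<in>J. \<bar>Re s - c\<bar>) ^ 6 \<le> (\<delta> s * (1 + norm s) ^ 7) ^ 6" by (intro power_mono prod_nonneg) auto
  then have "f s \<le> norm (P s) * (\<delta> s * (1 + norm s) ^ 7) ^ 6" unfolding f_def by (intro mult_left_mono) auto
  then show ?thesis by (simp add: power_mult_distrib power_mult[symmetric] mult.assoc)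
qed

lemma f_generic: "expb {s. Re s \<ge> -1/4 \<and> Re s \<notin> J \<and> D s \<noteq> 0} f"
proof -
  have "expb ({s. 1/4 < Re s \<and> Re s \<le> 2 \<and> Re s \<notin> J \<and> D s \<noteq> 0} \<union> {s. 0 < Re s \<and> Re s < 1/4 \<and> D s \<noteq> 0} \<union> {s. -1/4 < Re s \<and> Re s < 0 \<and> D s \<noteq> 0} \<union> {s. Re s > 2}) (\<lambda>s. norm (P s) * \<delta> s ^ 6)"
  proof (intro expb_Un region1 region2 region3)
    have "expb {s. Re s > 2} (\<lambda>s. exp (exp 1) * (norm (P s) * Gamma (Re s + 1)))"
      by (intro expb_mult expb_const region4) auto
    then show "expb {s. Re s > 2} (\<lambda>s. norm (P s) * \<delta> s ^ 6)"
    proof (rule expb_mono)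
      fix s :: complex assume "s \<in> {s. Re s > 2}"
      then have "1 \<le> exp (exp 1) * Gamma (Re s + 1)"
        using Gamma_real_ge[of "Re s + 1"] by (simp add: exp_minus field_simps)
      then have "norm (P s) * 1 \<le> norm (P s) * (exp (exp 1) * Gamma (Re s + 1))" by (intro mult_left_mono) auto
      moreover have "norm (P s) * \<delta> s ^ 6 \<le> norm (P s) * 1"
        using delta_le(2,3)[of s] by (intro mult_left_mono power_le_one) auto
      ultimately show "norm (P s) * \<delta> s ^ 6 \<le> exp (exp 1) * (norm (P s) * Gamma (Re s + 1))" by (simp add: mult_ac)
    qed simp
  qed
  then have "expb ({s. 1/4 < Re s \<and> Re s \<le> 2 \<and> Re s \<notin> J \<and> D s \<noteq> 0} \<union> {s. 0 < Re s \<and> Re s < 1/4 \<and> D s \<noteq> 0} \<union> {s. -1/4 < Re s \<and> Re s < 0 \<and> D s \<noteq> 0} \<union> {s. Re s > 2}) (\<lambda>s. (norm (P s) * \<delta> s ^ 6) * (1 + norm s) ^ 42)"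
    by (rule expb_mult[OF _ expb_power[OF expb_norm]]) (auto simp: delta_le)
  then show ?thesis
  proof (rule expb_mono)
    show "{s. Re s \<ge> -1/4 \<and> Re s \<notin> J \<and> D s \<noteq> 0} \<subseteq> {s. 1/4 < Re s \<and> Re s \<le> 2 \<and> Re s \<notin> J \<and> D s \<noteq> 0} \<union> {s. 0 < Re s \<and> Re s < 1/4 \<and> D s \<noteq> 0} \<union> {s. -1/4 < Re s \<and> Re s < 0 \<and> D s \<noteq> 0} \<union> {s. Re s > 2}"
      by (auto simp: J_def)
  qed (rule f_delta)
qed

text \<open>On the exceptional lines \<open>f\<close> is zero. The remaining excluded points are
  zeros of \<open>D\<close>; they are isolated, and both sides of the inequality are
  continuous.\<close>

lemma f_right: "expb {s. Re s \<ge> -1/4} f"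
proof -
  obtain C where C: "C \<ge> 0" "\<And>s. Re s \<ge> -1/4 \<Longrightarrow> Re s \<notin> J \<Longrightarrow> D s \<noteq> 0 \<Longrightarrow> f s \<le> exp (C * (1 + norm s))"
    using f_generic unfolding expb_def by auto
  have contP: "isCont P z" for z
    using holomorphic_on_imp_continuous_on[OF P(1)] by (simp add: continuous_on_eq_continuous_at)
  have "f s \<le> exp (C * (1 + norm s))" if s: "Re s \<ge> -1/4" for s
  proof (cases "Re s \<in> J")
    case True
    then have "(\<Prod>c\<in>J. \<bar>Re s - c\<bar>) = 0" using J(1) by (intro prod_zero) auto
    then show ?thesis by (simp add: f_def)
  next
    case False
    then have "Re s \<noteq> -1/4" by (auto simp: J_def)
    then have s': "Re s > -1/4" using s by simp
    have "open ((\<lambda>z. Re z) -` ({-1/4<..} - J))"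
      using J(1) by (intro open_vimage open_Diff finite_imp_closed continuous_intros) auto
    then have "\<forall>\<^sub>F z in at s. z \<in> (\<lambda>z. Re z) -` ({-1/4<..} - J)"
      using s' False by (intro eventually_at_in_open') auto
    moreover have "\<forall>\<^sub>F z in at s. D z \<noteq> 0 \<and> z \<in> UNIV"
      by (rule non_zero_neighbour_alt[OF Dhol, of _ _ 1]) (auto simp: D1)
    ultimately have ev: "\<forall>\<^sub>F z in at s. f z \<le> exp (C * (1 + norm z))"
      by eventually_elim (use C(2) in auto)
    have 1: "(f \<longlongrightarrow> f s) (at s)"
      unfolding f_def by (intro tendsto_intros isCont_tendsto_compose[OF contP])
    have 2: "((\<lambda>z. exp (C * (1 + norm z))) \<longlongrightarrow> exp (C * (1 + norm s))) (at s)"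
      by (intro tendsto_intros)
    show ?thesis by (rule tendsto_le[OF _ 2 1 ev]) simp
  qed
  then show ?thesis unfolding expb_def using C(1) by auto
qed

text \<open>The set \<open>J\<close> was chosen symmetric about -1/4 for this purpose.\<close>

lemma prod_reflect: "(\<Prod>c\<in>J. \<bar>Re (-1/2 - s) - c\<bar>) = (\<Prod>c\<in>J. \<bar>Re s - c\<bar>)"
proof -
  have "bij_betw (\<lambda>c. -1/2 - c) J J"
    by (rule bij_betwI[where g = "\<lambda>c. -1/2 - c"]) (auto simp: J_def)
  from prod.reindex_bij_betw[OF this, of "\<lambda>c. \<bar>Re s - c\<bar>"]
  have "(\<Prod>c\<in>J. \<bar>Re s - c\<bar>) = (\<Prod>c\<in>J. \<bar>Re s - (-1/2 - c)\<bar>)" by simp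
  also have "\<dots> = (\<Prod>c\<in>J. \<bar>Re (-1/2 - s) - c\<bar>)"
    by (intro prod.cong) (auto simp: abs_if)
  finally show ?thesis ..
qed

lemma f_all: "expb UNIV f"
proof -
  have "expb {s. Re s < -1/4} (\<lambda>s. f (-1/2 - s))"
  proof (rule expb_comp[OF f_right, of _ _ 1])
    show "norm (-1/2 - s) \<le> 1 + norm s" for s :: complex
      using norm_triangle_ineq4[of "-1/2" s] by simp
  qed auto
  then have "expb {s. Re s < -1/4} (\<lambda>s. (1 / norm \<kappa> ^ 4) * f (-1/2 - s))"
    by (intro expb_mult expb_const) (auto simp: f_def intro!: mult_nonneg_nonneg zero_le_power prod_nonneg)
  then have "expb {s. Re s < -1/4} f"
  proof (rule expb_mono)
    fix s
    have "f (-1/2 - s) = norm \<kappa> ^ 4 * f s" unfolding f_def P_reflect prod_reflect by (simp add: norm_mult norm_power)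
    then show "f s \<le> (1 / norm \<kappa> ^ 4) * f (-1/2 - s)" using kappa by simp
  qed simp
  from expb_Un[OF f_right this] show ?thesis by (rule expb_mono) auto
qed

theorem contradiction: False
proof -
  have "expb UNIV (\<lambda>s. norm (P s))"
    by (rule expb_remove_lines[OF P(1) J(1,3) f_all[unfolded f_def[abs_def]]])
  then have P0: "P s = 0" for s by (rule superexponential_decay_imp_zero[OF P(1) _ region4])
  \<comment> \<open>Zeros of \<Lambda> are isolated, so near 0 there is a point at which all four
    shifted factors of \<open>N\<close> are nonzero.\<close>
  have ev: "\<forall>\<^sub>F z in at 0. \<Lambda> (z + c) \<noteq> 0 \<and> z \<in> UNIV" for c
    by (rule non_zero_neighbour_alt[of _ _ _ "b - c"]) (auto intro!: Lcomp holomorphic_intros simp: Lnz)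
  have "\<forall>\<^sub>F z in at (0::complex). False"
    using ev[of 0] ev[of "1/2"] ev[of 1] ev[of "3/2"]
  proof eventually_elim
    case (elim z)
    then have "N z \<noteq> 0" by (simp add: N_def)
    then show ?case using P(2)[of z] P0[of z] by simp
  qed
  then show False by simp
qed

end

section \<open>Dirichlet series\<close>

definition dpow :: "complex \<Rightarrow> nat \<Rightarrow> complex" where
  "dpow s n = of_nat n powr (- s)"

lemma dpow_1 [simp]: "dpow s (Suc 0) = 1" by (simp add: dpow_def)

lemma dpow_mult: "dpow s (m * n) = dpow s m * dpow s n"
  unfolding dpow_def of_nat_mult by (rule powr_times_real) auto

lemma dpow_square: "dpow s (n ^ 2) = dpow (2 * s) n"
proof (cases "n = 0")
  case False
  then have "complex_of_nat n powr (- (2 * s)) = complex_of_nat n powr (- s + - s)" by (simp add: algebra_simps)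
  also have "\<dots> = complex_of_nat n powr (- s) * complex_of_nat n powr (- s)" by (rule powr_add)
  finally show ?thesis unfolding power2_eq_square dpow_mult by (simp add: dpow_def)
qed (simp add: dpow_def)

lemma norm_dpow: "n > 0 \<Longrightarrow> norm (dpow s n) = real n powr (- Re s)"
  unfolding dpow_def by (subst norm_powr_real_powr) auto

lemma dpow_real: "n > 0 \<Longrightarrow> dpow (of_real x) n = of_real (real n powr (- x))"
  unfolding dpow_def by (simp add: powr_of_real[symmetric])

lemma powr_telescope_bound:
  fixes e :: real
  assumes e: "e > 0" and n: "n > 0"
  shows "real (Suc n) powr (- 1 - e) \<le> (real n powr (- e) - real (Suc n) powr (- e)) / e"
proof -
  have "\<exists>z. real n < z \<and> z < real (Suc n) \<and> real (Suc n) powr (- e) - real n powr (- e) = (real (Suc n) - real n) * (- e * z powr (- e - 1))"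
    by (rule MVT2) (use n in \<open>auto intro!: derivative_eq_intros simp: powr_diff field_simps\<close>)
  then obtain z where z: "real n < z" "z < real (Suc n)" "real (Suc n) powr (- e) - real n powr (- e) = - e * z powr (- e - 1)" by auto
  have "real (Suc n) powr (- 1 - e) \<le> z powr (- 1 - e)" using z(1,2) n e by (intro powr_mono2') auto
  also have "z powr (- 1 - e) = (real n powr (- e) - real (Suc n) powr (- e)) / e"
  proof -
    have pe: "- 1 - e = - e - (1::real)" by simp
    show ?thesis unfolding pe using z(3) e by (simp add: field_simps)
  qed
  finally show ?thesis .
qed

text \<open>A telescoping comparison in place of an integral test; it gives an explicit bound of the
  size of the pole as e tends to 0.\<close>

lemma zeta_real_bound:
  fixes e :: real
  assumes e: "e > 0"
  shows "summable (\<lambda>n. real (Suc n) powr (- 1 - e))" and "(\<Sum>n. real (Suc n) powr (- 1 - e)) \<le> 1 + 1 / e"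
proof -
  have part: "(\<Sum>n<N. real (Suc n) powr (- 1 - e)) \<le> 1 + 1 / e" for N
  proof -
    have "(\<Sum>n<Suc N. real (Suc n) powr (- 1 - e)) \<le> 1 + (1 - real (Suc N) powr (- e)) / e"
    proof (induction N)
      case (Suc N)
      have "(\<Sum>n<Suc (Suc N). real (Suc n) powr (- 1 - e)) \<le> 1 + (1 - real (Suc N) powr (- e)) / e + (real (Suc N) powr (- e) - real (Suc (Suc N)) powr (- e)) / e"
        using Suc powr_telescope_bound[OF e, of "Suc N"] by simp
      also have "\<dots> = 1 + (1 - real (Suc (Suc N)) powr (- e)) / e" by (simp add: diff_divide_distrib)
      finally show ?case .
    qed simp
    also have "\<dots> \<le> 1 + 1 / e" using e by (simp add: divide_right_mono)
    finally have "(\<Sum>n<Suc N. real (Suc n) powr (- 1 - e)) \<le> 1 + 1 / e" .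
    moreover have "(\<Sum>n<N. real (Suc n) powr (- 1 - e)) \<le> (\<Sum>n<Suc N. real (Suc n) powr (- 1 - e))" by simp
    ultimately show ?thesis by linarith
  qed
  show sm: "summable (\<lambda>n. real (Suc n) powr (- 1 - e))"
    by (rule summableI_nonneg_bounded[OF _ part]) simp
  show "(\<Sum>n. real (Suc n) powr (- 1 - e)) \<le> 1 + 1 / e"
    by (rule suminf_le_const[OF sm]) (rule part)
qed

section \<open>Euler products\<close>

lemma summable_on_from_1_iff:
  fixes f :: "nat \<Rightarrow> real"
  assumes "\<And>n. f n \<ge> 0"
  shows "f summable_on {1..} \<longleftrightarrow> summable (\<lambda>n. f (Suc n))"
proof -
  have "f summable_on {1..} \<longleftrightarrow> (f \<circ> Suc) summable_on UNIV"
  proof -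
    have "range Suc = {1..}" by (auto simp: image_iff) (metis Suc_pred' Suc_le_eq not0_implies_Suc not_less_zero)
    then show ?thesis using summable_on_reindex[of Suc UNIV f] by simp
  qed
  then show ?thesis using assms by (simp add: o_def summable_on_UNIV_nonneg_real_iff)
qed

lemma infsum_from_1:
  fixes f :: "nat \<Rightarrow> complex"
  assumes "(\<lambda>n. norm (f n)) summable_on {1..}"
  shows "infsum f {1..} = (\<Sum>n. f (Suc n))" "summable (\<lambda>n. norm (f (Suc n)))"
proof -
  show "summable (\<lambda>n. norm (f (Suc n)))" using assms by (subst (asm) summable_on_from_1_iff) auto
  have r: "range Suc = {1..}" by (auto simp: image_iff) (metis Suc_pred' Suc_le_eq not0_implies_Suc not_less_zero)
  have "(f has_sum infsum f {1..}) (range Suc)" unfolding r using abs_summable_summable[OF assms] by simp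
  then have "((f \<circ> Suc) has_sum infsum f {1..}) UNIV" by (subst (asm) has_sum_reindex) auto
  then have "(\<lambda>n. f (Suc n)) sums infsum f {1..}" by (auto dest: has_sum_imp_sums simp: o_def)
  then show "infsum f {1..} = (\<Sum>n. f (Suc n))" by (rule sums_unique)
qed

lemma dpow_summable:
  assumes "Re s > 1"
  shows "(\<lambda>n. norm (dpow s n)) summable_on {1..}"
proof (subst summable_on_from_1_iff)
  have "norm (dpow s (Suc n)) = real (Suc n) powr (- 1 - (Re s - 1))" for n by (simp add: norm_dpow)
  then show "summable (\<lambda>n. norm (dpow s (Suc n)))" using zeta_real_bound(1)[of "Re s - 1"] assms by simp
qed simp

lemma dirichlet_summable:
  assumes "Re s > 1" "\<And>n. norm (u n) \<le> 1"
  shows "(\<lambda>n. norm (u n * dpow s n)) summable_on {1..}"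
proof (rule summable_on_comparison_test[OF dpow_summable[OF assms(1)]])
  show "norm (u n * dpow s n) \<le> norm (dpow s n)" for n
    using assms(2)[of n] by (simp add: norm_mult mult_left_le_one_le)
qed simp

text \<open>The integers free of primes from \<open>S\<close> split into those prime to
  \<open>p\<close> and \<open>p\<close> times the whole set, so each factor 1 - f p removes the
  multiples of one more prime. The same identity is used later to strip the primes dividing
  \<open>q\<close>.\<close>

lemma euler_sieve:
  fixes f :: "nat \<Rightarrow> complex"
  assumes mult: "\<And>m n. m > 0 \<Longrightarrow> n > 0 \<Longrightarrow> f (m * n) = f m * f n"
    and sm: "(\<lambda>n. norm (f n)) summable_on {1..}"
    and S: "finite S" "\<And>p. p \<in> S \<Longrightarrow> prime p"
  shows "infsum f {1..} * (\<Prod>p\<in>S. 1 - f p) = infsum f {n. n \<ge> 1 \<and> (\<forall>p\<in>S. \<not> p dvd n)}"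
  using S
proof (induction S)
  case empty
  have "{n. n \<ge> 1 \<and> (\<forall>p\<in>{}. \<not> p dvd n)} = {1::nat..}" by auto
  then show ?case by simp
next
  case (insert p S)
  let ?A = "{n. n \<ge> 1 \<and> (\<forall>p\<in>S. \<not> p dvd n)}"
  let ?B = "{n. n \<ge> 1 \<and> (\<forall>p\<in>insert p S. \<not> p dvd n)}"
  have p: "prime p" "p > 0" using insert.prems prime_gt_0_nat by auto
  have smA: "f summable_on X" if "X \<subseteq> {1..}" for X
    using summable_on_subset_banach[OF abs_summable_summable[OF sm] that] .
  have split: "?A = ?B \<union> (\<lambda>n. p * n) ` ?A"
  proof (intro equalityI subsetI)
    fix n assume n: "n \<in> ?A"
    show "n \<in> ?B \<union> (\<lambda>n. p * n) ` ?A"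
    proof (cases "p dvd n")
      case True
      then obtain m where m: "n = p * m" by blast
      have "m \<in> ?A" using n m p by auto
      then show ?thesis using m by blast
    qed (use n in auto)
  next
    fix n assume "n \<in> ?B \<union> (\<lambda>n. p * n) ` ?A"
    then show "n \<in> ?A"
    proof
      assume "n \<in> (\<lambda>n. p * n) ` ?A"
      then obtain m where m: "n = p * m" "m \<in> ?A" by blast
      have "\<not> r dvd p * m" if "r \<in> S" for r
      proof
        assume "r dvd p * m"
        then have "r dvd p \<or> r dvd m" using that insert.prems prime_dvd_mult_iff by blast
        then have "r dvd p" using m that by blast
        then have "r = p" using that insert.prems primes_dvd_imp_eq by blast
        then show False using that insert.hyps by blast
      qed
      then show ?thesis using m p by auto
    qed auto
  qed
  have disj: "?B \<inter> (\<lambda>n. p * n) ` ?A = {}" by auto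
  have "infsum f ?A = infsum f (?B \<union> (\<lambda>n. p * n) ` ?A)"
    using split by (rule arg_cong)
  also have "\<dots> = infsum f ?B + infsum f ((\<lambda>n. p * n) ` ?A)"
    by (rule infsum_Un_disjoint[OF smA smA disj]) (use p in auto)
  also have "infsum f ((\<lambda>n. p * n) ` ?A) = infsum (f \<circ> (\<lambda>n. p * n)) ?A"
    using p by (intro infsum_reindex) (auto simp: inj_on_def)
  also have "\<dots> = infsum (\<lambda>n. f p * f n) ?A"
    using p by (intro infsum_cong) (auto intro!: mult)
  also have "\<dots> = f p * infsum f ?A" by (rule infsum_cmult_right')
  finally have e0: "infsum f ?A = infsum f ?B + f p * infsum f ?A" .
  have "b = a * (1 - q)" if "a = b + q * a" for a b q :: complex
  proof -
    have "a - q * a = b" using that by (metis add_diff_cancel_right')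
    then show ?thesis by (simp add: algebra_simps)
  qed
  from this[OF e0] have e: "infsum f ?B = infsum f ?A * (1 - f p)" .
  have "infsum f {1..} * (\<Prod>p\<in>insert p S. 1 - f p) = (infsum f {1..} * (\<Prod>p\<in>S. 1 - f p)) * (1 - f p)"
    using insert.hyps by (simp add: mult_ac)
  also have "infsum f {1..} * (\<Prod>p\<in>S. 1 - f p) = infsum f ?A"
    by (rule insert.IH) (use insert.prems in blast)
  finally show ?case by (simp only: e)
qed

text \<open>After sieving by all primes up to \<open>N\<close>, only 1 and integers above
  \<open>N\<close> remain, and the latter are bounded by a tail of an absolutely convergent series.
  In this form nonvanishing of the sum is immediate.\<close>

lemma euler_limit:
  fixes f :: "nat \<Rightarrow> complex"
  assumes mult: "\<And>m n. m > 0 \<Longrightarrow> n > 0 \<Longrightarrow> f (m * n) = f m * f n" and f1: "f 1 = 1"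
    and sm: "(\<lambda>n. norm (f n)) summable_on {1..}"
  shows "(\<lambda>N. infsum f {1..} * (\<Prod>p | prime p \<and> p \<le> N. 1 - f p)) \<longlonglongrightarrow> 1"
proof -
  define T where "T N = infsum (\<lambda>n. norm (f n)) {1..} - (\<Sum>n\<in>{1..N}. norm (f n))" for N
  have "norm (infsum f {1..} * (\<Prod>p | prime p \<and> p \<le> N. 1 - f p) - 1) \<le> T N" if N: "N \<ge> 1" for N
  proof -
    let ?A = "{n. n \<ge> 1 \<and> (\<forall>p\<in>{p. prime p \<and> p \<le> N}. \<not> p dvd n)}"
    have fin: "finite {p::nat. prime p \<and> p \<le> N}" by (rule finite_subset[of _ "{..N}"]) auto
    have "infsum f {1..} * (\<Prod>p | prime p \<and> p \<le> N. 1 - f p) = infsum f ?A"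
      by (rule euler_sieve[OF mult sm fin]) auto
    also have "?A = {1} \<union> (?A - {1})" by auto
    also have "infsum f \<dots> = infsum f {1} + infsum f (?A - {1})"
      by (rule infsum_Un_disjoint) (auto intro!: summable_on_subset_banach[OF abs_summable_summable[OF sm]])
    finally have eq: "infsum f {1..} * (\<Prod>p | prime p \<and> p \<le> N. 1 - f p) - 1 = infsum f (?A - {1})" using f1 by simp
    have "norm (infsum f (?A - {1})) \<le> infsum (\<lambda>n. norm (f n)) (?A - {1})"
      by (rule norm_infsum_bound) (rule summable_on_subset_banach[OF sm], auto)
    moreover have "infsum (\<lambda>n. norm (f n)) (?A - {1}) \<le> infsum (\<lambda>n. norm (f n)) {N<..}"
    proof (rule infsum_mono2)
      show "?A - {1} \<subseteq> {N<..}"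
      proof
        fix n assume n: "n \<in> ?A - {1}"
        then obtain p where p: "prime p" "p dvd n" using prime_factor_nat[of n] by auto
        then have "p > N" using n by force
        moreover have "p \<le> n" using p n by (intro dvd_imp_le) auto
        ultimately show "n \<in> {N<..}" by simp
      qed
    qed (auto intro: summable_on_subset_banach[OF sm])
    moreover have "infsum (\<lambda>n. norm (f n)) {N<..} = T N"
    proof -
      have "infsum (\<lambda>n. norm (f n)) ({1..N} \<union> {N<..}) = infsum (\<lambda>n. norm (f n)) {1..N} + infsum (\<lambda>n. norm (f n)) {N<..}"
        using N by (intro infsum_Un_disjoint summable_on_subset_banach[OF sm]) auto
      moreover have "{1..N} \<union> {N<..} = {1..}" using N by auto
      ultimately show ?thesis by (simp add: T_def)
    qed
    ultimately show ?thesis unfolding eq by linarith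
  qed
  then have ev: "\<forall>\<^sub>F N in sequentially. norm (infsum f {1..} * (\<Prod>p | prime p \<and> p \<le> N. 1 - f p) - 1) \<le> T N"
    unfolding eventually_sequentially by blast
  have "(\<lambda>N. \<Sum>n\<in>{1..N}. norm (f n)) \<longlonglongrightarrow> infsum (\<lambda>n. norm (f n)) {1..}"
  proof -
    have "((\<lambda>n. norm (f n)) has_sum infsum (\<lambda>n. norm (f n)) {1..}) {1..}" using sm by simp
    then have "(sum (\<lambda>n. norm (f n)) \<longlongrightarrow> infsum (\<lambda>n. norm (f n)) {1..}) (finite_subsets_at_top {1..})"
      by (simp add: has_sum_def)
    moreover have "filterlim (\<lambda>N. {1..N}) (finite_subsets_at_top {1::nat..}) sequentially"
      unfolding filterlim_finite_subsets_at_top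
    proof (intro allI impI)
      fix X :: "nat set" assume X: "finite X \<and> X \<subseteq> {1..}"
      have "\<forall>\<^sub>F N in sequentially. N \<ge> Max (insert 0 X)" by (rule eventually_ge_at_top)
      then show "\<forall>\<^sub>F N in sequentially. finite {1..N} \<and> X \<subseteq> {1..N} \<and> {1..N} \<subseteq> {1..}"
        by eventually_elim (use X in auto)
    qed
    ultimately show ?thesis by (rule filterlim_compose)
  qed
  then have "T \<longlonglongrightarrow> infsum (\<lambda>n. norm (f n)) {1..} - infsum (\<lambda>n. norm (f n)) {1..}"
    unfolding T_def by (intro tendsto_intros)
  then have "T \<longlonglongrightarrow> 0" by simp
  from Lim_null_comparison[OF ev this] show ?thesis by (simp add: LIM_zero_iff)
qed

section \<open>Zeta for Re s > 1: bounds and the inequality of 3, 4 and 1\<close>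

definition zet :: "complex \<Rightarrow> complex" where
  "zet s = (\<Sum>n. dpow s (Suc n))"

lemma zet_infsum: "Re s > 1 \<Longrightarrow> zet s = infsum (dpow s) {1..}"
  unfolding zet_def by (rule infsum_from_1(1)[symmetric]) (rule dpow_summable)

lemma zet_real_le:
  assumes "x > 1"
  shows "norm (zet (of_real x)) \<le> 1 + 1 / (x - 1)"
proof -
  have e: "norm (dpow (of_real x) (Suc n)) = real (Suc n) powr (- 1 - (x - 1))" for n by (simp add: norm_dpow)
  have sm: "summable (\<lambda>n. norm (dpow (of_real x) (Suc n)))"
    unfolding e using zeta_real_bound(1)[of "x - 1"] assms by simp
  have "norm (zet (of_real x)) \<le> (\<Sum>n. norm (dpow (of_real x) (Suc n)))"
    unfolding zet_def by (rule summable_norm[OF sm])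
  also have "\<dots> \<le> 1 + 1 / (x - 1)" unfolding e using zeta_real_bound(2)[of "x - 1"] assms by simp
  finally show ?thesis .
qed

lemma zet_euler:
  assumes "Re s > 1"
  shows "(\<lambda>N. zet s * (\<Prod>p | prime p \<and> p \<le> N. 1 - dpow s p)) \<longlonglongrightarrow> 1"
  unfolding zet_infsum[OF assms] by (rule euler_limit[OF _ _ dpow_summable[OF assms]]) (simp_all add: dpow_mult)

lemma norm_dpow_prime_less:
  assumes "Re s > 0" "prime p"
  shows "norm (dpow s p) < 1"
proof -
  have "p > 1" using prime_gt_1_nat[OF assms(2)] .
  then show ?thesis using assms(1) by (simp add: norm_dpow powr_less_one)
qed

text \<open>For x = p^(-Re s) one has |1 - p^(-s)| (1 - x) \<le> (1 + x)(1 - x) \<le> 1, so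
  |\<zeta>(s)| \<zeta>(Re s) \<ge> 1 by the Euler product; then \<zeta>(Re s) is bounded
  above.\<close>

lemma zet_lower:
  assumes s: "Re s > 1"
  shows "norm (zet s) * (1 + 1 / (Re s - 1)) \<ge> 1"
proof -
  define r where "r = complex_of_real (Re s)"
  have r: "Re r > 1" using s by (simp add: r_def)
  have le: "norm ((zet s * (\<Prod>p | prime p \<and> p \<le> N. 1 - dpow s p)) * (zet r * (\<Prod>p | prime p \<and> p \<le> N. 1 - dpow r p))) \<le> norm (zet s) * norm (zet r)" for N
  proof -
    have "norm (1 - dpow s p) * norm (1 - dpow r p) \<le> 1" if "prime p" for p
    proof -
      define x where "x = real p powr (- Re s)"
      have p0: "p > 0" using prime_gt_0_nat[OF that] .
      have x: "0 \<le> x" "x < 1" using norm_dpow_prime_less[of s p] that s p0 by (auto simp: x_def norm_dpow)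
      have "norm (1 - dpow s p) \<le> 1 + x" using norm_triangle_ineq4[of 1 "dpow s p"] p0 by (simp add: norm_dpow x_def)
      moreover have "norm (1 - dpow r p) = 1 - x"
      proof -
        have "1 - dpow r p = of_real (1 - x)" using p0 by (simp add: r_def dpow_real x_def)
        then have "norm (1 - dpow r p) = \<bar>1 - x\<bar>" by (simp only: norm_of_real)
        then show ?thesis using x by simp
      qed
      ultimately have "norm (1 - dpow s p) * norm (1 - dpow r p) \<le> (1 + x) * (1 - x)" using x by (intro mult_mono) auto
      also have "\<dots> \<le> 1" by (simp add: algebra_simps)
      finally show ?thesis .
    qed
    then have "(\<Prod>p | prime p \<and> p \<le> N. norm (1 - dpow s p) * norm (1 - dpow r p)) \<le> 1"
      by (intro prod_le_1) auto
    then have "(norm (zet s) * norm (zet r)) * (\<Prod>p | prime p \<and> p \<le> N. norm (1 - dpow s p) * norm (1 - dpow r p)) \<le> (norm (zet s) * norm (zet r)) * 1"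
      by (intro mult_left_mono) auto
    then show ?thesis by (simp add: norm_mult prod_norm[symmetric] prod.distrib mult_ac)
  qed
  have "(\<lambda>N. norm ((zet s * (\<Prod>p | prime p \<and> p \<le> N. 1 - dpow s p)) * (zet r * (\<Prod>p | prime p \<and> p \<le> N. 1 - dpow r p)))) \<longlonglongrightarrow> norm (1 * 1 :: complex)"
    by (intro tendsto_norm tendsto_mult zet_euler s r)
  then have "norm (1 * 1 :: complex) \<le> norm (zet s) * norm (zet r)"
    by (rule LIMSEQ_le_const2) (use le in blast)
  also have "\<dots> \<le> norm (zet s) * (1 + 1 / (Re s - 1))"
    unfolding r_def using s by (intro mult_left_mono zet_real_le) auto
  finally show ?thesis by simp
qed

text \<open>Take logarithms and expand: with v = w^n of modulus 1, the n-th term is a nonnegative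
  multiple of 3 + 4 Re v + Re v^2 = 2 (1 + Re v)^2.\<close>

lemma three_four_one:
  fixes r :: real and w :: complex
  assumes r: "0 < r" "r < 1" and w: "norm w = 1"
  shows "(1 - r) ^ 3 * norm (1 - of_real r * w) ^ 4 * norm (1 - of_real r * w\<^sup>2) \<le> 1"
proof -
  have ser: "(\<lambda>n. Re (z ^ n) / real n) sums (- ln (norm (1 - z)))" if z: "norm z < 1" for z
  proof -
    have nz: "1 - z \<noteq> 0" using z by auto
    have "(\<lambda>n. - ((- (- z)) ^ n) / of_nat n) sums ln (1 + - z)" by (rule Ln_series') (use z in simp)
    then have "(\<lambda>n. Re (- (z ^ n) / of_nat n)) sums Re (ln (1 - z))" using sums_Re by fastforce
    then have "(\<lambda>n. - (Re (z ^ n) / real n)) sums ln (norm (1 - z))" using nz by (simp add: Re_Ln Re_divide_of_nat)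
    from sums_minus[OF this] show ?thesis by simp
  qed
  have n1: "norm (complex_of_real r) < 1" "norm (of_real r * w) < 1" "norm (of_real r * w\<^sup>2) < 1"
    using r w by (auto simp: norm_mult norm_power)
  have A: "(\<lambda>n. 3 * (Re ((of_real r) ^ n) / real n) + 4 * (Re ((of_real r * w) ^ n) / real n) + Re ((of_real r * w\<^sup>2) ^ n) / real n)
     sums (3 * (- ln (norm (1 - complex_of_real r))) + 4 * (- ln (norm (1 - of_real r * w))) + (- ln (norm (1 - of_real r * w\<^sup>2))))"
    by (intro sums_add sums_mult ser n1)
  have B: "0 \<le> 3 * (Re ((of_real r) ^ n) / real n) + 4 * (Re ((of_real r * w) ^ n) / real n) + Re ((of_real r * w\<^sup>2) ^ n) / real n" for n
  proof -
    define v where "v = w ^ n"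
    have nv: "(Re v)\<^sup>2 + (Im v)\<^sup>2 = 1" using w cmod_power2[of v] by (simp add: v_def norm_power)
    have e: "Re ((of_real r) ^ n) = r ^ n" "Re ((of_real r * w) ^ n) = r ^ n * Re v" "Re ((of_real r * w\<^sup>2) ^ n) = r ^ n * Re (v\<^sup>2)"
      by (simp_all add: power_mult_distrib v_def power_mult[symmetric] mult.commute[of 2] of_real_power[symmetric] del: of_real_power)
    have "3 + 4 * Re v + Re (v\<^sup>2) = 2 * (1 + Re v)\<^sup>2"
      using nv by (simp add: power2_eq_square algebra_simps)
    then have "3 + 4 * Re v + Re (v\<^sup>2) \<ge> 0" by simp
    then have "(r ^ n / real n) * (3 + 4 * Re v + Re (v\<^sup>2)) \<ge> 0" using r by (intro mult_nonneg_nonneg) auto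
    then show ?thesis unfolding e by (simp add: algebra_simps add_divide_distrib)
  qed
  have "0 \<le> 3 * (- ln (norm (1 - complex_of_real r))) + 4 * (- ln (norm (1 - of_real r * w))) + (- ln (norm (1 - of_real r * w\<^sup>2)))"
    by (rule sums_le[OF B sums_zero A])
  moreover have pos: "norm (1 - complex_of_real r) > 0" "norm (1 - of_real r * w) > 0" "norm (1 - of_real r * w\<^sup>2) > 0"
    using n1 by (auto simp: right_minus_eq)
  ultimately have "ln (norm (1 - complex_of_real r) ^ 3 * norm (1 - of_real r * w) ^ 4 * norm (1 - of_real r * w\<^sup>2)) \<le> 0"
    by (simp add: ln_mult ln_realpow)
  then have "norm (1 - complex_of_real r) ^ 3 * norm (1 - of_real r * w) ^ 4 * norm (1 - of_real r * w\<^sup>2) \<le> 1"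
    using pos by (subst (asm) ln_le_zero_iff) auto
  moreover have "norm (1 - complex_of_real r) = 1 - r"
  proof -
    have "1 - complex_of_real r = of_real (1 - r)" by simp
    then have "norm (1 - complex_of_real r) = \<bar>1 - r\<bar>" by (simp only: norm_of_real)
    then show ?thesis using r by simp
  qed
  ultimately show ?thesis by simp
qed

lemma zet_341:
  assumes x: "x > 1"
  shows "norm (zet (of_real x)) ^ 3 * norm (zet (Complex x t)) ^ 4 * norm (zet (Complex x (2 * t))) \<ge> 1"
proof -
  let ?a = "complex_of_real x" and ?b = "Complex x t" and ?c = "Complex x (2 * t)"
  let ?E = "\<lambda>s N. zet s * (\<Prod>p | prime p \<and> p \<le> N. 1 - dpow s p)"
  have le: "norm (?E ?a N) ^ 3 * norm (?E ?b N) ^ 4 * norm (?E ?c N) \<le> norm (zet ?a) ^ 3 * norm (zet ?b) ^ 4 * norm (zet ?c)" for N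
  proof -
    have "norm (1 - dpow ?a p) ^ 3 * norm (1 - dpow ?b p) ^ 4 * norm (1 - dpow ?c p) \<le> 1" if "prime p" for p
    proof -
      define r where "r = real p powr (- x)"
      define w where "w = exp (- (\<i> * of_real (t * ln (real p))))"
      have p1: "p > 1" using prime_gt_1_nat[OF that] .
      have r: "0 < r" "r < 1" using p1 x by (auto simp: r_def powr_less_one)
      have a: "dpow ?a p = of_real r" using p1 by (simp add: dpow_real r_def)
      have gen: "dpow (Complex x y) p = of_real r * exp (- (\<i> * of_real (y * ln (real p))))" for y
      proof -
        have "dpow (Complex x y) p = exp (- (Complex x y) * of_real (ln (real p)))"
          using p1 by (simp add: dpow_def powr_def Ln_of_nat)
        also have "- (Complex x y) * of_real (ln (real p)) = of_real (- x * ln (real p)) + - (\<i> * of_real (y * ln (real p)))"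
          by (simp add: complex_eq_iff)
        also have "exp \<dots> = of_real (exp (- x * ln (real p))) * exp (- (\<i> * of_real (y * ln (real p))))"
          by (simp only: exp_add exp_of_real)
        also have "exp (- x * ln (real p)) = r" using p1 by (simp add: r_def powr_def)
        finally show ?thesis .
      qed
      have b: "dpow ?b p = of_real r * w" using gen[of t] by (simp add: w_def)
      have c: "dpow ?c p = of_real r * w\<^sup>2"
        unfolding gen w_def exp_double[symmetric] by (simp add: mult_ac)
      have nw: "norm w = 1" by (simp add: w_def)
      have "norm (1 - dpow ?a p) = 1 - r"
      proof -
        have "1 - dpow ?a p = of_real (1 - r)" by (simp add: a)
        then have "norm (1 - dpow ?a p) = \<bar>1 - r\<bar>" by (simp only: norm_of_real)
        then show ?thesis using r by simp
      qed
      then show ?thesis unfolding b c using three_four_one[OF r nw] by simp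
    qed
    then have "(\<Prod>p | prime p \<and> p \<le> N. norm (1 - dpow ?a p) ^ 3 * norm (1 - dpow ?b p) ^ 4 * norm (1 - dpow ?c p)) \<le> 1"
      by (intro prod_le_1) auto
    then have "(norm (zet ?a) ^ 3 * norm (zet ?b) ^ 4 * norm (zet ?c)) * (\<Prod>p | prime p \<and> p \<le> N. norm (1 - dpow ?a p) ^ 3 * norm (1 - dpow ?b p) ^ 4 * norm (1 - dpow ?c p)) \<le> (norm (zet ?a) ^ 3 * norm (zet ?b) ^ 4 * norm (zet ?c)) * 1"
      by (intro mult_left_mono) auto
    then show ?thesis by (simp add: norm_mult prod_norm[symmetric] prod.distrib prod_power_distrib power_mult_distrib mult_ac)
  qed
  have "(\<lambda>N. norm (?E ?a N) ^ 3 * norm (?E ?b N) ^ 4 * norm (?E ?c N)) \<longlonglongrightarrow> norm (1::complex) ^ 3 * norm (1::complex) ^ 4 * norm (1::complex)"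
    by (intro tendsto_intros zet_euler) (use x in simp_all)
  then have "norm (1::complex) ^ 3 * norm (1::complex) ^ 4 * norm (1::complex) \<le> norm (zet ?a) ^ 3 * norm (zet ?b) ^ 4 * norm (zet ?c)"
    by (rule LIMSEQ_le_const2) (use le in blast)
  then show ?thesis by simp
qed

section \<open>Convolution with squares\<close>

lemma square_part_squarefree_mult:
  fixes a k :: nat
  assumes a: "squarefree a" and k: "k > 0"
  shows "square_part (a * k ^ 2) = k" "squarefree_part (a * k ^ 2) = a"
proof -
  have a0: "a > 0" using a by (auto intro: Nat.gr0I)
  let ?m = "square_part (a * k ^ 2)"
  have "k dvd ?m" by (simp add: dvd_square_part_iff)
  then obtain j where j: "?m = k * j" by blast
  have "?m ^ 2 dvd a * k ^ 2" by simp
  then have "k ^ 2 * j ^ 2 dvd k ^ 2 * a" unfolding j by (simp add: power_mult_distrib mult_ac)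
  then have "j ^ 2 dvd a" using k by simp
  then have "j = 1" using a unfolding squarefree_def by simp
  then show m: "?m = k" using j by simp
  have "a * k ^ 2 = squarefree_part (a * k ^ 2) * k ^ 2" using squarefree_decompose[of "a * k ^ 2"] m by simp
  then show "squarefree_part (a * k ^ 2) = a" using k by simp
qed

text \<open>Every positive integer is a k^2 with squarefree a in exactly one way. With
  \<open>H\<close> the Dirichlet terms of \<zeta>(2s) this removes the factor \<mu>^2.\<close>

lemma squarefree_convolution:
  fixes G :: "nat \<Rightarrow> complex"
  assumes mult: "\<And>a k. a > 0 \<Longrightarrow> k > 0 \<Longrightarrow> G (a * k ^ 2) = G a * H k"
    and sm: "(\<lambda>n. norm (G n)) summable_on {1..}" and smH: "(\<lambda>n. norm (H n)) summable_on {1..}"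
  shows "infsum (\<lambda>n. if squarefree n then G n else 0) {1..} * infsum H {1..} = infsum G {1..}"
proof -
  let ?A = "{a::nat. squarefree a}"
  have A0: "a > 0" if "a \<in> ?A" for a using that by (auto intro: Nat.gr0I)
  have bij: "bij_betw (\<lambda>(a, k). a * k ^ 2) (?A \<times> {1..}) {1::nat..}"
  proof (rule bij_betwI[where g = "\<lambda>m. (squarefree_part m, square_part m)"])
    show "(\<lambda>(a, k). a * k ^ 2) \<in> ?A \<times> {1..} \<rightarrow> {1..}" using A0 by (auto simp: Suc_le_eq)
    show "(\<lambda>m. (squarefree_part m, square_part m)) \<in> {1..} \<rightarrow> ?A \<times> {1..}" by (auto simp: Suc_le_eq intro!: Nat.gr0I)
  qed (auto simp: square_part_squarefree_mult Suc_le_eq squarefree_decompose[symmetric])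
  have "(G has_sum infsum G {1..}) {1..}" using abs_summable_summable[OF sm] by simp
  then have "((\<lambda>(a, k). G (a * k ^ 2)) has_sum infsum G {1..}) (?A \<times> {1..})"
    using has_sum_reindex_bij_betw[OF bij, of G] by (simp add: case_prod_unfold)
  moreover have "((\<lambda>k. (\<lambda>(a, k). G (a * k ^ 2)) (a, k)) has_sum (G a * infsum H {1..})) {1..}" if "a \<in> ?A" for a
  proof -
    have "((\<lambda>k. G a * H k) has_sum (G a * infsum H {1..})) {1..}"
      by (intro has_sum_cmult_right) (use abs_summable_summable[OF smH] in simp)
    then show ?thesis
      by (rule iffD1[OF has_sum_cong, rotated]) (use mult A0[OF that] in auto)
  qed
  ultimately have "((\<lambda>a. G a * infsum H {1..}) has_sum infsum G {1..}) ?A" by (rule has_sum_SigmaD)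
  then have "((\<lambda>a. (if squarefree a then G a else 0) * infsum H {1..}) has_sum infsum G {1..}) {1..}"
    by (rule iffD1[OF has_sum_cong_neutral, rotated -1]) (use A0 in \<open>auto simp: Suc_le_eq\<close>)
  then have "infsum (\<lambda>a. (if squarefree a then G a else 0) * infsum H {1..}) {1..} = infsum G {1..}" by (rule infsumI)
  then show ?thesis by (simp only: infsum_cmult_left')
qed

section \<open>Completed L-functions\<close>

lemma exp_minus_le_power:
  fixes x :: real
  assumes "x > 0"
  shows "exp (- x) \<le> fact K / x ^ K"
proof -
  have es: "(\<lambda>k. x ^ k / fact k) sums exp x"
    using exp_converges[of x] by (simp add: field_simps)
  have "(\<Sum>k\<in>{K}. x ^ k / fact k) \<le> (\<Sum>k. x ^ k / fact k)"
    using es assms by (intro sum_le_suminf) (auto simp: sums_iff)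
  then have "x ^ K / fact K \<le> exp x" using es by (simp add: sums_iff)
  then show ?thesis using assms by (simp add: exp_minus field_simps)
qed

text \<open>Any power K of the exponent may be spent on decay in u. The condition K \<ge> 2 gives a
  + 2 \<le> 2 K, so that 1/n^2 is left for summing over n.\<close>

lemma theta_term_bound:
  assumes n: "n > 0" and d: "d > 0" and K: "K \<ge> 2" and a: "a \<le> 1"
  shows "real n ^ a * exp (- (pi * (real n)\<^sup>2 / real d * exp u)) \<le> (fact K * real d ^ K * exp (- (real K * u))) * (1 / (real n)\<^sup>2)"
proof -
  define x where "x = pi * (real n)\<^sup>2 / real d * exp u"
  have x: "x > 0" using n d by (simp add: x_def)
  have "real n ^ (a + 2) \<le> real n ^ (2 * K)" using n K a by (intro power_increasing) auto
  also have "1 * \<dots> \<le> pi ^ K * real n ^ (2 * K)" using pi_gt3 by (intro mult_right_mono one_le_power) auto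
  finally have p: "real n ^ a * (real n)\<^sup>2 \<le> pi ^ K * real n ^ (2 * K)" by (simp add: power_add power2_eq_square mult_ac)
  have xK: "x ^ K = pi ^ K * real n ^ (2 * K) / real d ^ K * exp (real K * u)"
    by (simp add: x_def power_mult_distrib power_divide power_mult exp_of_nat_mult)
  have "real n ^ a * exp (- x) \<le> real n ^ a * (fact K / x ^ K)" using exp_minus_le_power[OF x] by (intro mult_left_mono) auto
  also have "\<dots> = (fact K * real d ^ K * exp (- (real K * u))) * (real n ^ a / (pi ^ K * real n ^ (2 * K)))"
    unfolding xK using d n by (simp add: exp_minus field_simps)
  also have "\<dots> \<le> (fact K * real d ^ K * exp (- (real K * u))) * (1 / (real n)\<^sup>2)"
  proof (intro mult_left_mono)
    show "real n ^ a / (pi ^ K * real n ^ (2 * K)) \<le> 1 / (real n)\<^sup>2"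
      using p n by (simp add: divide_le_eq le_divide_eq mult_ac)
  qed auto
  finally show ?thesis by (simp add: x_def)
qed

lemma theta_bounds:
  assumes h: "\<And>n. norm (h n) \<le> 1" and d: "d > 0" and a: "a \<le> 1"
  shows "summable (\<lambda>n. norm (h (Suc n) * of_nat (Suc n ^ a)) * exp (- (pi * (real (Suc n))\<^sup>2 / real d * exp u)))"
    and "K \<ge> 2 \<Longrightarrow> \<exists>C\<ge>0. \<forall>u. norm (theta d a h u) \<le> C * exp (- (real K * u))"
proof -
  let ?t = "\<lambda>u n. norm (h (Suc n) * of_nat (Suc n ^ a)) * exp (- (pi * (real (Suc n))\<^sup>2 / real d * exp u))"
  have t: "?t u n \<le> (fact K * real d ^ K * exp (- (real K * u))) * (1 / (real (Suc n))\<^sup>2)" if "K \<ge> 2" for u n K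
  proof -
    have "norm (h (Suc n) * of_nat (Suc n ^ a)) \<le> 1 * real (Suc n) ^ a"
      unfolding norm_mult norm_of_nat by (rule order_trans[OF mult_right_mono[OF h]]) (simp_all del: of_nat_Suc)
    then have "?t u n \<le> (1 * real (Suc n) ^ a) * exp (- (pi * (real (Suc n))\<^sup>2 / real d * exp u))"
      by (rule mult_right_mono) simp
    also have "\<dots> \<le> (fact K * real d ^ K * exp (- (real K * u))) * (1 / (real (Suc n))\<^sup>2)"
      unfolding mult_1 by (rule theta_term_bound) (use d a that in auto)
    finally show ?thesis .
  qed
  have s2: "summable (\<lambda>n. 1 / (real (Suc n))\<^sup>2)"
    using inverse_power_summable[of 2, where 'a = real] by (subst summable_Suc_iff) (simp add: inverse_eq_divide)
  have smK: "summable (\<lambda>n. (fact K * real d ^ K * exp (- (real K * u))) * (1 / (real (Suc n))\<^sup>2))" for K u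
    by (intro summable_mult s2)
  show sm: "summable (?t u)" for u
    by (rule summable_comparison_test[OF _ smK[of 2 u]]) (use t[where K = 2 and u = u] in \<open>auto simp del: of_nat_Suc\<close>)
  show "\<exists>C\<ge>0. \<forall>u. norm (theta d a h u) \<le> C * exp (- (real K * u))" if K: "K \<ge> 2"
  proof (intro exI conjI allI)
    show "0 \<le> fact K * real d ^ K * (\<Sum>n. 1 / (real (Suc n))\<^sup>2)" by (intro mult_nonneg_nonneg suminf_nonneg s2) auto
    fix u
    have nt: "norm ((h (Suc n) * of_nat (Suc n ^ a)) * of_real (exp (- (pi * (real (Suc n))\<^sup>2 / real d * exp u)))) = ?t u n" for n
      by (simp add: norm_mult del: of_nat_Suc)
    have "norm (theta d a h u) \<le> (\<Sum>n. ?t u n)"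
      unfolding theta_def nt[symmetric] by (rule summable_norm) (use sm[of u] in \<open>simp only: nt\<close>)
    also have "\<dots> \<le> (\<Sum>n. (fact K * real d ^ K * exp (- (real K * u))) * (1 / (real (Suc n))\<^sup>2))"
      by (rule suminf_le[OF t[OF K] sm smK])
    also have "\<dots> = (fact K * real d ^ K * exp (- (real K * u))) * (\<Sum>n. 1 / (real (Suc n))\<^sup>2)"
      by (rule suminf_mult[OF s2])
    finally show "norm (theta d a h u) \<le> fact K * real d ^ K * (\<Sum>n. 1 / (real (Suc n))\<^sup>2) * exp (- (real K * u))"
      by (simp only: mult_ac)
  qed
qed

lemma theta_measurable: "theta d a h \<in> borel_measurable borel"
  unfolding theta_def[abs_def] by measurable

lemma theta_mellin:
  assumes h: "\<And>n. norm (h n) \<le> 1" and d: "d > 0" and a: "a \<le> 1" and w: "Re w > (1 + real a) / 2"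
  shows "integrable lborel (\<lambda>u. theta d a h u * exp (of_real u * w))"
    and "(LINT u|lborel. theta d a h u * exp (of_real u * w)) =
      Gamma w * of_real (pi / real d) powr (- w) * (\<Sum>n. h (Suc n) * dpow (2 * w - of_nat a) (Suc n))"
proof -
  let ?l = "\<lambda>n. pi * (real (Suc n))\<^sup>2 / real d"
  let ?c = "\<lambda>n. h (Suc n) * of_nat (Suc n ^ a)"
  have l: "?l n > 0" for n using d by simp
  have w0: "Re w > 0" using w by (rule less_trans[rotated]) simp
  have trm: "?c n * of_real (?l n) powr (- w) = of_real (pi / real d) powr (- w) * (h (Suc n) * dpow (2 * w - of_nat a) (Suc n))" for n
  proof -
    have "complex_of_real (?l n) = of_real (pi / real d) * of_nat (Suc n ^ 2)" by (simp add: field_simps)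
    also have "\<dots> powr (- w) = of_real (pi / real d) powr (- w) * of_nat (Suc n ^ 2) powr (- w)"
      using d by (intro powr_times_real) auto
    also have "of_nat (Suc n ^ 2) powr (- w) = dpow (2 * w) (Suc n)" using dpow_square[of w "Suc n"] by (simp add: dpow_def)
    finally have 1: "complex_of_real (?l n) powr (- w) = of_real (pi / real d) powr (- w) * dpow (2 * w) (Suc n)" .
    have "complex_of_nat (Suc n ^ a) = of_nat (Suc n) powr (of_nat a)" by (simp del: of_nat_Suc)
    then have "of_nat (Suc n ^ a) * dpow (2 * w) (Suc n) = of_nat (Suc n) powr (of_nat a + - (2 * w))"
      unfolding dpow_def by (simp only: powr_add)
    also have "of_nat a + - (2 * w) = - (2 * w - of_nat a)" by simp
    finally have "of_nat (Suc n ^ a) * dpow (2 * w) (Suc n) = dpow (2 * w - of_nat a) (Suc n)"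
      by (simp only: dpow_def)
    then show ?thesis unfolding 1 by (simp add: mult_ac del: of_nat_Suc)
  qed
  have le: "norm (?c n) * ?l n powr (- Re w) \<le> (pi / real d) powr (- Re w) * real (Suc n) powr (- 1 - (2 * Re w - real a - 1))" for n
  proof -
    have "norm (?c n) * ?l n powr (- Re w) = norm (?c n * of_real (?l n) powr (- w))"
      unfolding norm_mult[of "?c n"] using l[of n] by (subst norm_powr_real_powr) auto
    also have "\<dots> = norm (of_real (pi / real d) powr (- w) * (h (Suc n) * dpow (2 * w - of_nat a) (Suc n)))" by (simp only: trm)
    also have "\<dots> = (pi / real d) powr (- Re w) * (norm (h (Suc n)) * real (Suc n) powr (- 1 - (2 * Re w - real a - 1)))"
      using d unfolding norm_mult by (subst norm_powr_real_powr) (auto simp: norm_dpow)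
    also have "\<dots> \<le> (pi / real d) powr (- Re w) * (1 * real (Suc n) powr (- 1 - (2 * Re w - real a - 1)))"
      using h by (intro mult_left_mono mult_right_mono) auto
    finally show ?thesis by simp
  qed
  have sb: "summable (\<lambda>n. (pi / real d) powr (- Re w) * real (Suc n) powr (- 1 - (2 * Re w - real a - 1)))"
    by (intro summable_mult zeta_real_bound(1)) (use w in simp)
  have sm: "summable (\<lambda>n. norm (?c n) * ?l n powr (- Re w))"
  proof (rule summable_comparison_test[OF _ sb], intro exI allI impI)
    fix n
    show "norm (norm (?c n) * ?l n powr (- Re w)) \<le> (pi / real d) powr (- Re w) * real (Suc n) powr (- 1 - (2 * Re w - real a - 1))"
      using le[of n] by (subst real_norm_def, subst abs_of_nonneg) auto
  qed
  have pt: "summable (\<lambda>n. norm (?c n) * exp (- (?l n * exp u)))" for u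
    using theta_bounds(1)[where h = h, OF h d a] by simp
  note m = mellin_exp_series[where l = ?l and c = ?c, OF w0 l sm pt]
  show "integrable lborel (\<lambda>u. theta d a h u * exp (of_real u * w))"
    using m(1) unfolding theta_def .
  have nz: "complex_of_real (pi / real d) powr (- w) \<noteq> 0" using d by simp
  have sm2: "summable (\<lambda>n. h (Suc n) * dpow (2 * w - of_nat a) (Suc n))"
    using m(3) unfolding trm using nz by (simp only: summable_cmult_iff) simp
  show "(LINT u|lborel. theta d a h u * exp (of_real u * w)) =
      Gamma w * of_real (pi / real d) powr (- w) * (\<Sum>n. h (Suc n) * dpow (2 * w - of_nat a) (Suc n))"
    using m(2) unfolding theta_def trm suminf_mult[OF sm2] by (simp only: mult.assoc)
qed

lemma exp_double_decay:
  assumes bd: "\<And>K::nat. K \<ge> 2 \<Longrightarrow> \<exists>C\<ge>0. \<forall>u\<ge>0. norm (T u :: complex) \<le> C * exp (b * u) * exp (- (real K * u))"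
    and b: "b \<le> 1" and sym: "\<And>u. norm (T (- u)) = k * norm (T u)"
  shows "\<exists>K. \<forall>u. norm (T u) \<le> K * exp (- real c * \<bar>u\<bar>)"
proof -
  \<comment> \<open>The surplus 2 absorbs exp(b u) with b \<le> 1 and satisfies the requirement K
    \<ge> 2.\<close>
  obtain C where C: "C \<ge> 0" "\<And>u. u \<ge> 0 \<Longrightarrow> norm (T u) \<le> C * exp (b * u) * exp (- (real (c + 2) * u))"
    using bd[of "c + 2"] by auto
  have pos: "norm (T u) \<le> C * exp (- real c * u)" if u: "u \<ge> 0" for u
  proof -
    have "b * u \<le> 1 * u" using b u by (intro mult_right_mono) auto
    then have "exp (b * u + - (real (c + 2) * u)) \<le> exp (- real c * u)" using u by (simp add: algebra_simps)
    then have "C * exp (b * u + - (real (c + 2) * u)) \<le> C * exp (- real c * u)" using C(1) by (rule mult_left_mono)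
    then show ?thesis using C(2)[OF u] unfolding exp_add by (simp only: mult.assoc)
  qed
  have "norm (T u) \<le> (C + \<bar>k\<bar> * C) * exp (- real c * \<bar>u\<bar>)" for u
  proof (cases "u \<ge> 0")
    case True
    have "C * exp (- real c * u) \<le> (C + \<bar>k\<bar> * C) * exp (- real c * u)" using C(1) by (intro mult_right_mono) auto
    then have "norm (T u) \<le> (C + \<bar>k\<bar> * C) * exp (- real c * u)" using pos[OF True] by linarith
    then show ?thesis using True by (simp only: abs_of_nonneg)
  next
    case False
    have "norm (T u) = k * norm (T (- u))" using sym[of "- u"] by simp
    also have "\<dots> \<le> \<bar>k\<bar> * norm (T (- u))" by (intro mult_right_mono) auto
    also have "\<dots> \<le> \<bar>k\<bar> * (C * exp (- real c * (- u)))" using pos[of "- u"] False by (intro mult_left_mono) auto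
    also have "\<dots> \<le> (C + \<bar>k\<bar> * C) * exp (- real c * \<bar>u\<bar>)" using C(1) False by (simp add: distrib_right)
    finally show ?thesis .
  qed
  then show ?thesis by blast
qed

text \<open>Since \<open>h 0 = 0\<close>, the functional equation of theta has no constant term. The
  weighted theta function \<open>T\<close> then decays at both ends faster than any exponential, and
  its Laplace transform is entire.\<close>

lemma completed_L_function:
  fixes h :: "nat \<Rightarrow> complex" and d a :: nat
  assumes d: "d > 0" and per: "\<And>n. h (n mod d) = h n" and a: "a \<le> 1" and h0: "h 0 = 0"
    and parity: "\<And>n. n \<le> d \<Longrightarrow> h (d - n) = (-1) ^ a * h n"
    and hat: "\<And>m. (\<Sum>k<d. h k * cis (2 * pi * real k * real m / real d)) = \<tau> * h m"
    and h: "\<And>n. norm (h n) \<le> 1"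
  defines "\<kappa> \<equiv> (- \<i>) ^ a * \<tau> / of_real (sqrt d)"
  obtains \<Lambda> where "\<Lambda> holomorphic_on UNIV" "\<And>s. \<Lambda> (1 - s) = \<kappa> * \<Lambda> s"
    "\<And>R. \<exists>B. \<forall>s. \<bar>Re s\<bar> \<le> R \<longrightarrow> norm (\<Lambda> s) \<le> B"
    "\<And>s. Re s > 1 \<Longrightarrow> \<Lambda> s = Gamma ((s + of_nat a) / 2) * of_real (pi / real d) powr (- ((s + of_nat a) / 2)) * (\<Sum>n. h (Suc n) * dpow s (Suc n))"
proof -
  define b where "b = 1/4 + real a / 2"
  define T where "T u = of_real (exp (u * b)) * theta d a h u" for u
  have Tfe: "T (- u) = \<kappa> * T u" for u
  proof -
    have "of_real (exp (- u * b)) * ((if a = 0 then h 0 else 0) + 2 * theta d a h (- u)) = \<kappa> * (of_real (exp (u * b)) * ((if a = 0 then h 0 else 0) + 2 * theta d a h u))"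
      using theta_functional_equation[OF d per a parity hat] unfolding \<kappa>_def b_def by blast
    then have "2 * T (- u) = 2 * (\<kappa> * T u)" unfolding T_def h0 by (simp add: mult_ac)
    then show ?thesis by simp
  qed
  have meas: "T \<in> borel_measurable borel" unfolding T_def[abs_def] using theta_measurable by measurable
  have dec: "\<exists>K. \<forall>u. norm (T u) \<le> K * exp (- real c * \<bar>u\<bar>)" for c
  proof (rule exp_double_decay[where b = b and k = "norm \<kappa>"])
    fix K :: nat assume "K \<ge> 2"
    from theta_bounds(2)[where h = h, OF h d a this] obtain C where C: "C \<ge> 0" "\<And>u. norm (theta d a h u) \<le> C * exp (- (real K * u))" by blast
    have "norm (T u) \<le> C * exp (b * u) * exp (- (real K * u))" for u
    proof -
      have "norm (T u) = exp (b * u) * norm (theta d a h u)" by (simp add: T_def norm_mult mult.commute)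
      also have "\<dots> \<le> exp (b * u) * (C * exp (- (real K * u)))" by (intro mult_left_mono C) auto
      finally show ?thesis by (simp only: mult_ac)
    qed
    then show "\<exists>C\<ge>0. \<forall>u\<ge>0. norm (T u) \<le> C * exp (b * u) * exp (- (real K * u))" using C(1) by blast
  next
    show "b \<le> 1" using a by (simp add: b_def)
    show "norm (T (- u)) = norm \<kappa> * norm (T u)" for u by (simp add: Tfe norm_mult)
  qed
  define \<Phi> where "\<Phi> w = (LINT u|lborel. T u * exp (of_real u * w))" for w
  note lap = laplace_entire[OF meas dec, folded \<Phi>_def]
  have \<Phi>hol: "\<Phi> holomorphic_on UNIV" using lap(2) by (simp add: \<Phi>_def[abs_def])
  have \<Phi>neg: "\<Phi> (- w) = \<kappa> * \<Phi> w" for w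
  proof -
    have "\<Phi> (- w) = \<bar>-1\<bar> *\<^sub>R (LINT u|lborel. T (0 + (-1) * u) * exp (of_real (0 + (-1) * u) * (- w)))"
      unfolding \<Phi>_def by (rule lborel_integral_real_affine) simp
    also have "\<dots> = (LINT u|lborel. \<kappa> * (T u * exp (of_real u * w)))" by (simp add: Tfe mult.assoc)
    also have "\<dots> = \<kappa> * \<Phi> w" unfolding \<Phi>_def by (rule integral_mult_right_zero)
    finally show ?thesis .
  qed
  \<comment> \<open>Centred at 1/2, so that s \<mapsto> 1 - s becomes w \<mapsto> -w; the half stems
    from n^2 in the theta series.\<close>
  define \<Lambda> where "\<Lambda> s = \<Phi> ((s - 1/2) / 2)" for s
  show thesis
  proof (rule that[of \<Lambda>])
    show "\<Lambda> holomorphic_on UNIV" unfolding \<Lambda>_def[abs_def]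
      by (rule holomorphic_on_compose_gen[OF _ \<Phi>hol, unfolded o_def]) (auto intro!: holomorphic_intros)
    show "\<Lambda> (1 - s) = \<kappa> * \<Lambda> s" for s
    proof -
      have "(1 - s - 1/2) / 2 = - ((s - 1/2) / 2)" by (simp add: field_simps)
      then show ?thesis unfolding \<Lambda>_def by (simp only: \<Phi>neg)
    qed
    show "\<exists>B. \<forall>s. \<bar>Re s\<bar> \<le> R \<longrightarrow> norm (\<Lambda> s) \<le> B" for R
    proof -
      obtain B where B: "\<And>w. \<bar>Re w\<bar> \<le> R + 1 \<Longrightarrow> norm (\<Phi> w) \<le> B" using lap(3)[of "R + 1"] by blast
      have "norm (\<Lambda> s) \<le> B" if "\<bar>Re s\<bar> \<le> R" for s
      proof -
        have "Re ((s - 1/2) / 2) = Re s / 2 - 1/4" by (simp add: diff_divide_distrib)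
        then show ?thesis unfolding \<Lambda>_def using that by (intro B) linarith
      qed
      then show ?thesis by blast
    qed
    fix s :: complex assume s: "Re s > 1"
    let ?w = "(s + of_nat a) / 2"
    have "\<Lambda> s = (LINT u|lborel. theta d a h u * exp (of_real u * ?w))"
      unfolding \<Lambda>_def \<Phi>_def
    proof (rule Bochner_Integration.integral_cong[OF refl])
      fix u
      have "complex_of_real (u * b) + of_real u * ((s - 1/2) / 2) = of_real u * ?w"
        by (simp add: b_def field_simps)
      then have "of_real (exp (u * b)) * exp (of_real u * ((s - 1/2) / 2)) = exp (of_real u * ?w)"
        by (simp only: exp_of_real[symmetric] exp_add[symmetric])
      then show "T u * exp (of_real u * ((s - 1/2) / 2)) = theta d a h u * exp (of_real u * ?w)"
        unfolding T_def by (metis mult.assoc mult.commute)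
    qed
    also have "\<dots> = Gamma ?w * of_real (pi / real d) powr (- ?w) * (\<Sum>n. h (Suc n) * dpow (2 * ?w - of_nat a) (Suc n))"
      by (rule theta_mellin(2)[OF h d a]) (use s in simp)
    also have "2 * ?w - of_nat a = s" by (simp add: add_divide_distrib)
    finally show "\<Lambda> s = Gamma ?w * of_real (pi / real d) powr (- ?w) * (\<Sum>n. h (Suc n) * dpow s (Suc n))" .
  qed
qed

section \<open>The completed zeta function\<close>

lemma integral_exp_left:
  assumes z: "Re z > 0"
  shows "integrable lborel (\<lambda>u. if u \<le> 0 then exp (of_real u * z) else 0)"
    and "(LINT u|lborel. (if u \<le> 0 then exp (of_real u * z) else 0)) = 1 / z"
proof -
  let ?f = "\<lambda>u. if u \<le> 0 then exp (of_real u * z) else 0"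
  have "integrable lborel (\<lambda>u. exp (- \<bar>0 + Re z * u\<bar>))"
    using lborel_integrable_real_affine_iff[of "Re z" "\<lambda>u. exp (- \<bar>u\<bar>)" 0] integrable_exp_minus_abs z by simp
  then show int: "integrable lborel ?f"
  proof (rule Bochner_Integration.integrable_bound)
    show "AE u in lborel. norm (?f u) \<le> norm (exp (- \<bar>0 + Re z * u\<bar>))"
      using z by (intro AE_I2) (auto simp: abs_mult mult.commute)
  qed measurable
  have z0: "z \<noteq> 0" using z by auto
  have "integral {- real N..real N + 1} ?f = (1 - exp (- of_real (real N) * z)) / z" for N
  proof -
    have "integral {- real N..real N + 1} ?f = integral {- real N..real N + 1} (\<lambda>u. if u \<in> {..0} then exp (of_real u * z) else 0)" by simp
    also have "\<dots> = integral ({..0} \<inter> {- real N..real N + 1}) (\<lambda>u. exp (of_real u * z))"  by (rule Henstock_Kurzweil_Integration.integral_restrict_Int)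
    also have "{..0} \<inter> {- real N..real N + 1} = {- real N..0}" by auto
    also have "integral {- real N..0} (\<lambda>u. exp (of_real u * z)) = exp (of_real 0 * z) / z - exp (of_real (- real N) * z) / z"
    proof (rule integral_unique, rule fundamental_theorem_of_calculus)
      fix u :: real
      have "((\<lambda>w. exp (w * z) / z) has_field_derivative exp (of_real u * z)) (at (of_real u))"
        using z0 by (auto intro!: derivative_eq_intros)
      then show "((\<lambda>u. exp (of_real u * z) / z) has_vector_derivative exp (of_real u * z)) (at u within {- real N..0})"
        by (rule has_vector_derivative_real_field)
    qed simp
    finally show ?thesis by (simp add: diff_divide_distrib)
  qed
  moreover have "(\<lambda>N. integral {- real N..real N + 1} ?f) \<longlonglongrightarrow> (LINT u|lborel. ?f u)"
    by (rule has_integral_UNIV_imp_lim[OF has_integral_integral_lborel[OF int]])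
  moreover have "(\<lambda>N. (1 - exp (- of_real (real N) * z)) / z) \<longlonglongrightarrow> (1 - 0) / z"
  proof (intro tendsto_intros z0)
    have n: "norm (exp (- of_real (real N) * z)) = exp (- (Re z * real N))" for N by (simp add: mult.commute)
    have "(\<lambda>N. exp (- (Re z * real N))) \<longlonglongrightarrow> 0" using z by real_asymp
    then show "(\<lambda>N. exp (- of_real (real N) * z)) \<longlonglongrightarrow> 0" unfolding tendsto_norm_zero_iff[symmetric, of "\<lambda>N. exp (- of_real (real N) * z)"] n .
  qed
  ultimately show "(LINT u|lborel. ?f u) = 1 / z" using LIMSEQ_unique by fastforce
qed

text \<open>The term n = 0 of theta spoils the symmetry of \<open>T\<close> by an explicit
  combination of exp(u/4) and exp(-u/4). Its integrals over u \<le> 0 are the polar terms 1 / (s -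
  1/2) and 1 / s.\<close>

lemma completed_zeta_function:
  obtains \<Xi> where "\<Xi> holomorphic_on UNIV" "\<And>s. \<Xi> (1/2 - s) = \<Xi> s" "\<Xi> (1/2) = 1/2"
    "\<And>s. Re s > 1/2 \<Longrightarrow> \<Xi> s = s * (2 * s - 1) * Gamma s * of_real pi powr (- s) * zet (2 * s)"
proof -
  define h where "h n = (1::complex)" for n :: nat
  define \<theta> where "\<theta> = theta 1 0 h"
  have h: "norm (h n) \<le> 1" for n by (simp add: h_def)
  define T where "T u = of_real (exp (u / 4)) * \<theta> u" for u
  have Tfe: "T (- u) = T u + of_real ((exp (u / 4) - exp (- u / 4)) / 2)" for u
  proof -
    have "of_real (exp (- u * (1/4 + real 0/2))) * ((if (0::nat) = 0 then h 0 else 0) + 2 * theta 1 0 h (- u))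
      = ((- \<i>) ^ 0 * 1 / of_real (sqrt (real 1))) * (of_real (exp (u * (1/4 + real 0/2))) * ((if (0::nat) = 0 then h 0 else 0) + 2 * theta 1 0 h u))"
      by (rule theta_functional_equation) (auto simp: h_def)
    then have "of_real (exp (- u / 4)) * (1 + 2 * \<theta> (- u)) = of_real (exp (u / 4)) * (1 + 2 * \<theta> u)"
      by (simp add: h_def \<theta>_def)
    then have "2 * T (- u) = 2 * T u + (of_real (exp (u / 4)) - of_real (exp (- u / 4)))"
      by (simp add: T_def algebra_simps)
    then show ?thesis by (simp add: field_simps)
  qed
  \<comment> \<open>The half u \<ge> 0, on which \<open>T\<close> decays, continued evenly; its
    transform is entire and even, and the correction for u \<le> 0 is integrated by hand.\<close>
  define S where "S u = T \<bar>u\<bar>" for u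
  have Tmeas: "T \<in> borel_measurable borel" unfolding T_def[abs_def] \<theta>_def using theta_measurable by measurable
  have meas: "S \<in> borel_measurable borel" unfolding S_def[abs_def] using Tmeas by measurable
  have dec: "\<exists>K. \<forall>u. norm (S u) \<le> K * exp (- real c * \<bar>u\<bar>)" for c
  proof (rule exp_double_decay[where b = "1/4" and k = 1])
    fix K :: nat assume "K \<ge> 2"
    from theta_bounds(2)[where h = h and d = 1 and a = 0, OF h _ _ this] obtain C where C: "C \<ge> 0" "\<And>u. norm (\<theta> u) \<le> C * exp (- (real K * u))"
      unfolding \<theta>_def by auto
    have "norm (S u) \<le> C * exp (1/4 * u) * exp (- (real K * u))" if "u \<ge> 0" for u
    proof -
      have "norm (S u) = exp (1/4 * u) * norm (\<theta> u)" using that by (simp add: S_def T_def norm_mult)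
      also have "\<dots> \<le> exp (1/4 * u) * (C * exp (- (real K * u)))" by (intro mult_left_mono C) auto
      finally show ?thesis by (simp only: mult_ac)
    qed
    then show "\<exists>C\<ge>0. \<forall>u\<ge>0. norm (S u) \<le> C * exp (1/4 * u) * exp (- (real K * u))" using C(1) by blast
  qed (simp_all add: S_def)
  define I where "I w = (LINT u|lborel. S u * exp (of_real u * w))" for w
  note lap = laplace_entire[OF meas dec, folded I_def]
  have Ihol: "I holomorphic_on UNIV" using lap(2) by (simp add: I_def[abs_def])
  have Ineg: "I (- w) = I w" for w
  proof -
    have "I (- w) = \<bar>-1\<bar> *\<^sub>R (LINT u|lborel. S (0 + (-1) * u) * exp (of_real (0 + (-1) * u) * (- w)))"
      unfolding I_def by (rule lborel_integral_real_affine) simp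
    also have "\<dots> = I w" unfolding I_def by (simp add: S_def)
    finally show ?thesis .
  qed
  have mellin: "Gamma s * of_real pi powr (- s) * zet (2 * s) = I (s - 1/4) + (1 / (s - 1/2) - 1 / s) / 2" if s: "Re s > 1/2" for s
  proof -
    let ?w = "s - 1/4"
    let ?e = "\<lambda>z u. if u \<le> 0 then exp (of_real u * z) else 0"
    have s1: "Re (s - 1/2) > 0" "Re s > 0" using s by auto
    have "(LINT u|lborel. \<theta> u * exp (of_real u * s)) = Gamma s * of_real (pi / real 1) powr (- s) * (\<Sum>n. h (Suc n) * dpow (2 * s - of_nat 0) (Suc n))"
      unfolding \<theta>_def by (rule theta_mellin(2)[OF h]) (use s in auto)
    also have "\<dots> = Gamma s * of_real pi powr (- s) * zet (2 * s)" by (simp add: h_def zet_def)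
    finally have "Gamma s * of_real pi powr (- s) * zet (2 * s) = (LINT u|lborel. \<theta> u * exp (of_real u * s))" ..
    also have "\<dots> = (LINT u|lborel. S u * exp (of_real u * ?w) + (?e (s - 1/2) u - ?e s u) / 2)"
    proof (rule Bochner_Integration.integral_cong[OF refl])
      fix u :: real
      have E: "of_real (exp (u / 4)) * exp (of_real u * ?w) = exp (of_real u * s)" "of_real (exp (- u / 4)) * exp (of_real u * ?w) = exp (of_real u * (s - 1/2))"
        unfolding exp_of_real[symmetric] exp_add[symmetric] by (simp_all add: algebra_simps)
      have T1: "\<theta> u * exp (of_real u * s) = T u * exp (of_real u * ?w)"
        unfolding T_def E(1)[symmetric] by (simp only: mult_ac)
      show "\<theta> u * exp (of_real u * s) = S u * exp (of_real u * ?w) + (?e (s - 1/2) u - ?e s u) / 2"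
      proof (cases "u > 0")
        case True
        then show ?thesis unfolding T1 by (simp add: S_def)
      next
        case False
        then have Su: "S u = T (- u)" by (simp add: S_def)
        have "T u = S u + of_real ((exp (- u / 4) - exp (u / 4)) / 2)"
          unfolding Su Tfe by (simp add: diff_divide_distrib)
        then have "T u * exp (of_real u * ?w) = S u * exp (of_real u * ?w) + (of_real (exp (- u / 4)) * exp (of_real u * ?w) - of_real (exp (u / 4)) * exp (of_real u * ?w)) / 2"
          by (simp add: algebra_simps)
        then show ?thesis unfolding T1 E using False by simp
      qed
    qed
    also have "\<dots> = I ?w + (1 / (s - 1/2) - 1 / s) / 2"
    proof -
      have i: "integrable lborel (?e (s - 1/2))" "integrable lborel (?e s)" by (rule integral_exp_left(1); fact s1)+
      have "(LINT u|lborel. S u * exp (of_real u * ?w) + (?e (s - 1/2) u - ?e s u) / 2) =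
        (LINT u|lborel. S u * exp (of_real u * ?w)) + (LINT u|lborel. (?e (s - 1/2) u - ?e s u) / 2)"
        by (intro Bochner_Integration.integral_add lap(1) integrable_divide_zero Bochner_Integration.integrable_diff i)
      also have "(LINT u|lborel. (?e (s - 1/2) u - ?e s u) / 2) = ((LINT u|lborel. ?e (s - 1/2) u) - (LINT u|lborel. ?e s u)) / 2"
        unfolding integral_divide_zero by (subst Bochner_Integration.integral_diff[OF i]) simp
      finally show ?thesis unfolding integral_exp_left(2)[OF s1(1)] integral_exp_left(2)[OF s1(2)] I_def .
    qed
    finally show ?thesis .
  qed
  \<comment> \<open>Multiplication by s (2 s - 1) turns the polar part into the constant
    1/2.\<close>
  define \<Xi> where "\<Xi> s = s * (2 * s - 1) * I (s - 1/4) + 1/2" for s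
  show thesis
  proof (rule that[of \<Xi>])
    have "(\<lambda>s. I (s - 1/4)) holomorphic_on UNIV"
      by (rule holomorphic_on_compose_gen[OF _ Ihol, unfolded o_def]) (auto intro!: holomorphic_intros)
    then show "\<Xi> holomorphic_on UNIV" unfolding \<Xi>_def[abs_def] by (intro holomorphic_intros)
    show "\<Xi> (1/2 - s) = \<Xi> s" for s
    proof -
      have e: "1/2 - s - 1/4 = - (s - 1/4)" by (simp add: field_simps)
      have "(1/2 - s) * (2 * (1/2 - s) - 1) = s * (2 * s - 1)" by (simp add: algebra_simps)
      then show ?thesis unfolding \<Xi>_def e Ineg by simp
    qed
    show "\<Xi> (1/2) = 1/2" by (simp add: \<Xi>_def)
    fix s :: complex assume s: "Re s > 1/2"
    then have nz: "s \<noteq> 0" "s - 1/2 \<noteq> 0" by (auto simp: complex_eq_iff)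
    have "s * (2 * s - 1) * Gamma s * of_real pi powr (- s) * zet (2 * s) = s * (2 * s - 1) * (I (s - 1/4) + (1 / (s - 1/2) - 1 / s) / 2)"
      unfolding mellin[OF s, symmetric] by (simp only: mult.assoc)
    also have "\<dots> = s * (2 * s - 1) * I (s - 1/4) + s * (2 * (s - 1/2)) * ((1 / (s - 1/2) - 1 / s) / 2)"
      by (simp add: algebra_simps)
    also have "s * (2 * (s - 1/2)) * ((1 / (s - 1/2) - 1 / s) / 2) = 1/2"
      using nz by (simp add: field_simps)
    finally show "\<Xi> s = s * (2 * s - 1) * Gamma s * of_real pi powr (- s) * zet (2 * s)" by (simp add: \<Xi>_def)
  qed
qed

section \<open>The Dirichlet series of a small summatory function\<close>

lemma norm_dpow_diff:
  assumes n: "n > 0" and s: "Re s > 0"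
  shows "norm (dpow s n - dpow s (Suc n)) \<le> norm s * real n powr (- 1 - Re s)"
proof -
  let ?S = "closed_segment (of_nat n) (of_nat (Suc n)) :: complex set"
  have S: "\<exists>x. z = of_real x \<and> x \<ge> real n" if "z \<in> ?S" for z
  proof -
    obtain u where u: "z = (1 - u) *\<^sub>R of_nat n + u *\<^sub>R of_nat (Suc n)" "0 \<le> u" "u \<le> 1"
      using \<open>z \<in> ?S\<close> unfolding closed_segment_def by blast
    then have "z = of_real (real n + u)" by (simp add: scaleR_conv_of_real algebra_simps)
    then show ?thesis using u by (intro exI[of _ "real n + u"]) auto
  qed
  have "norm (of_nat n powr (- s) - of_nat (Suc n) powr (- s)) \<le> (norm s * real n powr (- 1 - Re s)) * norm (of_nat n - of_nat (Suc n) :: complex)"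
  proof (rule field_differentiable_bound[OF convex_closed_segment[of "of_nat n" "of_nat (Suc n)"]])
    fix z :: complex assume "z \<in> ?S"
    then obtain x where x: "z = of_real x" "x \<ge> real n" using S by blast
    then have x0: "x > 0" using n by linarith
    have "z \<notin> \<real>\<^sub>\<le>\<^sub>0" using x x0 by (auto simp: complex_nonpos_Reals_iff)
    then show "((\<lambda>z. z powr (- s)) has_field_derivative (- s * z powr (- s - 1))) (at z within ?S)"
      by (intro has_field_derivative_at_within[OF has_field_derivative_powr])
    have "norm (z powr (- s - 1)) = x powr Re (- s - 1)"
      unfolding x(1) by (subst norm_powr_real_powr) (use x0 in auto)
    also have "\<dots> = x powr (- 1 - Re s)"
    proof -
      have "Re (- s - 1) = - 1 - Re s" by simp
      then show ?thesis by (simp only:)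
    qed
    also have "\<dots> \<le> real n powr (- 1 - Re s)" using x n s by (intro powr_mono2') auto
    finally show "norm (- s * z powr (- s - 1)) \<le> norm s * real n powr (- 1 - Re s)"
      by (simp add: norm_mult mult_left_mono)
  qed auto
  then show ?thesis by (simp add: dpow_def)
qed

text \<open>The Dirichlet series with summatory function \<open>M\<close> after partial summation;
  in this form it converges as far to the left as the growth of \<open>M\<close> permits.\<close>

definition Fs :: "(nat \<Rightarrow> real) \<Rightarrow> complex \<Rightarrow> complex" where
  "Fs M s = (\<Sum>n. of_real (M (Suc n)) * (dpow s (Suc n) - dpow s (Suc (Suc n))))"

lemma Fs_term_bound:
  assumes M: "\<And>n. n > 0 \<Longrightarrow> \<bar>M n\<bar> \<le> c * real n powr (1/4) + B" and s: "Re s > 1/4"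
  shows "norm (of_real (M (Suc n)) * (dpow s (Suc n) - dpow s (Suc (Suc n))))
    \<le> norm s * (c * real (Suc n) powr (- 1 - (Re s - 1/4)) + B * real (Suc n) powr (- 1 - Re s))"
proof -
  have "norm (of_real (M (Suc n)) * (dpow s (Suc n) - dpow s (Suc (Suc n)))) \<le> (c * real (Suc n) powr (1/4) + B) * (norm s * real (Suc n) powr (- 1 - Re s))"
    unfolding norm_mult norm_of_real using M[of "Suc n"] norm_dpow_diff[of "Suc n" s] s by (intro mult_mono) auto
  also have "\<dots> = norm s * (c * (real (Suc n) powr (1/4) * real (Suc n) powr (- 1 - Re s)) + B * real (Suc n) powr (- 1 - Re s))"
    by (simp add: algebra_simps)
  also have "real (Suc n) powr (1/4) * real (Suc n) powr (- 1 - Re s) = real (Suc n) powr (- 1 - (Re s - 1/4))"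
    by (simp add: powr_add[symmetric] algebra_simps)
  finally show ?thesis .
qed

text \<open>Only the term with \<open>c\<close> is singular at Re s = 1/4, so a small
  \<open>c\<close> means a weak singularity whatever \<open>B\<close> is. The 5 bounds 1 + 1 / Re
  s.\<close>

lemma Fs_bound:
  assumes M: "\<And>n. n > 0 \<Longrightarrow> \<bar>M n\<bar> \<le> c * real n powr (1/4) + B" and cB: "c \<ge> 0" "B \<ge> 0" and s: "Re s > 1/4"
  shows "summable (\<lambda>n. norm (of_real (M (Suc n)) * (dpow s (Suc n) - dpow s (Suc (Suc n)))))"
    and "norm (Fs M s) \<le> norm s * (c * (1 + 1 / (Re s - 1/4)) + 5 * B)"
proof -
  let ?t = "\<lambda>n. of_real (M (Suc n)) * (dpow s (Suc n) - dpow s (Suc (Suc n)))"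
  let ?b = "\<lambda>n. norm s * (c * real (Suc n) powr (- 1 - (Re s - 1/4)) + B * real (Suc n) powr (- 1 - Re s))"
  have z1: "summable (\<lambda>n. real (Suc n) powr (- 1 - (Re s - 1/4)))" "(\<Sum>n. real (Suc n) powr (- 1 - (Re s - 1/4))) \<le> 1 + 1 / (Re s - 1/4)"
    by (rule zeta_real_bound; use s in simp)+
  have z2: "summable (\<lambda>n. real (Suc n) powr (- 1 - Re s))" "(\<Sum>n. real (Suc n) powr (- 1 - Re s)) \<le> 1 + 1 / Re s"
    by (rule zeta_real_bound; use s in simp)+
  have smb: "summable ?b" by (intro summable_mult summable_add z1 z2)
  show sm: "summable (\<lambda>n. norm (?t n))"
    by (rule summable_comparison_test[OF _ smb]) (use Fs_term_bound[OF M s] in auto)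
  have "norm (Fs M s) \<le> (\<Sum>n. norm (?t n))" unfolding Fs_def by (rule summable_norm[OF sm])
  also have "\<dots> \<le> (\<Sum>n. ?b n)" by (rule suminf_le[OF Fs_term_bound[OF M s] sm smb])
  also have "\<dots> = norm s * (c * (\<Sum>n. real (Suc n) powr (- 1 - (Re s - 1/4))) + B * (\<Sum>n. real (Suc n) powr (- 1 - Re s)))"
    by (rule sums_unique[symmetric]) (intro sums_mult sums_add summable_sums z1 z2)
  also have "\<dots> \<le> norm s * (c * (1 + 1 / (Re s - 1/4)) + B * 5)"
  proof -
    have "1 / Re s \<le> 4" using s by (simp add: field_simps)
    then have "(\<Sum>n. real (Suc n) powr (- 1 - Re s)) \<le> 5" using z2(2) by linarith
    then show ?thesis using z1(2) cB by (intro mult_left_mono add_mono) auto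
  qed
  finally show "norm (Fs M s) \<le> norm s * (c * (1 + 1 / (Re s - 1/4)) + 5 * B)" by (simp add: mult.commute)
qed

lemma Fs_holomorphic:
  assumes M: "\<And>n. n > 0 \<Longrightarrow> \<bar>M n\<bar> \<le> c * real n powr (1/4) + B" and cB: "c \<ge> 0" "B \<ge> 0"
  shows "Fs M holomorphic_on {s. Re s > 1/4}"
proof (rule holomorphic_uniform_sequence)
  let ?t = "\<lambda>n s. of_real (M (Suc n)) * (dpow s (Suc n) - dpow s (Suc (Suc n)))"
  show op: "open {s. Re s > 1/4}" by (rule open_halfspace_Re_gt)
  show "(\<lambda>s. \<Sum>k<n. ?t k s) holomorphic_on {s. Re s > 1/4}" for n
    unfolding dpow_def by (intro holomorphic_intros)
  fix x assume x: "x \<in> {s. Re s > 1/4}"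
  define e where "e = (Re x - 1/4) / 2"
  have e: "e > 0" "Re x = 1/4 + 2 * e" using x by (simp_all add: e_def field_simps)
  define R where "R = norm x + e"
  let ?b = "\<lambda>n. R * (c * real (Suc n) powr (- 1 - e) + B * real (Suc n) powr (- 1 - e))"
  have ball: "Re s \<ge> 1/4 + e" "norm s \<le> R" if "s \<in> cball x e" for s
  proof -
    have "\<bar>Re (x - s)\<bar> \<le> e" using that abs_Re_le_cmod[of "x - s"] by (simp add: dist_norm)
    then show "Re s \<ge> 1/4 + e" using e by (simp add: abs_le_iff)
    show "norm s \<le> R" using that norm_triangle_ineq2[of s x] by (simp add: R_def dist_norm norm_minus_commute)
  qed
  have sub: "cball x e \<subseteq> {s. Re s > 1/4}" using ball(1) e(1) by force
  have "uniform_limit (cball x e) (\<lambda>n s. \<Sum>k<n. ?t k s) (\<lambda>s. \<Sum>k. ?t k s) sequentially"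
  proof (rule Weierstrass_m_test)
    fix n s assume s: "s \<in> cball x e"
    note b = ball[OF s]
    have "norm (?t n s) \<le> norm s * (c * real (Suc n) powr (- 1 - (Re s - 1/4)) + B * real (Suc n) powr (- 1 - Re s))"
      by (rule Fs_term_bound[OF M]) (use b e in auto)
    also have "\<dots> \<le> ?b n"
      using b cB e order_trans[OF norm_ge_zero b(2)] by (intro mult_mono add_mono mult_left_mono powr_mono) auto
    finally show "norm (?t n s) \<le> ?b n" .
  next
    show "summable ?b" by (intro summable_mult summable_add zeta_real_bound(1) e)
  qed
  then show "\<exists>d. 0 < d \<and> cball x d \<subseteq> {s. Re s > 1/4} \<and> uniform_limit (cball x d) (\<lambda>n s. \<Sum>k<n. ?t k s) (Fs M) sequentially"
    using e(1) sub unfolding Fs_def[abs_def] by blast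
qed

lemma Fs_abel:
  fixes f :: "nat \<Rightarrow> real"
  assumes M: "\<And>n. n > 0 \<Longrightarrow> \<bar>\<Sum>k=1..n. f k\<bar> \<le> c * real n powr (1/4) + B" and cB: "c \<ge> 0" "B \<ge> 0"
    and s: "Re s > 1" and f: "\<And>n. \<bar>f n\<bar> \<le> 1"
  shows "Fs (\<lambda>n. \<Sum>k=1..n. f k) s = infsum (\<lambda>n. of_real (f n) * dpow s n) {1..}"
proof -
  let ?M = "\<lambda>n. \<Sum>k=1..n. f k"
  let ?t = "\<lambda>n. of_real (?M (Suc n)) * (dpow s (Suc n) - dpow s (Suc (Suc n)))"
  have abel: "(\<Sum>n<N. of_real (f (Suc n)) * dpow s (Suc n)) = (\<Sum>n<N. ?t n) + of_real (?M N) * dpow s (Suc N)" for N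
  proof (induction N)
    case (Suc N)
    then show ?case by (simp add: algebra_simps del: of_real_sum)
  qed simp
  have sm: "(\<lambda>n. norm (of_real (f n) * dpow s n)) summable_on {1..}"
    by (rule dirichlet_summable[OF s]) (use f in auto)
  have "(\<lambda>N. \<Sum>n<N. of_real (f (Suc n)) * dpow s (Suc n)) \<longlonglongrightarrow> infsum (\<lambda>n. of_real (f n) * dpow s n) {1..}"
    unfolding infsum_from_1(1)[OF sm] by (rule summable_LIMSEQ[OF summable_norm_cancel[OF infsum_from_1(2)[OF sm]]])
  moreover have A: "(\<lambda>N. \<Sum>n<N. ?t n) \<longlonglongrightarrow> Fs ?M s"
    unfolding Fs_def by (rule summable_LIMSEQ[OF summable_norm_cancel[OF Fs_bound(1)[OF M cB]]]) (use s in auto)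
  \<comment> \<open>The boundary term of partial summation: at most N^(1/4) times N^(-1), up to a
    constant.\<close>
  moreover have C: "(\<lambda>N. of_real (?M N) * dpow s (Suc N)) \<longlonglongrightarrow> 0"
  proof (rule Lim_null_comparison)
    have b: "norm (of_real (?M N) * dpow s (Suc N)) \<le> (c + B) * real N powr (- (3/4))" if N: "N \<ge> 1" for N
    proof -
      have p: "real N powr (1/4) \<ge> 1" using N by (intro ge_one_powr_ge_zero) auto
      have "\<bar>?M N\<bar> \<le> (c + B) * real N powr (1/4)"
      proof -
        have "B * 1 \<le> B * real N powr (1/4)" using cB p by (intro mult_left_mono) auto
        then show ?thesis using M[of N] N by (simp add: distrib_right)
      qed
      moreover have "norm (dpow s (Suc N)) \<le> real N powr (- 1)"
      proof -
        have "norm (dpow s (Suc N)) = real (Suc N) powr (- Re s)" by (simp add: norm_dpow)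
        also have "\<dots> \<le> real (Suc N) powr (- 1)" using s by (intro powr_mono) auto
        also have "\<dots> \<le> real N powr (- 1)" using N by (intro powr_mono2') auto
        finally show ?thesis .
      qed
      ultimately have "norm (of_real (?M N) * dpow s (Suc N)) \<le> ((c + B) * real N powr (1/4)) * real N powr (- 1)"
        unfolding norm_mult norm_of_real using cB by (intro mult_mono) auto
      also have "\<dots> = (c + B) * (real N powr (1/4) * real N powr (- 1))" by (simp only: mult.assoc)
      also have "real N powr (1/4) * real N powr (- 1) = real N powr (- (3/4))"
        by (subst powr_add[symmetric]) simp
      finally show ?thesis .
    qed
    show "\<forall>\<^sub>F N in sequentially. norm (of_real (?M N) * dpow s (Suc N)) \<le> (c + B) * real N powr (- (3/4))"
      unfolding eventually_sequentially using b by blast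
    have "(\<lambda>N. real N powr (- (3/4))) \<longlonglongrightarrow> 0" by (rule tendsto_neg_powr[OF _ filterlim_real_sequentially]) simp
    then show "(\<lambda>N. (c + B) * real N powr (- (3/4))) \<longlonglongrightarrow> 0" by (rule tendsto_mult_right_zero)
  qed
  ultimately have "(\<lambda>N. (\<Sum>n<N. ?t n) + of_real (?M N) * dpow s (Suc N)) \<longlonglongrightarrow> infsum (\<lambda>n. of_real (f n) * dpow s n) {1..}"
    unfolding abel by blast
  from LIMSEQ_unique[OF tendsto_add[OF A C] this] show ?thesis by simp
qed

section \<open>Conclusion\<close>

lemma zet_nonzero: "Re s > 1 \<Longrightarrow> zet s \<noteq> 0"
  using zet_lower[of s] by auto

lemma xi_factor_continuous:
  assumes "Re s > 0"
  shows "isCont (\<lambda>s. s * (2 * s - 1) * Gamma s * of_real pi powr (- s)) s"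
proof -
  have "(\<lambda>s. s * (2 * s - 1) * Gamma s * of_real pi powr (- s)) holomorphic_on {s. Re s > 0}"
    by (intro holomorphic_intros) (auto elim!: nonpos_Ints_cases)
  then have "continuous_on {s. Re s > 0} (\<lambda>s. s * (2 * s - 1) * Gamma s * of_real pi powr (- s))"
    by (rule holomorphic_on_imp_continuous_on)
  then show ?thesis using assms by (subst (asm) continuous_on_eq_continuous_at[OF open_halfspace_Re_gt]) auto
qed

text \<open>To the right of the line the Euler product decides, and at s = 1/2 the pole of zeta is
  met by the zero of 2 s - 1. On the rest of the line the classical argument by
  \<open>zet_341\<close> is applied to \<Xi> divided by its elementary factors, which continues zeta
  to the line.\<close>

lemma completed_zeta_nonzero:
  assumes hol: "\<Xi> holomorphic_on UNIV" and half: "\<Xi> (1/2) = 1/2"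
    and form: "\<And>s. Re s > 1/2 \<Longrightarrow> \<Xi> s = s * (2 * s - 1) * Gamma s * of_real pi powr (- s) * zet (2 * s)"
    and s: "Re s \<ge> 1/2"
  shows "\<Xi> s \<noteq> 0"
proof -
  define W where "W s = s * (2 * s - 1) * Gamma s * of_real pi powr (- s)" for s :: complex
  have W0: "W z \<noteq> 0" if "Re z > 1/2 \<or> Re z = 1/2 \<and> Im z \<noteq> 0" for z
  proof -
    have "Gamma z \<noteq> 0" using that by (auto simp: Gamma_eq_zero_iff elim!: nonpos_Ints_cases)
    moreover have "2 * z - 1 \<noteq> 0" using that by (auto simp: complex_eq_iff)
    moreover have "z \<noteq> 0" using that by auto
    ultimately show ?thesis by (simp add: W_def)
  qed
  have form': "\<Xi> z = W z * zet (2 * z)" if "Re z > 1/2" for z using form[OF that] by (simp add: W_def)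
  have tend: "((\<lambda>e. \<phi> (z + of_real e)) \<longlongrightarrow> \<phi> z) (at_right 0)" if "isCont \<phi> z" for \<phi> :: "complex \<Rightarrow> complex" and z
  proof (rule isCont_tendsto_compose[OF that])
    have "((\<lambda>e. z + complex_of_real e) \<longlongrightarrow> z + of_real 0) (at_right 0)" by (intro tendsto_intros)
    then show "((\<lambda>e. z + complex_of_real e) \<longlongrightarrow> z) (at_right 0)" by simp
  qed
  have Xc: "isCont \<Xi> z" for z
    using holomorphic_on_imp_continuous_on[OF hol] by (simp add: continuous_on_eq_continuous_at)
  have Wc: "isCont W z" if "Re z > 0" for z using xi_factor_continuous[OF that] unfolding W_def[abs_def] .
  consider "Re s > 1/2" | "s = 1/2" | "Re s = 1/2" "s \<noteq> 1/2" using s by fastforce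
  then show ?thesis
  proof cases
    case 1
    have "zet (2 * s) \<noteq> 0" using 1 by (intro zet_nonzero) simp
    moreover have "W s \<noteq> 0" using 1 by (intro W0) auto
    ultimately show ?thesis using form'[OF 1] by simp
  next
    case 2
    then have "\<Xi> s = 1/2" using half by (simp only:)
    show ?thesis unfolding \<open>\<Xi> s = 1/2\<close> by simp
  next
    case 3
    define y where "y = Im s"
    have sy: "s = Complex (1/2) y" using 3 by (simp add: complex_eq_iff y_def)
    have y0: "y \<noteq> 0" using 3 by (auto simp: complex_eq_iff y_def)
    define s' where "s' = Complex (1/2) (2 * y)"
    show ?thesis
    proof
      assume X0: "\<Xi> s = 0"
      have "(\<Xi> has_field_derivative deriv \<Xi> s) (at s)" using hol by (intro holomorphic_derivI) auto
      then have "((\<lambda>h. \<Xi> (s + h) / h) \<longlongrightarrow> deriv \<Xi> s) (at 0)" by (simp add: DERIV_def X0)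
      moreover have "filterlim (\<lambda>e. complex_of_real e) (at 0) (at_right 0)"
        unfolding filterlim_at using eventually_at_right_less[of "0::real"]
        by (auto intro!: tendsto_eq_intros elim: eventually_mono)
      ultimately have D: "((\<lambda>e. \<Xi> (s + of_real e) / of_real e) \<longlongrightarrow> deriv \<Xi> s) (at_right 0)"
        by (rule filterlim_compose)
      have nz: "W s \<noteq> 0" "W s' \<noteq> 0" using y0 by (simp_all add: W0 sy s'_def )
      have V: "((\<lambda>e. (\<Xi> (s + of_real e) / of_real e) / W (s + of_real e)) \<longlongrightarrow> deriv \<Xi> s / W s) (at_right 0)"
        by (intro tendsto_divide D tend[OF Wc] nz) (simp add: sy)
      have Z: "((\<lambda>e. \<Xi> (s' + of_real e) / W (s' + of_real e)) \<longlongrightarrow> \<Xi> s' / W s') (at_right 0)"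
        by (intro tendsto_divide tend[OF Wc] tend[OF Xc] nz) (simp add: s'_def)
      \<comment> \<open>A zero at \<open>s\<close> would supply e^4 against e^(-3) from the pole;
        one factor e is left over, so \<open>?L\<close> tends to 0 although it is at least
        1.\<close>
      let ?L = "\<lambda>e. (e + 1/2) ^ 3 * norm ((\<Xi> (s + of_real e) / of_real e) / W (s + of_real e)) ^ 4 * norm (\<Xi> (s' + of_real e) / W (s' + of_real e)) * e"
      have "(?L \<longlongrightarrow> (0 + 1/2) ^ 3 * norm (deriv \<Xi> s / W s) ^ 4 * norm (\<Xi> s' / W s') * 0) (at_right 0)"
        by (intro tendsto_mult tendsto_power tendsto_norm tendsto_add V Z tendsto_const) (simp_all add: tendsto_ident_at)
      then have L0: "(?L \<longlongrightarrow> 0) (at_right 0)" by simp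
      have "?L e \<ge> 1" if e: "e > 0" for e
      proof -
        have z: "\<Xi> z / W z = zet (2 * z)" if "Re z > 1/2" for z
        proof -
          have "W z \<noteq> 0" using that by (intro W0) auto
          then show ?thesis using form'[OF that] by simp
        qed
        have e1: "2 * (s + of_real e) = Complex (1 + 2 * e) (2 * y)" "2 * (s' + of_real e) = Complex (1 + 2 * e) (2 * (2 * y))"
          by (simp_all add: complex_eq_iff sy s'_def)
        have r1: "\<Xi> (s + of_real e) / W (s + of_real e) = zet (Complex (1 + 2 * e) (2 * y))"
          using z[of "s + of_real e"] e unfolding e1 by (simp add: sy)
        have r2: "\<Xi> (s' + of_real e) / W (s' + of_real e) = zet (Complex (1 + 2 * e) (2 * (2 * y)))"
          using z[of "s' + of_real e"] e unfolding e1 by (simp add: s'_def)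
        let ?a = "norm (zet (of_real (1 + 2 * e)))"
        let ?b = "norm (zet (Complex (1 + 2 * e) (2 * y)))" and ?c = "norm (zet (Complex (1 + 2 * e) (2 * (2 * y))))"
        have "1 \<le> ?a ^ 3 * ?b ^ 4 * ?c" by (rule zet_341) (use e in simp)
        also have "\<dots> = (e * ?a) ^ 3 * (?b / e) ^ 4 * ?c * e"
          using e by (simp add: field_simps power3_eq_cube power4_eq_xxxx)
        also have "\<dots> \<le> (e + 1/2) ^ 3 * (?b / e) ^ 4 * ?c * e"
        proof (intro mult_right_mono power_mono)
          have "e * ?a \<le> e * (1 + 1 / (2 * e))"
            using zet_real_le[of "1 + 2 * e"] e by (intro mult_left_mono) auto
          also have "e * (1 + 1 / (2 * e)) = e + 1/2" using e by (simp add: field_simps)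
          finally show "e * ?a \<le> e + 1/2" .
        qed (use e in auto)
        also have "?b / e = norm ((\<Xi> (s + of_real e) / of_real e) / W (s + of_real e))"
          unfolding r1[symmetric] using e by (simp add: norm_divide norm_mult)
        also have "?c = norm (\<Xi> (s' + of_real e) / W (s' + of_real e))" unfolding r2 ..
        finally show ?thesis .
      qed
      then have "\<forall>\<^sub>F e in at_right 0. ?L e \<ge> 1"
        using eventually_at_right_less[of "0::real"] by (auto elim: eventually_mono)
      then have "(1::real) \<le> 0" by (intro tendsto_lowerbound[OF L0]) simp_all
      then show False by simp
    qed
  qed
qed

lemma expb_powr:
  assumes "\<And>s. g s = u * s + v"
  shows "expb S (\<lambda>s. norm (w powr g s))"
proof (cases "w = 0")
  case True
  then show ?thesis by (simp add: expb_const)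
next
  case False
  define l where "l = norm (Ln w)"
  show ?thesis unfolding expb_def
  proof (intro exI conjI ballI)
    show "(norm u + norm v) * l \<ge> 0" by (simp add: l_def)
    fix s
    have "norm (w powr g s) = exp (Re (g s * Ln w))" using False by (simp add: powr_def)
    also have "\<dots> \<le> exp (norm (g s * Ln w))" by (simp only: exp_le_cancel_iff complex_Re_le_cmod)
    also have "norm (g s * Ln w) \<le> (norm u * norm s + norm v) * l"
      unfolding norm_mult l_def assms by (intro mult_right_mono order_trans[OF norm_triangle_ineq]) (auto simp: norm_mult)
    also have "\<dots> \<le> ((norm u + norm v) * (1 + norm s)) * l"
    proof (intro mult_right_mono)
      have "norm v * norm s \<ge> 0" by simp
      then show "norm u * norm s + norm v \<le> (norm u + norm v) * (1 + norm s)" by (simp add: algebra_simps)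
    qed (simp add: l_def)
    finally show "norm (w powr g s) \<le> exp ((norm u + norm v) * l * (1 + norm s))" by (simp add: mult_ac)
  qed
qed

text \<open>One factor Re s - 1/2 comes from 2 s - 1 and the other from the lower bound
  \<open>zet_lower\<close> for zeta near its pole.\<close>

lemma completed_zeta_lower:
  assumes form: "\<And>s. Re s > 1/2 \<Longrightarrow> \<Xi> s = s * (2 * s - 1) * Gamma s * of_real pi powr (- s) * zet (2 * s)"
  shows "expb {s. Re s > 1/2} (\<lambda>s. (Re s - 1/2)\<^sup>2 * Gamma (Re s) / norm (\<Xi> s))"
proof -
  obtain C where C: "C > 0" "\<And>s. Re s > 0 \<Longrightarrow> Re s * Gamma (Re s) \<le> C * exp (pi * \<bar>Im s\<bar>) * norm s * norm (Gamma s)"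
    using norm_Gamma_lower by blast
  have "expb {s. Re s > 1/2} (\<lambda>s. (C / 2 * exp (pi * \<bar>Im s\<bar>)) * norm (of_real pi powr s))"
    by (rule expb_mult[OF expb_mult[OF expb_const expb_exp_Im] expb_powr[where u = 1 and v = 0]]) (use C in auto)
  then show ?thesis
  proof (rule expb_mono)
    fix s assume "s \<in> {s. Re s > 1/2}"
    then have s: "Re s > 1/2" by simp
    define x where "x = Re s"
    define E where "E = exp (pi * \<bar>Im s\<bar>)"
    have x: "x > 1/2" using s by (simp add: x_def)
    have E: "E > 0" by (simp add: E_def)
    have G: "x * Gamma x \<le> C * E * norm s * norm (Gamma s)" using C(2)[of s] s by (simp add: x_def E_def)
    have Z: "(2 * x - 1) / (2 * x) \<le> norm (zet (2 * s))"
    proof -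
      have "1 \<le> norm (zet (2 * s)) * (1 + 1 / (2 * x - 1))" using zet_lower[of "2 * s"] s by (simp add: x_def)
      also have "1 + 1 / (2 * x - 1) = 2 * x / (2 * x - 1)" using x by (simp add: field_simps)
      finally show ?thesis using x by (simp add: field_simps)
    qed
    have T: "2 * x - 1 \<le> norm (2 * s - 1)" using complex_Re_le_cmod[of "2 * s - 1"] by (simp add: x_def)
    have p1: "norm (of_real pi powr z) = pi powr Re z" for z by (simp add: norm_powr_real_powr)
    have p: "norm (of_real pi powr s) = pi powr x" "norm (of_real pi powr (- s)) = 1 / pi powr x"
      using p1[of s] p1[of "- s"] powr_minus_divide[of pi x] by (simp_all only: uminus_complex.sel x_def)
    define Y where "Y = norm (\<Xi> s)"
    have "(x * Gamma x) * (2 * x - 1) * ((2 * x - 1) / (2 * x)) \<le> (C * E * norm s * norm (Gamma s)) * norm (2 * s - 1) * norm (zet (2 * s))"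
      by (intro mult_mono G T Z) (use x C E in auto)
    also have "\<dots> = C * E * pi powr x * Y"
      using form[OF s] by (simp add: Y_def norm_mult p mult_ac)
    also have "(x * Gamma x) * (2 * x - 1) * ((2 * x - 1) / (2 * x)) = 2 * ((x - 1/2)\<^sup>2 * Gamma x)"
      using x by (simp add: field_simps power2_eq_square)
    finally have main: "2 * ((x - 1/2)\<^sup>2 * Gamma x) \<le> C * E * pi powr x * Y" .
    have "(x - 1/2)\<^sup>2 * Gamma x / Y \<le> C / 2 * E * pi powr x"
    proof (cases "Y = 0")
      case True
      then show ?thesis using C E by simp
    next
      case False
      then have "Y > 0" by (simp add: Y_def)
      then show ?thesis using main by (simp add: field_simps)
    qed
    then show "(Re s - 1/2)\<^sup>2 * Gamma (Re s) / norm (\<Xi> s) \<le> C / 2 * exp (pi * \<bar>Im s\<bar>) * norm (of_real pi powr s)"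
      by (simp add: p Y_def x_def E_def)
  qed simp
qed

lemma L_series_nonzero:
  fixes h :: "nat \<Rightarrow> complex"
  assumes mult: "\<And>m n. h (m * n) = h m * h n" and h1: "h 1 = 1" and h: "\<And>n. norm (h n) \<le> 1" and s: "Re s > 1"
  shows "(\<Sum>n. h (Suc n) * dpow s (Suc n)) \<noteq> 0"
proof
  assume 0: "(\<Sum>n. h (Suc n) * dpow s (Suc n)) = 0"
  note sm = dirichlet_summable[OF s h]
  have "infsum (\<lambda>n. h n * dpow s n) {1..} = 0" using infsum_from_1(1)[OF sm] 0 by simp
  moreover have "(\<lambda>N. infsum (\<lambda>n. h n * dpow s n) {1..} * (\<Prod>p | prime p \<and> p \<le> N. 1 - h p * dpow s p)) \<longlonglongrightarrow> 1"
    by (rule euler_limit[OF _ _ sm]) (use h1 in \<open>auto simp: mult dpow_mult\<close>)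
  ultimately show False by (simp add: LIMSEQ_const_iff)
qed

lemma L_series_bounded:
  fixes h :: "nat \<Rightarrow> complex"
  assumes h: "\<And>n. norm (h n) \<le> 1" and s: "Re s \<ge> 2"
  shows "norm (\<Sum>n. h (Suc n) * dpow s (Suc n)) \<le> 2"
proof -
  have s1: "Re s > 1" using s by simp
  note sm = infsum_from_1(2)[OF dirichlet_summable[OF s1 h]]
  have le: "norm (h (Suc n) * dpow s (Suc n)) \<le> real (Suc n) powr (- 1 - 1)" for n
  proof -
    have "norm (h (Suc n) * dpow s (Suc n)) \<le> 1 * real (Suc n) powr (- Re s)"
      unfolding norm_mult by (intro mult_mono h) (auto simp: norm_dpow)
    also have "\<dots> \<le> 1 * real (Suc n) powr (- 1 - 1)" using s by (intro mult_left_mono powr_mono) auto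
    finally show ?thesis by simp
  qed
  have "norm (\<Sum>n. h (Suc n) * dpow s (Suc n)) \<le> (\<Sum>n. norm (h (Suc n) * dpow s (Suc n)))" by (rule summable_norm[OF sm])
  also have "\<dots> \<le> (\<Sum>n. real (Suc n) powr (- 1 - 1))" by (rule suminf_le[OF le sm]) (rule zeta_real_bound(1), simp)
  also have "\<dots> \<le> 1 + 1 / 1" by (rule zeta_real_bound(2)) simp
  finally show ?thesis by simp
qed

section \<open>The Dirichlet series of the squarefree twist\<close>

lemma char_extension_eq_on_coprime:
  fixes h :: "nat \<Rightarrow> complex"
  assumes g: "is_char_extension q chi g" and q: "q > 0"
    and mult: "\<And>m n. h (m * n) = h m * h n" and h1: "h 1 = 1" and hchi: "\<And>n. coprime n q \<Longrightarrow> h n = chi n"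
  shows "n > 0 \<Longrightarrow> coprime n q \<Longrightarrow> of_int (g n) = h n"
proof (induction n rule: less_induct)
  case (less n)
  show ?case
  proof (cases "n = 1")
    case True
    then show ?thesis using g h1 by (simp add: is_char_extension_def completely_multiplicative_def)
  next
    case False
    then obtain p where p: "prime p" "p dvd n" using prime_factor_nat by blast
    then obtain m where n: "n = p * m" by (elim dvdE)
    have p1: "p > 1" using prime_gt_1_nat[OF p(1)] .
    with n less.prems have m: "m > 0" "m < n" "coprime m q" "coprime p q" by auto
    have "\<not> p dvd q" using coprime_common_divisor[OF m(4), of p] p(1) by auto
    then have "of_int (g p) = h p" using g p(1) hchi[OF m(4)] by (simp add: is_char_extension_def)
    moreover have "g n = g p * g m" using g m p1 unfolding n by (simp add: is_char_extension_def completely_multiplicative_def)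
    ultimately show ?thesis using less.IH[OF m(2,1,3)] by (simp add: n mult)
  qed
qed

lemma coprime_iff_no_prime_factor:
  fixes n q :: nat
  assumes "q > 0"
  shows "coprime n q \<longleftrightarrow> (\<forall>p\<in>prime_factors q. \<not> p dvd n)"
proof
  assume c: "coprime n q"
  show "\<forall>p\<in>prime_factors q. \<not> p dvd n"
  proof (intro ballI notI)
    fix p assume p: "p \<in> prime_factors q" "p dvd n"
    have "p dvd q" "prime p" using p(1) by (auto simp: in_prime_factors_iff)
    then show False using coprime_common_divisor[OF c p(2)] by auto
  qed
next
  assume a: "\<forall>p\<in>prime_factors q. \<not> p dvd n"
  show "coprime n q"
  proof (rule ccontr)
    assume "\<not> coprime n q"
    then have "gcd n q \<noteq> 1" using coprime_iff_gcd_eq_1[of n q] by blast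
    then obtain p where "prime p" "p dvd gcd n q" using prime_factor_nat by blast
    then show False using a assms by (auto simp: in_prime_factors_iff)
  qed
qed

text \<open>Convolution with \<zeta>(2s) turns the twist into the full series of \<open>g\<close>.
  Sieving this series and that of \<open>h\<close> by the primes of \<open>q\<close> leaves sums
  over integers prime to \<open>q\<close>, where \<open>g\<close> and \<open>h\<close>
  coincide.\<close>

lemma moebius_twist_series:
  fixes h :: "nat \<Rightarrow> complex" and g :: "nat \<Rightarrow> int"
  assumes g: "is_char_extension q chi g" and q: "q > 0"
    and mult: "\<And>m n. h (m * n) = h m * h n" and h1: "h 1 = 1" and hchi: "\<And>n. coprime n q \<Longrightarrow> h n = chi n"
    and h: "\<And>n. norm (h n) \<le> 1" and s: "Re s > 1"
  shows "infsum (\<lambda>n. of_real (real_of_int ((moebius_mu n)\<^sup>2 * g n)) * dpow s n) {1..} * zet (2 * s) * (\<Prod>p\<in>prime_factors q. 1 - dpow s p)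
    = (\<Sum>n. h (Suc n) * dpow s (Suc n)) * (\<Prod>p\<in>prime_factors q. 1 - h p * dpow s p)"
proof -
  define u where "u n = (if n = 0 then 0 else complex_of_int (g n))" for n
  have gm: "g (m * n) = g m * g n" if "m > 0" "n > 0" for m n
    using g that by (simp add: is_char_extension_def completely_multiplicative_def)
  have gv: "g n = 1 \<or> g n = -1" if "n > 0" for n using g that by (auto simp: is_char_extension_def)
  have g2: "g (k\<^sup>2) = 1" if "k > 0" for k
    using gm[OF that that] gv[OF that] by (auto simp: power2_eq_square)
  have un: "norm (u n) \<le> 1" for n using gv[of n] by (auto simp: u_def)
  note smu = dirichlet_summable[OF s un] and smh = dirichlet_summable[OF s h]
  have s2: "Re (2 * s) > 1" using s by simp
  have 1: "infsum (\<lambda>n. of_real (real_of_int ((moebius_mu n)\<^sup>2 * g n)) * dpow s n) {1..} = infsum (\<lambda>n. if squarefree n then u n * dpow s n else 0) {1..}"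
  proof (rule infsum_cong)
    fix n :: nat assume n: "n \<in> {1..}"
    have "((- 1) ^ card (prime_factors n))\<^sup>2 = (1::complex)" by (simp add: power_even_eq[symmetric] power_mult[symmetric])
    then show "of_real (real_of_int ((moebius_mu n)\<^sup>2 * g n)) * dpow s n = (if squarefree n then u n * dpow s n else 0)"
      using n by (simp add: moebius_mu_def u_def)
  qed
  have 2: "infsum (\<lambda>n. if squarefree n then u n * dpow s n else 0) {1..} * zet (2 * s) = infsum (\<lambda>n. u n * dpow s n) {1..}"
    unfolding zet_infsum[OF s2]
  proof (rule squarefree_convolution[OF _ smu dpow_summable[OF s2]])
    fix a k :: nat assume "a > 0" "k > 0"
    then show "u (a * k\<^sup>2) * dpow s (a * k\<^sup>2) = u a * dpow s a * dpow (2 * s) k"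
      using gm[of a "k\<^sup>2"] g2[of k] by (simp add: u_def dpow_mult dpow_square)
  qed
  have "infsum (\<lambda>n. u n * dpow s n) {1..} * (\<Prod>p\<in>prime_factors q. 1 - dpow s p) = infsum (\<lambda>n. u n * dpow s n) {1..} * (\<Prod>p\<in>prime_factors q. 1 - u p * dpow s p)"
  proof -
    \<comment> \<open>By the choice of \<open>g\<close> at primes dividing \<open>q\<close>, so the
      zeta-like factor 1 - p^(-s) is the Euler factor of \<open>g\<close> there.\<close>
    have "u p = 1" if "p \<in> prime_factors q" for p
      using that g by (auto simp: u_def is_char_extension_def in_prime_factors_iff prime_gt_0_nat)
    then show ?thesis by simp
  qed
  also have "\<dots> = infsum (\<lambda>n. u n * dpow s n) {n. n \<ge> 1 \<and> (\<forall>p\<in>prime_factors q. \<not> p dvd n)}"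
    by (rule euler_sieve[OF _ smu]) (use gm in \<open>auto simp: u_def dpow_mult\<close>)
  also have "\<dots> = infsum (\<lambda>n. h n * dpow s n) {n. n \<ge> 1 \<and> (\<forall>p\<in>prime_factors q. \<not> p dvd n)}"
  proof (rule infsum_cong)
    fix n assume "n \<in> {n. n \<ge> 1 \<and> (\<forall>p\<in>prime_factors q. \<not> p dvd n)}"
    then have "n > 0" "coprime n q" using coprime_iff_no_prime_factor[OF q, of n] by auto
    then show "u n * dpow s n = h n * dpow s n"
      using char_extension_eq_on_coprime[OF g q mult h1 hchi] by (simp add: u_def)
  qed
  also have "\<dots> = infsum (\<lambda>n. h n * dpow s n) {1..} * (\<Prod>p\<in>prime_factors q. 1 - h p * dpow s p)"
    by (rule euler_sieve[OF _ smh, symmetric]) (auto simp: mult dpow_mult)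
  also have "infsum (\<lambda>n. h n * dpow s n) {1..} = (\<Sum>n. h (Suc n) * dpow s (Suc n))" by (rule infsum_from_1(1)[OF smh])
  finally show ?thesis unfolding 1 2 .
qed

text \<open>The residue d - 1 represents -1, so \<open>h\<close> takes at it a value with square 1,
  and d - n is congruent to (d - 1) n.\<close>

lemma primitive_character_parity:
  fixes h :: "nat \<Rightarrow> complex"
  assumes d: "d > 1" and per: "\<And>n. h (n + d) = h n" and mult: "\<And>m n. h (m * n) = h m * h n" and h0: "h 0 = 0" and h1: "h 1 = 1"
  obtains a :: nat where "a \<le> 1" "\<And>n. n \<le> d \<Longrightarrow> h (d - n) = (-1) ^ a * h n"
proof -
  have hmod: "h (n mod d) = h n" for n by (rule periodic_mod[where h = h and d = d, OF per])
  obtain m where m: "d = m + 2" using d by (metis add.commute le_Suc_ex Suc_1 Suc_leI One_nat_def)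
  have "h (d - 1) * h (d - 1) = 1"
  proof -
    have "(d - 1) * (d - 1) = 1 + m * d" by (simp add: m algebra_simps)
    then have "h ((d - 1) * (d - 1)) = h ((1 + m * d) mod d)" using hmod by metis
    moreover have "(1 + m * d) mod d = 1" using d by (simp only: mod_mult_self1) simp
    ultimately show ?thesis using h1 by (simp only: mult)
  qed
  then have sq: "h (d - 1) = 1 \<or> h (d - 1) = -1" by (simp add: square_eq_1_iff)
  have refl: "h (d - n) = h (d - 1) * h n" if n: "n \<le> d" for n
  proof (cases n)
    case 0
    then show ?thesis using per[of 0] h0 by simp
  next
    case (Suc k)
    obtain j where j: "d = n + j" using n le_Suc_ex by blast
    have "(d - 1) * n = (d - n) + k * d" unfolding j Suc by (simp add: algebra_simps)
    then have "h ((d - 1) * n) = h (((d - n) + k * d) mod d)" using hmod by metis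
    then show ?thesis using hmod[of "d - n"] by (simp add: mult)
  qed
  from sq show ?thesis
  proof
    assume "h (d - 1) = 1" then show ?thesis using refl by (intro that[of 0]) auto
  next
    assume "h (d - 1) = -1" then show ?thesis using refl by (intro that[of 1]) auto
  qed
qed

lemma summatory_nat: "summatory f (real n) = (\<Sum>k=1..n. real_of_int (f k))"
  unfolding summatory_def by (rule sum.cong) auto

text \<open>The shape c n^(1/4) + B with arbitrary c > 0 expresses smallness without limits;
  \<open>B\<close>, which depends on \<open>c\<close>, collects the finitely many n below the
  threshold.\<close>

lemma summatory_small:
  assumes neg: "\<not> (\<exists>c>0. \<forall>X. \<exists>x\<ge>X. \<bar>summatory f x\<bar> \<ge> c * x powr (1 / 4))" and c: "c > 0"
  shows "\<exists>B\<ge>0. \<forall>n>0. \<bar>\<Sum>k=1..n. real_of_int (f k)\<bar> \<le> c * real n powr (1/4) + B"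
proof -
  obtain X where X: "\<And>x. x \<ge> X \<Longrightarrow> \<bar>summatory f x\<bar> < c * x powr (1 / 4)" using neg c by (meson not_le)
  define N where "N = nat \<lceil>X\<rceil>"
  let ?M = "\<lambda>n. \<bar>\<Sum>k=1..n. real_of_int (f k)\<bar>"
  show ?thesis
  proof (intro exI conjI allI impI)
    show "(\<Sum>n\<le>N. ?M n) \<ge> 0" by (intro sum_nonneg) simp
    fix n :: nat
    show "?M n \<le> c * real n powr (1/4) + (\<Sum>n\<le>N. ?M n)"
    proof (cases "n \<le> N")
      case True
      then have "?M n \<le> (\<Sum>n\<le>N. ?M n)" by (intro member_le_sum) auto
      moreover have "c * real n powr (1/4) \<ge> 0" using c by simp
      ultimately show ?thesis by linarith
    next
      case False
      then have "real n \<ge> X" by (simp add: N_def) linarith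
      then have "?M n < c * real n powr (1/4)" using X[of "real n"] by (simp add: summatory_nat)
      moreover have "(\<Sum>n\<le>N. ?M n) \<ge> 0" by (intro sum_nonneg) simp
      ultimately show ?thesis by linarith
    qed
  qed
qed

lemma omega_imp_not_smallo:
  assumes "\<exists>c>0. \<forall>X. \<exists>x\<ge>X. \<bar>F x\<bar> \<ge> c * x powr (1 / 4 :: real)"
  shows "F \<notin> o[at_top](\<lambda>x. x powr (1 / 4))"
proof
  assume o: "F \<in> o[at_top](\<lambda>x. x powr (1 / 4))"
  obtain c where c: "c > 0" "\<And>X. \<exists>x\<ge>X. \<bar>F x\<bar> \<ge> c * x powr (1 / 4)" using assms by blast
  have "\<forall>\<^sub>F x in at_top. norm (F x) \<le> c / 2 * norm (x powr (1 / 4))"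
    using c(1) by (intro landau_o.smallD[OF o]) simp
  then obtain X where X: "\<And>x. x \<ge> X \<Longrightarrow> \<bar>F x\<bar> \<le> c / 2 * x powr (1 / 4)" by (auto simp: eventually_at_top_linorder)
  obtain x where x: "x \<ge> max X 1" "\<bar>F x\<bar> \<ge> c * x powr (1 / 4)" using c(2) by blast
  have "c * x powr (1 / 4) \<le> c / 2 * x powr (1 / 4)" using X[of x] x by simp
  moreover have "c * x powr (1 / 4) > 0" using x c(1) by simp
  ultimately show False by simp
qed

text \<open>The conductor may lack primes of \<open>q\<close>, so \<open>h\<close> can have
  nontrivial Euler factors there. They are harmless: |p^(-s)| \<le> 2^(-1/4) < 1 for every prime
  once Re s > 1/4.\<close>

lemma euler_factor_bounds:
  fixes h :: "nat \<Rightarrow> complex"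
  assumes h: "\<And>n. norm (h n) \<le> 1"
  obtains K :: real where "K \<ge> 0"
    "\<And>s. Re s > 1/4 \<Longrightarrow> (\<Prod>p\<in>prime_factors q. 1 - h p * dpow s p) \<noteq> 0"
    "\<And>s. Re s > 1/4 \<Longrightarrow> norm ((\<Prod>p\<in>prime_factors q. 1 - dpow s p) / (\<Prod>p\<in>prime_factors q. 1 - h p * dpow s p)) \<le> K"
proof -
  define r where "r = (2::real) powr (- (1/4))"
  have r: "r < 1" unfolding r_def by (rule powr_less_one) auto
  have dp: "norm (dpow s p) \<le> r" if "p \<in> prime_factors q" "Re s > 1/4" for s p
  proof -
    have p: "p \<ge> 2" using that(1) by (auto simp: in_prime_factors_iff prime_ge_2_nat)
    then have "norm (dpow s p) = real p powr (- Re s)" by (simp add: norm_dpow)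
    also have "\<dots> \<le> real p powr (- (1/4))" using that p by (intro powr_mono) auto
    also have "\<dots> \<le> r" unfolding r_def using p by (intro powr_mono2') auto
    finally show ?thesis .
  qed
  have low: "norm (1 - h p * dpow s p) \<ge> 1 - r" if "p \<in> prime_factors q" "Re s > 1/4" for s p
  proof -
    have "norm (h p * dpow s p) \<le> 1 * r" unfolding norm_mult by (intro mult_mono h dp that) auto
    then show ?thesis using norm_triangle_ineq2[of 1 "h p * dpow s p"] by simp
  qed
  have le: "norm ((\<Prod>p\<in>prime_factors q. 1 - dpow s p) / (\<Prod>p\<in>prime_factors q. 1 - h p * dpow s p)) \<le> (\<Prod>p\<in>prime_factors q. 2 / (1 - r))" if s: "Re s > 1/4" for s
    unfolding prod_dividef[symmetric] prod_norm[symmetric]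
  proof (rule prod_mono)
    fix p assume p: "p \<in> prime_factors q"
    have "norm (1 - dpow s p) \<le> 2" using norm_triangle_ineq4[of 1 "dpow s p"] dp[OF p s] r by simp
    then show "0 \<le> norm ((1 - dpow s p) / (1 - h p * dpow s p)) \<and> norm ((1 - dpow s p) / (1 - h p * dpow s p)) \<le> 2 / (1 - r)"
      unfolding norm_divide using low[OF p s] r by (auto intro!: frac_le)
  qed
  show ?thesis
  proof (rule that[OF _ _ le])
    show "(\<Prod>p\<in>prime_factors q. 2 / (1 - r)) \<ge> 0" using r by (intro prod_nonneg) auto
    fix s :: complex assume s: "Re s > 1/4"
    have "1 - h p * dpow s p \<noteq> 0" if "p \<in> prime_factors q" for p using low[OF that s] r by auto
    then show "(\<Prod>p\<in>prime_factors q. 1 - h p * dpow s p) \<noteq> 0" by simp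
  qed
qed

lemma small_summatory_contradiction:
  fixes q :: nat and chi :: "nat \<Rightarrow> complex" and g f :: "nat \<Rightarrow> int"
  assumes chi: "dirichlet_character q chi" "real_character chi" "chi \<noteq> principal_character q"
    and g: "is_char_extension q chi g" and f: "f = (\<lambda>n. (moebius_mu n)\<^sup>2 * g n)"
    and small: "\<And>c. c > 0 \<Longrightarrow> \<exists>B\<ge>0. \<forall>n>0. \<bar>\<Sum>k=1..n. real_of_int (f k)\<bar> \<le> c * real n powr (1/4) + B"
  shows False
proof -
  have q: "q > 0" using chi(1) by (simp add: dirichlet_character_def)
  obtain d h \<tau> where d: "d > 1" and per: "\<And>n. h (n + d) = h n" and mult: "\<And>m n. h (m * n) = h m * h n" and hv: "\<And>n. h n \<in> {-1, 0, 1}"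
    and h0: "h 0 = 0" and h1: "h 1 = 1" and hchi: "\<And>n. coprime n q \<Longrightarrow> h n = chi n" and \<tau>: "\<tau> \<noteq> 0"
    and hat: "\<And>m. (\<Sum>k<d. h k * cis (2 * pi * real k * real m / real d)) = \<tau> * h m"
    by (rule primitive_real_character[OF chi]) (rule that)
  have h: "norm (h n) \<le> 1" for n using hv[of n] by auto
  obtain a :: nat where a: "a \<le> 1" and parity: "\<And>n. n \<le> d \<Longrightarrow> h (d - n) = (-1) ^ a * h n"
    using primitive_character_parity[where h = h and d = d, OF d per mult h0 h1] by blast
  have d0: "d > 0" using d by simp
  define \<kappa> where "\<kappa> = (- \<i>) ^ a * \<tau> / of_real (sqrt d)"
  have \<kappa>: "\<kappa> \<noteq> 0" using \<tau> d by (simp add: \<kappa>_def)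
  define L where "L s = (\<Sum>n. h (Suc n) * dpow s (Suc n))" for s
  define P where "P s = of_real (pi / real d) powr (- ((s + of_nat a) / 2))" for s :: complex
  obtain \<Lambda> where Lhol: "\<Lambda> holomorphic_on UNIV" and Lfe: "\<And>s. \<Lambda> (1 - s) = \<kappa> * \<Lambda> s"
    and Lstrip: "\<And>R. \<exists>B. \<forall>s. \<bar>Re s\<bar> \<le> R \<longrightarrow> norm (\<Lambda> s) \<le> B"
    and Lform: "\<And>s. Re s > 1 \<Longrightarrow> \<Lambda> s = Gamma ((s + of_nat a) / 2) * P s * L s"
    by (rule completed_L_function[where h = h and d = d and a = a and \<tau> = \<tau>, OF d0 periodic_mod[where h = h and d = d, OF per] a h0 parity hat h,
      folded \<kappa>_def L_def P_def]) (assumption | rule that)+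
  obtain \<Xi> where Xhol: "\<Xi> holomorphic_on UNIV" and Xfe: "\<And>s. \<Xi> (1/2 - s) = \<Xi> s" and Xhalf: "\<Xi> (1/2) = 1/2"
    and Xform: "\<And>s. Re s > 1/2 \<Longrightarrow> \<Xi> s = s * (2 * s - 1) * Gamma s * of_real pi powr (- s) * zet (2 * s)"
    by (rule completed_zeta_function) (rule that)
  define M where "M n = (\<Sum>k=1..n. real_of_int (f k))" for n
  have MB: "\<exists>B\<ge>0. \<forall>n>0. \<bar>M n\<bar> \<le> c * real n powr (1/4) + B" if "c > 0" for c
    using small[OF that] unfolding M_def .
  obtain B1 where B1: "B1 \<ge> 0" "\<And>n. n > 0 \<Longrightarrow> \<bar>M n\<bar> \<le> 1 * real n powr (1/4) + B1" using MB[of 1] by auto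
  define A where "A s = (\<Prod>p\<in>prime_factors q. 1 - dpow s p)" for s
  define E where "E s = (\<Prod>p\<in>prime_factors q. 1 - h p * dpow s p)" for s
  obtain K where K: "K \<ge> 0" and E0: "\<And>s. Re s > 1/4 \<Longrightarrow> E s \<noteq> 0" and AE: "\<And>s. Re s > 1/4 \<Longrightarrow> norm (A s / E s) \<le> K"
    using euler_factor_bounds[where h = h and q = q, OF h] unfolding A_def[symmetric] E_def[symmetric] by blast
  \<comment> \<open>\<open>U\<close> gathers the exponential factors of both completions and A / E
    the correction at the primes of \<open>q\<close>; with these, \<open>k\<close> is what remains
    of the series of \<open>f\<close> in the identity \<open>kL\<close>.\<close>
  define U where "U s = P s * of_real pi powr s" for s
  define k where "k s = U s * Fs M s * (A s / E s)" for s
  have f1: "\<bar>real_of_int (f n)\<bar> \<le> 1" for n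
  proof (cases "n = 0")
    case False
    then have "g n = 1 \<or> g n = -1" using g by (auto simp: is_char_extension_def)
    moreover have "moebius_mu n \<in> {-1, 0, 1}" by (auto simp: moebius_mu_def minus_one_power_iff)
    ultimately show ?thesis by (auto simp: f)
  qed (simp add: f moebius_mu_def)
  have FL: "Fs M s * zet (2 * s) * A s = L s * E s" if s: "Re s > 1" for s
  proof -
    have "Fs M s = infsum (\<lambda>n. of_real (real_of_int (f n)) * dpow s n) {1..}"
      unfolding M_def[abs_def] by (rule Fs_abel[OF B1(2)[unfolded M_def] _ B1(1) s f1]) auto
    also have "\<dots> = infsum (\<lambda>n. of_real (real_of_int ((moebius_mu n)\<^sup>2 * g n)) * dpow s n) {1..}" unfolding f ..
    finally show ?thesis using moebius_twist_series[OF g q mult h1 hchi h s] unfolding A_def E_def L_def by simp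
  qed
  have pI: "z \<notin> \<int>\<^sub>\<le>\<^sub>0" if "Re z > 0" for z :: complex using that by (auto elim!: nonpos_Ints_cases)
  have nI: "(s + of_nat a) / 2 \<notin> \<int>\<^sub>\<le>\<^sub>0" "s \<notin> \<int>\<^sub>\<le>\<^sub>0" if "Re s > 0" for s
    using that by (auto intro!: pI simp del: divide_eq_eq_numeral1)
  have Fhol: "Fs M holomorphic_on {s. Re s > 1/4}" by (rule Fs_holomorphic[OF B1(2) _ B1(1)]) auto
  have khol: "k holomorphic_on {s. Re s > 1/4}"
    unfolding k_def[abs_def] U_def P_def A_def E_def dpow_def
    by (intro holomorphic_intros Fhol) (use E0 d0 in \<open>auto simp: E_def dpow_def\<close>)
  \<comment> \<open>All series converge for Re s > 1, where the identity is a computation; both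
    sides are holomorphic for Re s > 1/4, so it continues there.\<close>
  have kL: "\<Lambda> s * (s * (2 * s - 1) * Gamma s) = \<Xi> s * Gamma ((s + of_nat a) / 2) * k s" if s: "Re s > 1/4" for s
  proof (rule analytic_continuation_open[where s = "{s. Re s > 1}" and s' = "{s. Re s > 1/4}" and
        f = "\<lambda>s. \<Lambda> s * (s * (2 * s - 1) * Gamma s)" and g = "\<lambda>s. \<Xi> s * Gamma ((s + of_nat a) / 2) * k s"])
    show "open {s. Re s > 1}" "open {s. Re s > 1/4}" by (rule open_halfspace_Re_gt)+
    show "connected {s. Re s > 1/4}" by (intro convex_connected convex_halfspace_Re_gt)
    show "{s. Re s > 1} \<noteq> {}" by (auto intro!: exI[of _ 2])
    show "(\<lambda>s. \<Lambda> s * (s * (2 * s - 1) * Gamma s)) holomorphic_on {s. Re s > 1/4}"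
      by (intro holomorphic_intros holomorphic_on_subset[OF Lhol]) (use nI in auto)
    show "(\<lambda>s. \<Xi> s * Gamma ((s + of_nat a) / 2) * k s) holomorphic_on {s. Re s > 1/4}"
      by (intro holomorphic_intros holomorphic_on_subset[OF Xhol] khol holomorphic_on_compose_gen[unfolded o_def, OF _ holomorphic_Gamma]) (use nI in auto)
    fix z assume "z \<in> {s. Re s > 1}"
    then have z: "Re z > 1" by simp
    have Ez: "E z \<noteq> 0" using E0[of z] z by simp
    have pp: "of_real pi powr (- z) * of_real pi powr z = (1::complex)" by (simp add: powr_minus)
    have "\<Xi> z * Gamma ((z + of_nat a) / 2) * k z = z * (2 * z - 1) * Gamma z * Gamma ((z + of_nat a) / 2) * P z * (of_real pi powr (- z) * of_real pi powr z) * ((Fs M z * zet (2 * z) * A z) / E z)"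
      using Xform[of z] z by (simp add: k_def U_def)
    also have "\<dots> = z * (2 * z - 1) * Gamma z * Gamma ((z + of_nat a) / 2) * P z * L z"
      unfolding FL[OF z] pp using Ez by simp
    also have "\<dots> = \<Lambda> z * (z * (2 * z - 1) * Gamma z)" using Lform[OF z] by simp
    finally show "\<Lambda> z * (z * (2 * z - 1) * Gamma z) = \<Xi> z * Gamma ((z + of_nat a) / 2) * k z" ..
  qed (use s in auto)
  \<comment> \<open>Stated for all \<open>c\<close> and \<open>B\<close> because it is used twice:
    with c = 1 for the bound on the strip, and with c tending to 0 for the limit on the
    line.\<close>
  have kle: "norm (k s) * (Re s - 1/4) \<le> (norm (U s) * K) * (norm s * (c * (Re s - 1/4 + 1) + 5 * B * (Re s - 1/4)))"
    if s: "Re s > 1/4" and c: "c > 0" and B: "B \<ge> 0" "\<And>n. n > 0 \<Longrightarrow> \<bar>M n\<bar> \<le> c * real n powr (1/4) + B" for s c B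
  proof -
    define y where "y = Re s - 1/4"
    have y: "y > 0" using s by (simp add: y_def)
    have "norm (Fs M s) \<le> norm s * (c * (1 + 1 / y) + 5 * B)"
      unfolding y_def by (rule Fs_bound(2)[OF B(2) _ B(1) s]) (use c in auto)
    then have "norm (Fs M s) * y \<le> norm s * (c * (1 + 1 / y) + 5 * B) * y" using y by (intro mult_right_mono) auto
    also have "\<dots> = norm s * (c * (y + 1) + 5 * B * y)" using y by (simp add: field_simps)
    finally have F: "norm (Fs M s) * y \<le> norm s * (c * (y + 1) + 5 * B * y)" .
    have "norm (k s) * y = norm (U s) * norm (A s / E s) * (norm (Fs M s) * y)" by (simp only: k_def norm_mult mult_ac)
    also have "\<dots> \<le> norm (U s) * K * (norm s * (c * (y + 1) + 5 * B * y))"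
      by (intro mult_mono F AE[OF s] order_refl) (use y K in auto)
    finally show ?thesis by (simp add: y_def)
  qed
  have Ub: "expb S (\<lambda>s. norm (U s))" for S
    unfolding U_def P_def norm_mult
    by (rule expb_mult[OF expb_powr[where u = "-1/2" and v = "- of_nat a / 2"] expb_powr[where u = 1 and v = 0]]) (auto simp: field_simps)
  have Vb: "expb S (\<lambda>s. (norm (U s) * K) * (0 + norm s))" for S
    by (rule expb_mult[OF expb_mult[OF Ub expb_const] expb_norm]) (use K in auto)
  have kbd: "expb {s. 1/4 < Re s \<and> Re s \<le> 2} (\<lambda>s. norm (k s) * (Re s - 1/4))"
  proof (rule expb_mono[OF expb_mult[OF Vb[of UNIV] expb_const[of _ "3 + 10 * B1"]]])
    fix s assume "s \<in> {s. 1/4 < Re s \<and> Re s \<le> 2}"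
    then have s: "1/4 < Re s" "Re s \<le> 2" by auto
    have "norm (k s) * (Re s - 1/4) \<le> (norm (U s) * K) * (norm s * (1 * (Re s - 1/4 + 1) + 5 * B1 * (Re s - 1/4)))"
      by (rule kle[OF s(1) _ B1]) simp
    also have "\<dots> \<le> (norm (U s) * K) * (norm s * (3 + 10 * B1))"
    proof (intro mult_left_mono)
      have "B1 * (Re s - 1/4) \<le> B1 * 2" using s B1(1) by (intro mult_left_mono) auto
      then show "1 * (Re s - 1/4 + 1) + 5 * B1 * (Re s - 1/4) \<le> 3 + 10 * B1" using s by simp
    qed (use K in auto)
    finally show "norm (k s) * (Re s - 1/4) \<le> (norm (U s) * K) * (0 + norm s) * (3 + 10 * B1)" by (simp add: mult_ac)
  qed (use K B1 in auto)
  have klim: "((\<lambda>e. e * norm (k (Complex (1/4 + e) t))) \<longlongrightarrow> 0) (at_right 0)" for t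
  proof (rule tendstoI)
    fix \<epsilon> :: real assume \<epsilon>: "\<epsilon> > 0"
    obtain C where C: "C \<ge> 0" "\<And>s. (norm (U s) * K) * (0 + norm s) \<le> exp (C * (1 + norm s))" using Vb[of UNIV] unfolding expb_def by blast
    define V where "V = exp (C * (1 + (2 + \<bar>t\<bar>)))"
    have V: "V > 0" by (simp add: V_def)
    \<comment> \<open>The bound tends to V c = \<epsilon> / 2 as e tends to 0. \<open>V\<close> is
      fixed before \<open>c\<close>, and \<open>B\<close> may then depend on \<open>c\<close> since
      it is multiplied by e.\<close>
    define c where "c = \<epsilon> / (2 * V)"
    have c: "c > 0" using V \<epsilon> by (simp add: c_def)
    obtain B where B: "B \<ge> 0" "\<And>n. n > 0 \<Longrightarrow> \<bar>M n\<bar> \<le> c * real n powr (1/4) + B" using MB[OF c] by blast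
    have le: "e * norm (k (Complex (1/4 + e) t)) \<le> V * (c * (e + 1) + 5 * B * e)" if e: "0 < e" "e < 1" for e
    proof -
      let ?s = "Complex (1/4 + e) t"
      have "norm ?s \<le> 2 + \<bar>t\<bar>" using cmod_le[of ?s] e by simp
      then have "exp (C * (1 + norm ?s)) \<le> V" unfolding V_def using C(1) by (simp add: mult_left_mono)
      then have V': "(norm (U ?s) * K) * norm ?s \<le> V" using C(2)[of ?s] by simp
      have "norm (k ?s) * (Re ?s - 1/4) \<le> (norm (U ?s) * K) * (norm ?s * (c * (Re ?s - 1/4 + 1) + 5 * B * (Re ?s - 1/4)))"
        by (rule kle[OF _ c B]) (use e in auto)
      then have "e * norm (k ?s) \<le> ((norm (U ?s) * K) * norm ?s) * (c * (e + 1) + 5 * B * e)" by (simp add: mult_ac)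
      also have "\<dots> \<le> V * (c * (e + 1) + 5 * B * e)" using V' c B e by (intro mult_right_mono) auto
      finally show ?thesis .
    qed
    have "((\<lambda>e. V * (c * (e + 1) + 5 * B * e)) \<longlongrightarrow> V * (c * (0 + 1) + 5 * B * 0)) (at_right 0)" by (intro tendsto_intros)
    moreover have "V * (c * (0 + 1) + 5 * B * 0) < \<epsilon>" using V \<epsilon> by (simp add: c_def)
    ultimately have "\<forall>\<^sub>F e in at_right 0. V * (c * (e + 1) + 5 * B * e) < \<epsilon>" by (rule order_tendstoD)
    moreover have "\<forall>\<^sub>F e in at_right (0::real). e > 0 \<and> e < 1" using eventually_at_right_real[of 0 1] by (auto elim: eventually_mono)
    ultimately show "\<forall>\<^sub>F e in at_right 0. dist (e * norm (k (Complex (1/4 + e) t))) 0 < \<epsilon>"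
    proof eventually_elim
      case (elim e)
      then show ?case using le[of e] by (simp add: dist_real_def)
    qed
  qed
  have Lgrow: "expb {s. Re s \<ge> 2} (\<lambda>s. norm (\<Lambda> s) / Gamma ((Re s + real a) / 2))"
  proof (rule expb_mono[OF expb_mult[OF expb_powr[where g = "\<lambda>s. - ((s + of_nat a) / 2)" and u = "-1/2" and v = "- of_nat a / 2" and w = "of_real (pi / real d)"] expb_const[of UNIV 2]]])
    fix s assume "s \<in> {s. Re s \<ge> 2}"
    then have s: "Re s \<ge> 2" by simp
    have w: "Re ((s + of_nat a) / 2) = (Re s + real a) / 2" by simp
    have G: "Gamma ((Re s + real a) / 2) > 0" using s by (intro Gamma_real_pos) simp
    have "norm (\<Lambda> s) = norm (Gamma ((s + of_nat a) / 2)) * norm (P s) * norm (L s)"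
      using Lform[of s] s by (simp add: norm_mult)
    also have "\<dots> \<le> Gamma ((Re s + real a) / 2) * norm (P s) * 2"
    proof (intro mult_mono order_refl)
      show "norm (Gamma ((s + of_nat a) / 2)) \<le> Gamma ((Re s + real a) / 2)"
        using norm_Gamma_le[of "(s + of_nat a) / 2"] s unfolding w by simp
      show "norm (L s) \<le> 2" unfolding L_def by (rule L_series_bounded[OF h s])
    qed (use G in auto)
    finally show "norm (\<Lambda> s) / Gamma ((Re s + real a) / 2) \<le> norm (of_real (pi / real d) powr (- ((s + of_nat a) / 2)) :: complex) * 2"
      using G unfolding P_def by (simp add: field_simps)
  qed (auto simp: field_simps)
  have Lnz: "\<Lambda> 2 \<noteq> 0"
  proof -
    have "Gamma ((2 + of_nat a) / 2 :: complex) \<noteq> 0" using nI(1)[of 2] by (simp add: Gamma_eq_zero_iff)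
    moreover have "P 2 \<noteq> 0" using d0 by (simp add: P_def)
    moreover have "L 2 \<noteq> 0" unfolding L_def by (rule L_series_nonzero[OF mult h1 h]) simp
    ultimately show ?thesis using Lform[of 2] by simp
  qed
  have "zero_cancellation \<Lambda> \<Xi> k \<kappa> 2 a"
    by (rule zero_cancellation.intro[OF Lhol Lfe \<kappa> Lstrip Lgrow Lnz Xhol Xfe completed_zeta_nonzero[OF Xhol Xhalf Xform]
      completed_zeta_lower[OF Xform] khol kL kbd klim a])
  then show False by (rule zero_cancellation.contradiction)
qed

theorem theorem1p2:
  fixes q :: nat and chi :: "nat \<Rightarrow> complex" and g f :: "nat \<Rightarrow> int"
  assumes "q \<ge> 3"
    and "dirichlet_character q chi"
    and "real_character chi"
    and "chi \<noteq> principal_character q"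
    and "is_char_extension q chi g"
    and "f = (\<lambda>n. (moebius_mu n)\<^sup>2 * g n)"
  shows "summatory f \<notin> o[at_top](\<lambda>x. x powr (1 / 4)) \<and>
         (\<exists>c>0. \<forall>X. \<exists>x\<ge>X. \<bar>summatory f x\<bar> \<ge> c * x powr (1 / 4))"
proof -
  have "\<exists>c>0. \<forall>X. \<exists>x\<ge>X. \<bar>summatory f x\<bar> \<ge> c * x powr (1 / 4)"
    using small_summatory_contradiction[OF assms(2-6)] summatory_small[of f] by blast
  then show ?thesis using omega_imp_not_smallo by blast
qed

end
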